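(* Let $(S,N,Z)$ be a structured semigroup such that $Z$ is symmetric. Then $a\mapsto\widetilde{a}$ is a universal bundle representation of $(S,N,Z)$ on the coset bundle $\rho_\mathcal{C}:\widetilde{\mathcal{C}}(S)\to\mathcal{C}(S)$, where $\widetilde{a}\in\mathcal{S}(\rho_\mathcal{C})$ denotes the slice-section with $\mathrm{dom}(\widetilde{a})=\mathcal{C}_a=\{C\in\mathcal{C}(S):a\in C\}$ such that, for all $C\in\mathcal{C}_a$, \[\widetilde{a}(C)=[a,C].\]
   Context: STRUCTURED SEMIGROUPS. A structured semigroup $(S,N,Z)$ consists of a semigroup $S$, a subsemigroup $N$ of $S$ and a subsemigroup $Z$ of $S$ with $Z\subseteq\mathsf{Z}(N)=\{z\in N:\forall n\in N\ (nz=zn)\}$, such that: (i) for all $a,b\in S$, $ab,ba\in Z$ implies $aZb\cup bZa\subseteq Z$; (ii) for all $a,b\in S$ and $n\in N$, if $abn=n=nab$ and $ab,ba\in Z$ then $bna\in N$. $Z$ is symmetric if for all $a,b\in S$, $ab\in Z$ implies $baba\in Z$. For $a,s,b\in S$: $a<_sb$ means $asb=a=bsa$, $as,sa\in N$ and $bs,sb\in Z$; $a<b$ means $a<_sb$ for some $s\in S$. For $A,B\subseteq S$: $AB=\{ab:a\in A,b\in B\}$, $A^<=\{b\in S:\exists a\in A\ (a<b)\}$ and $A^*=\{s\in S:\exists a\in A\,\exists b\in S\ (a<_sb)\}$. An atlas is an $A\subseteq S$ with $AA^*A\subseteq A\subseteq A^<$; a coset is a $C\subseteq S$ with $CC^*C\subseteq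 C=C^<$. For an atlas $A$, put $\mathsf{s}(A)=(A^*A)^<$, $\mathsf{r}(A)=(AA^* )^<$. $\mathcal{C}(S)$ is the set of non-empty cosets, an étale groupoid with inverse $C\mapsto C^*$, product $B\cdot C=(BC)^<$ defined when $\mathsf{s}(B)=\mathsf{r}(C)$, and the topology with subbasis $(\mathcal{C}_a)_{a\in S}$. COSET BUNDLE. For an atlas $A$, $\sim_A$ is the equivalence relation on $A^<$ given by $a\sim_Ab\Leftrightarrow\exists s,t\in A^*\ (sat=sbt)$. For $a\in A^<$, $[a,A]=(a^{\sim_A},A^<)$, where $a^{\sim_A}$ is the $\sim_A$-class of $a$. $\widetilde{\mathcal{C}}(S)=\{[c,C]:c\in C\in\mathcal{C}(S)\}$ is a groupoid under $[a,A][b,B]=[ab,AB]$ when $\mathsf{s}(A)=\mathsf{r}(B)$, $\rho_\mathcal{C}([a,A])=A^<$, and the topology on $\widetilde{\mathcal{C}}(S)$ is generated by the sets $\widetilde{\mathcal{C}}^s=\{[s,C]:s\in C\in\mathcal{C}(S)\}$ and $\widetilde{\mathcal{C}}_s=\rho_\mathcal{C}^{-1}[\mathcal{C}_s]$, $s\in S$. Then $\rho_\mathcal{C}$ is a groupoid bundle. GROUPOID BUNDLES. For a groupoid $G$, $G^0$ is its set of units, $\mathsf{s}(g)=g^{-1}g$, $\mathsf{r}(g)=gg^{-1}$, $gh$ is defined iff $\mathsf{s}(g)=\mathsf{r}(h)$. A slice is a subset on which $\mathsf{s}$ and $\mathsf{r}$ are injective. A topological groupoid (continuous inverse and product) is étale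 if $\mathsf{s}$ maps open subsets of $G$ to open subsets of $G$; no Hausdorff assumptions. $\mathcal{O}(X)$ denotes the open subsets of $X$; $\mathcal{B}(G)$ is the semigroup of open slices of $G$ under pointwise products. A groupoid bundle is a map $\pi:F\to G$ with $F$ a topological groupoid, $G$ an étale groupoid and $\pi$ an open continuous functor injective on units. A slice-section of $\pi$ is a continuous map $a$ into $F$ whose domain is an open slice of $G$ with $\pi(a(g))=g$ for $g\in\mathrm{dom}(a)$. $\mathcal{S}(\pi)$ is the semigroup of slice-sections under $ab(gh)=a(g)b(h)$ ($g\in\mathrm{dom}(a)$, $h\in\mathrm{dom}(b)$, $gh$ defined). MORPHISMS. A relation $\phi\subseteq G\times H$ is viewed as going from $H$ to $G$; $\phi^{-1}[G']=\{h:\exists g\in G'\,(g\mathrel\phi h)\}$. It is functorial if $g\mathrel\phi h$ implies $g^{-1}\mathrel\phi h^{-1}$, and $g\mathrel\phi h$, $g'\mathrel\phi h'$, $\mathsf{s}(h)=\mathsf{r}(h')$ imply $\mathsf{s}(g)=\mathsf{r}(g')$ and $gg'\mathrel\phi hh'$. A functorial $\phi$ is star-bijective if whenever $\mathsf{r}(g)\mathrel\phi h\in H^0$ there is precisely one $i\in H$ with $\mathsf{r}(i)=h$ and $g\mathrel\phi i$. A Zakrzewski morphism between étale groupoids is a star-bijective functorial $\phi\subseteq G\times H$ with $\phi^{-1}[O]$ open for all open $O\subseteq G$. For a groupoid bundle $\pi:F\to G$ and a Zakrzewski morphism $\phi\subseteq G\times G'$, $\phi^\pi F=\{(f,g')\in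 F\times G':\pi(f)\mathrel\phi g'\}$ is a topological groupoid (subspace topology) under $(f,g')(e,h')=(fe,g'h')$ when $g'h'$ is defined. A Zakrzewski-Pierce morphism from $\pi:F\to G$ to $\pi':F'\to G'$ is a pair $(\phi,\tau)$ with $\phi\subseteq G\times G'$ a Zakrzewski morphism and $\tau:\phi^\pi F\to F'$ a continuous functor with $\pi'(\tau(f,g'))=g'$ for all $(f,g')\in\phi^\pi F$. It is a Pierce morphism if $\phi$ is also a function (each $g'\in G'$ in the domain of $\phi$ is related to exactly one $g$, written $\phi(g')$). Each such pair yields a semigroup homomorphism $\tfrac{\tau}{\phi}:\mathcal{S}(\pi)\to\mathcal{S}(\pi')$ with $\mathrm{dom}(\tfrac{\tau}{\phi}(a))=\phi^{-1}[\mathrm{dom}(a)]$ and $\tfrac{\tau}{\phi}(a)(g')=\tau((a\circ\phi)(g'),g')$. REPRESENTATIONS. An étale representation of $(S,N,Z)$ on an étale groupoid $G$ is a semigroup homomorphism $\theta:S\to\mathcal{B}(G)$ with $\bigcup_{a\in S}\theta(a)=G$, $\theta[N]\subseteq\mathcal{O}(G^0)$ and such that $g\in\theta(a)$ implies $g\in\theta(b)$ for some $b<a$. A bundle representation of $(S,N,Z)$ on a groupoid bundle $\pi:F\to G$ is a semigroup homomorphism $\theta:S\to\mathcal{S}(\pi)$ such that $a\mapsto\mathrm{dom}(\theta(a))$ is an étale representation on $G$. A bundle representation $\mu:S\to\mathcal{S}(\pi)$ is universal if for every bundle representation $\theta:S\to\mathcal{S}(\pi')$ (on any groupoid bundle $\pi'$)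 there is a unique Pierce morphism $(\phi,\tau)$ from $\pi$ to $\pi'$ with $\theta=\tfrac{\tau}{\phi}\circ\mu$. *)

theory Defs
  imports "HOL-Analysis.Analysis" "HOL-Library.Set_Algebras" "HOL-Library.FuncSet"
begin

section \<open>Structured semigroups\<close>

text \<open>The ambient semigroup \<open>S\<close> is the type \<open>'a\<close>. On sets, \<open>A * B\<close> is the elementwise product of
  \<^theory>\<open>HOL-Library.Set_Algebras\<close>.\<close>

definition subsemigroup :: "'a::semigroup_mult set \<Rightarrow> bool" where
  "subsemigroup T \<longleftrightarrow> (\<forall>a\<in>T. \<forall>b\<in>T. a * b \<in> T)"

definition center :: "'a::semigroup_mult set \<Rightarrow> 'a set" where
  "center N = {z \<in> N. \<forall>n\<in>N. n * z = z * n}"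

definition structured_semigroup :: "'a::semigroup_mult set \<Rightarrow> 'a set \<Rightarrow> bool" where
  "structured_semigroup N Z \<longleftrightarrow>
     subsemigroup N \<and> subsemigroup Z \<and> Z \<subseteq> center N \<and>
     (\<forall>a b. a * b \<in> Z \<and> b * a \<in> Z \<longrightarrow> {a} * Z * {b} \<union> {b} * Z * {a} \<subseteq> Z) \<and>
     (\<forall>a b. \<forall>n\<in>N. a * b * n = n \<and> n = n * a * b \<and> a * b \<in> Z \<and> b * a \<in> Z \<longrightarrow> b * n * a \<in> N)"

definition symmetric_subset :: "'a::semigroup_mult set \<Rightarrow> bool" where
  "symmetric_subset Z \<longleftrightarrow> (\<forall>a b. a * b \<in> Z \<longrightarrow> b * a * b * a \<in> Z)"

text \<open>\<open>dom_by N Z a s b\<close> is \<open>a <\<^sub>s b\<close>, and \<open>dominated N Z a b\<close> is \<open>a < b\<close>.\<close>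

definition dom_by :: "'a::semigroup_mult set \<Rightarrow> 'a set \<Rightarrow> 'a \<Rightarrow> 'a \<Rightarrow> 'a \<Rightarrow> bool" where
  "dom_by N Z a s b \<longleftrightarrow>
     a * s * b = a \<and> a = b * s * a \<and> a * s \<in> N \<and> s * a \<in> N \<and> b * s \<in> Z \<and> s * b \<in> Z"

definition dominated :: "'a::semigroup_mult set \<Rightarrow> 'a set \<Rightarrow> 'a \<Rightarrow> 'a \<Rightarrow> bool" where
  "dominated N Z a b \<longleftrightarrow> (\<exists>s. dom_by N Z a s b)"

text \<open>\<open>up N Z A\<close> is \<open>A\<^sup><\<close>, and \<open>star N Z A\<close> is \<open>A\<^sup>*\<close>.\<close>

definition up :: "'a::semigroup_mult set \<Rightarrow> 'a set \<Rightarrow> 'a set \<Rightarrow> 'a set" where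
  "up N Z A = {b. \<exists>a\<in>A. dominated N Z a b}"

definition star :: "'a::semigroup_mult set \<Rightarrow> 'a set \<Rightarrow> 'a set \<Rightarrow> 'a set" where
  "star N Z A = {s. \<exists>a\<in>A. \<exists>b. dom_by N Z a s b}"

definition coset :: "'a::semigroup_mult set \<Rightarrow> 'a set \<Rightarrow> 'a set \<Rightarrow> bool" where
  "coset N Z C \<longleftrightarrow> C * star N Z C * C \<subseteq> C \<and> C = up N Z C"

definition cosets :: "'a::semigroup_mult set \<Rightarrow> 'a set \<Rightarrow> 'a set set" where
  "cosets N Z = {C. coset N Z C \<and> C \<noteq> {}}"


section \<open>Topological groupoids\<close>

text \<open>The underlying set of a groupoid is the space of its topology. The product is a total
  function of the type, but only its values on composable pairs are meaningful.\<close>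

record 'g gpd =
  gtop :: "'g topology"
  gmult :: "'g \<Rightarrow> 'g \<Rightarrow> 'g"
  ginv :: "'g \<Rightarrow> 'g"

abbreviation arr :: "'g gpd \<Rightarrow> 'g set" where
  "arr G \<equiv> topspace (gtop G)"

definition gsrc :: "'g gpd \<Rightarrow> 'g \<Rightarrow> 'g" where
  "gsrc G g = gmult G (ginv G g) g"

definition grng :: "'g gpd \<Rightarrow> 'g \<Rightarrow> 'g" where
  "grng G g = gmult G g (ginv G g)"

definition units :: "'g gpd \<Rightarrow> 'g set" where
  "units G = gsrc G ` arr G"

definition composable :: "'g gpd \<Rightarrow> ('g \<times> 'g) set" where
  "composable G = {(g, h). g \<in> arr G \<and> h \<in> arr G \<and> gsrc G g = grng G h}"

definition groupoid :: "'g gpd \<Rightarrow> bool" where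
  "groupoid G \<longleftrightarrow>
     (\<forall>g \<in> arr G. ginv G g \<in> arr G \<and> ginv G (ginv G g) = g \<and>
        gmult G (grng G g) g = g \<and> gmult G g (gsrc G g) = g) \<and>
     (\<forall>(g, h) \<in> composable G. gmult G g h \<in> arr G \<and>
        gsrc G (gmult G g h) = gsrc G h \<and> grng G (gmult G g h) = grng G g) \<and>
     (\<forall>g h k. (g, h) \<in> composable G \<and> (h, k) \<in> composable G \<longrightarrow>
        gmult G (gmult G g h) k = gmult G g (gmult G h k))"

definition topological_groupoid :: "'g gpd \<Rightarrow> bool" where
  "topological_groupoid G \<longleftrightarrow> groupoid G \<and>
     continuous_map (gtop G) (gtop G) (ginv G) \<and>
     continuous_map (subtopology (prod_topology (gtop G) (gtop G)) (composable G)) (gtop G)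
       (\<lambda>(g, h). gmult G g h)"

definition etale_groupoid :: "'g gpd \<Rightarrow> bool" where
  "etale_groupoid G \<longleftrightarrow> topological_groupoid G \<and> open_map (gtop G) (gtop G) (gsrc G)"

definition open_slices :: "'g gpd \<Rightarrow> 'g set set" where
  "open_slices G = {B. openin (gtop G) B \<and> inj_on (gsrc G) B \<and> inj_on (grng G) B}"

definition slice_mult :: "'g gpd \<Rightarrow> 'g set \<Rightarrow> 'g set \<Rightarrow> 'g set" where
  "slice_mult G B C = {gmult G g h | g h. g \<in> B \<and> h \<in> C \<and> (g, h) \<in> composable G}"

definition gfunctor :: "'f gpd \<Rightarrow> 'g gpd \<Rightarrow> ('f \<Rightarrow> 'g) \<Rightarrow> bool" where
  "gfunctor F G p \<longleftrightarrow> p ` arr F \<subseteq> arr G \<and>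
     (\<forall>(e, f) \<in> composable F.
        (p e, p f) \<in> composable G \<and> p (gmult F e f) = gmult G (p e) (p f))"


section \<open>Groupoid bundles\<close>

record ('f, 'g) gpd_bundle =
  total_gpd :: "'f gpd"
  base_gpd :: "'g gpd"
  proj :: "'f \<Rightarrow> 'g"

definition groupoid_bundle :: "('f, 'g) gpd_bundle \<Rightarrow> bool" where
  "groupoid_bundle \<pi> \<longleftrightarrow>
     topological_groupoid (total_gpd \<pi>) \<and> etale_groupoid (base_gpd \<pi>) \<and>
     continuous_map (gtop (total_gpd \<pi>)) (gtop (base_gpd \<pi>)) (proj \<pi>) \<and>
     open_map (gtop (total_gpd \<pi>)) (gtop (base_gpd \<pi>)) (proj \<pi>) \<and>
     gfunctor (total_gpd \<pi>) (base_gpd \<pi>) (proj \<pi>) \<and>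
     inj_on (proj \<pi>) (units (total_gpd \<pi>))"

definition slice_sections :: "('f, 'g) gpd_bundle \<Rightarrow> ('g \<rightharpoonup> 'f) set" where
  "slice_sections \<pi> = {a. dom a \<in> open_slices (base_gpd \<pi>) \<and>
     continuous_map (subtopology (gtop (base_gpd \<pi>)) (dom a)) (gtop (total_gpd \<pi>)) (\<lambda>g. the (a g)) \<and>
     (\<forall>g \<in> dom a. proj \<pi> (the (a g)) = g)}"

text \<open>The factorisation \<open>k = g h\<close> below is unique because the domains are slices.\<close>

definition section_mult :: "('f, 'g) gpd_bundle \<Rightarrow> ('g \<rightharpoonup> 'f) \<Rightarrow> ('g \<rightharpoonup> 'f) \<Rightarrow> ('g \<rightharpoonup> 'f)" where
  "section_mult \<pi> a b = (\<lambda>k.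
     if k \<in> slice_mult (base_gpd \<pi>) (dom a) (dom b)
     then Some (THE f. \<exists>g \<in> dom a. \<exists>h \<in> dom b. (g, h) \<in> composable (base_gpd \<pi>) \<and>
                 k = gmult (base_gpd \<pi>) g h \<and> f = gmult (total_gpd \<pi>) (the (a g)) (the (b h)))
     else None)"


section \<open>Morphisms\<close>

text \<open>A relation \<open>\<phi> \<subseteq> G \<times> H\<close> is viewed as going from \<open>H\<close> to \<open>G\<close>, so the preimage \<open>\<phi>\<inverse>[O]\<close> of
  \<open>O \<subseteq> G\<close> is \<open>\<phi> `` O\<close>, and \<open>\<phi>\<close> is a function when \<open>\<phi>\<inverse>\<close> is \<^const>\<open>single_valued\<close>.\<close>

definition functorial :: "'g gpd \<Rightarrow> 'h gpd \<Rightarrow> ('g \<times> 'h) set \<Rightarrow> bool" where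
  "functorial G H \<phi> \<longleftrightarrow>
     (\<forall>(g, h) \<in> \<phi>. (ginv G g, ginv H h) \<in> \<phi>) \<and>
     (\<forall>(g, h) \<in> \<phi>. \<forall>(g', h') \<in> \<phi>. gsrc H h = grng H h' \<longrightarrow>
        gsrc G g = grng G g' \<and> (gmult G g g', gmult H h h') \<in> \<phi>)"

definition star_bijective :: "'g gpd \<Rightarrow> 'h gpd \<Rightarrow> ('g \<times> 'h) set \<Rightarrow> bool" where
  "star_bijective G H \<phi> \<longleftrightarrow>
     (\<forall>g \<in> arr G. \<forall>h \<in> units H. (grng G g, h) \<in> \<phi> \<longrightarrow>
        (\<exists>!i. i \<in> arr H \<and> grng H i = h \<and> (g, i) \<in> \<phi>))"

definition zakrzewski_morphism :: "'g gpd \<Rightarrow> 'h gpd \<Rightarrow> ('g \<times> 'h) set \<Rightarrow> bool" where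
  "zakrzewski_morphism G H \<phi> \<longleftrightarrow> \<phi> \<subseteq> arr G \<times> arr H \<and>
     functorial G H \<phi> \<and> star_bijective G H \<phi> \<and>
     (\<forall>O'. openin (gtop G) O' \<longrightarrow> openin (gtop H) (\<phi> `` O'))"

definition pullback :: "('f, 'g) gpd_bundle \<Rightarrow> 'h gpd \<Rightarrow> ('g \<times> 'h) set \<Rightarrow> ('f \<times> 'h) gpd" where
  "pullback \<pi> H \<phi> =
     \<lparr> gtop = subtopology (prod_topology (gtop (total_gpd \<pi>)) (gtop H))
                {(f, h). (proj \<pi> f, h) \<in> \<phi>},
       gmult = (\<lambda>(f, g) (e, h). (gmult (total_gpd \<pi>) f e, gmult H g h)),
       ginv = (\<lambda>(f, h). (ginv (total_gpd \<pi>) f, ginv H h)) \<rparr>"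

text \<open>A map \<open>\<tau>\<close> defined on the pullback is represented by the total function taking the value
  \<^const>\<open>undefined\<close> elsewhere, so that equality of such functions is equality of maps.\<close>

definition zakrzewski_pierce_morphism ::
    "('f, 'g) gpd_bundle \<Rightarrow> ('e, 'h) gpd_bundle \<Rightarrow> ('g \<times> 'h) set \<Rightarrow> ('f \<times> 'h \<Rightarrow> 'e) \<Rightarrow> bool" where
  "zakrzewski_pierce_morphism \<pi> \<pi>' \<phi> \<tau> \<longleftrightarrow>
     zakrzewski_morphism (base_gpd \<pi>) (base_gpd \<pi>') \<phi> \<and>
     \<tau> \<in> extensional (arr (pullback \<pi> (base_gpd \<pi>') \<phi>)) \<and>
     continuous_map (gtop (pullback \<pi> (base_gpd \<pi>') \<phi>)) (gtop (total_gpd \<pi>')) \<tau> \<and>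
     gfunctor (pullback \<pi> (base_gpd \<pi>') \<phi>) (total_gpd \<pi>') \<tau> \<and>
     (\<forall>(f, h) \<in> arr (pullback \<pi> (base_gpd \<pi>') \<phi>). proj \<pi>' (\<tau> (f, h)) = h)"

definition pierce_morphism ::
    "('f, 'g) gpd_bundle \<Rightarrow> ('e, 'h) gpd_bundle \<Rightarrow> ('g \<times> 'h) set \<Rightarrow> ('f \<times> 'h \<Rightarrow> 'e) \<Rightarrow> bool" where
  "pierce_morphism \<pi> \<pi>' \<phi> \<tau> \<longleftrightarrow>
     zakrzewski_pierce_morphism \<pi> \<pi>' \<phi> \<tau> \<and> single_valued (\<phi>\<inverse>)"

text \<open>The map \<open>\<tau>/\<phi>\<close> on slice-sections; the \<open>g\<close> below is \<open>\<phi>(h)\<close> when \<open>\<phi>\<close> is a function.\<close>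

definition induced_section :: "('g \<times> 'h) set \<Rightarrow> ('f \<times> 'h \<Rightarrow> 'e) \<Rightarrow> ('g \<rightharpoonup> 'f) \<Rightarrow> ('h \<rightharpoonup> 'e)" where
  "induced_section \<phi> \<tau> a = (\<lambda>h.
     if h \<in> \<phi> `` dom a then Some (\<tau> (the (a (THE g. g \<in> dom a \<and> (g, h) \<in> \<phi>)), h)) else None)"


section \<open>Representations\<close>

definition etale_representation ::
    "'a::semigroup_mult set \<Rightarrow> 'a set \<Rightarrow> 'g gpd \<Rightarrow> ('a \<Rightarrow> 'g set) \<Rightarrow> bool" where
  "etale_representation N Z G \<theta> \<longleftrightarrow> etale_groupoid G \<and>
     (\<forall>a. \<theta> a \<in> open_slices G) \<and> (\<forall>a b. \<theta> (a * b) = slice_mult G (\<theta> a) (\<theta> b)) \<and>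
     (\<Union>a. \<theta> a) = arr G \<and>
     (\<forall>n\<in>N. openin (subtopology (gtop G) (units G)) (\<theta> n)) \<and>
     (\<forall>a. \<forall>g \<in> \<theta> a. \<exists>b. dominated N Z b a \<and> g \<in> \<theta> b)"

definition bundle_representation ::
    "'a::semigroup_mult set \<Rightarrow> 'a set \<Rightarrow> ('f, 'g) gpd_bundle \<Rightarrow> ('a \<Rightarrow> ('g \<rightharpoonup> 'f)) \<Rightarrow> bool" where
  "bundle_representation N Z \<pi> \<theta> \<longleftrightarrow> groupoid_bundle \<pi> \<and>
     (\<forall>a. \<theta> a \<in> slice_sections \<pi>) \<and> (\<forall>a b. \<theta> (a * b) = section_mult \<pi> (\<theta> a) (\<theta> b)) \<and>
     etale_representation N Z (base_gpd \<pi>) (\<lambda>a. dom (\<theta> a))"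

text \<open>HOL does not quantify over types inside a formula: the types \<open>'e\<close> and \<open>'h\<close> of the total and
  base groupoids of the competing bundles are parameters. Universality is the statement for
  arbitrary (i.e. schematic) \<open>'e\<close> and \<open>'h\<close>.\<close>

definition universal_bundle_representation ::
    "'e itself \<Rightarrow> 'h itself \<Rightarrow> 'a::semigroup_mult set \<Rightarrow> 'a set \<Rightarrow>
     ('f, 'g) gpd_bundle \<Rightarrow> ('a \<Rightarrow> ('g \<rightharpoonup> 'f)) \<Rightarrow> bool" where
  "universal_bundle_representation _ _ N Z \<pi> \<mu> \<longleftrightarrow> bundle_representation N Z \<pi> \<mu> \<and>
     (\<forall>(\<pi>' :: ('e, 'h) gpd_bundle) \<theta>. bundle_representation N Z \<pi>' \<theta> \<longrightarrow>
        (\<exists>!(\<phi>, \<tau>). pierce_morphism \<pi> \<pi>' \<phi> \<tau> \<and> \<theta> = induced_section \<phi> \<tau> \<circ> \<mu>))"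


section \<open>The coset bundle\<close>

definition cosets_at :: "'a::semigroup_mult set \<Rightarrow> 'a set \<Rightarrow> 'a \<Rightarrow> 'a set set" where
  "cosets_at N Z a = {C \<in> cosets N Z. a \<in> C}"

definition coset_groupoid :: "'a::semigroup_mult set \<Rightarrow> 'a set \<Rightarrow> 'a set gpd" where
  "coset_groupoid N Z =
     \<lparr> gtop = topology_generated_by (range (cosets_at N Z)),
       gmult = (\<lambda>B C. up N Z (B * C)),
       ginv = star N Z \<rparr>"

definition germ_rel :: "'a::semigroup_mult set \<Rightarrow> 'a set \<Rightarrow> 'a set \<Rightarrow> ('a \<times> 'a) set" where
  "germ_rel N Z A = {(a, b). a \<in> up N Z A \<and> b \<in> up N Z A \<and>
     (\<exists>s \<in> star N Z A. \<exists>t \<in> star N Z A. s * a * t = s * b * t)}"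

text \<open>\<open>germ N Z a A\<close> is \<open>[a, A]\<close>.\<close>

definition germ :: "'a::semigroup_mult set \<Rightarrow> 'a set \<Rightarrow> 'a \<Rightarrow> 'a set \<Rightarrow> 'a set \<times> 'a set" where
  "germ N Z a A = (germ_rel N Z A `` {a}, up N Z A)"

definition germs :: "'a::semigroup_mult set \<Rightarrow> 'a set \<Rightarrow> ('a set \<times> 'a set) set" where
  "germs N Z = {germ N Z c C | c C. c \<in> C \<and> C \<in> cosets N Z}"

text \<open>\<open>[a, A] [b, B] = [a b, A B]\<close>, which for composable germs does not depend on the
  representatives.\<close>

definition germ_mult ::
    "'a::semigroup_mult set \<Rightarrow> 'a set \<Rightarrow> 'a set \<times> 'a set \<Rightarrow> 'a set \<times> 'a set \<Rightarrow> 'a set \<times> 'a set" where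
  "germ_mult N Z p q = (THE r. \<exists>A \<in> cosets N Z. \<exists>B \<in> cosets N Z. \<exists>a\<in>A. \<exists>b\<in>B.
     p = germ N Z a A \<and> q = germ N Z b B \<and> r = germ N Z (a * b) (A * B))"

text \<open>The inverse is the one determined by the product: in a groupoid, \<open>p\<inverse>\<close> is the only \<open>q\<close> for
  which \<open>p q p = p\<close> and \<open>q p q = q\<close> are defined and hold. All products below are defined because
  \<open>q\<close> is required to lie over the inverse \<open>A\<^sup>*\<close> of the coset \<open>A\<close> below \<open>p\<close>.\<close>

definition germ_inv ::
    "'a::semigroup_mult set \<Rightarrow> 'a set \<Rightarrow> 'a set \<times> 'a set \<Rightarrow> 'a set \<times> 'a set" where
  "germ_inv N Z p = (THE q. q \<in> germs N Z \<and> snd q = star N Z (snd p) \<and>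
     germ_mult N Z (germ_mult N Z p q) p = p \<and> germ_mult N Z (germ_mult N Z q p) q = q)"

text \<open>The projection \<open>[a, A] \<mapsto> A\<^sup><\<close> is \<^const>\<open>snd\<close>.\<close>

definition coset_bundle ::
    "'a::semigroup_mult set \<Rightarrow> 'a set \<Rightarrow> ('a set \<times> 'a set, 'a set) gpd_bundle" where
  "coset_bundle N Z =
     \<lparr> total_gpd =
         \<lparr> gtop = topology_generated_by
             (range (\<lambda>s. {germ N Z s C | C. C \<in> cosets_at N Z s}) \<union>
              range (\<lambda>s. {p \<in> germs N Z. snd p \<in> cosets_at N Z s})),
           gmult = germ_mult N Z,
           ginv = germ_inv N Z \<rparr>,
       base_gpd = coset_groupoid N Z,
       proj = snd \<rparr>"

definition coset_section ::
    "'a::semigroup_mult set \<Rightarrow> 'a set \<Rightarrow> 'a \<Rightarrow> ('a set \<rightharpoonup> 'a set \<times> 'a set)" where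
  "coset_section N Z a = (\<lambda>C. if C \<in> cosets_at N Z a then Some (germ N Z a C) else None)"

end

theory Submission
  imports Defs
begin

text \<open>
  Let \<open>\<theta>\<close> be a bundle representation on \<open>\<pi>'\<close>. For an arrow \<open>h\<close> of the base of \<open>\<pi>'\<close>, the set
  \<open>C\<^sub>h\<close> of all \<open>a\<close> with \<open>h \<in> dom (\<theta> a)\<close> is a coset, and \<open>a \<mapsto> \<theta>(a)(h)\<close> is constant on the germs of
  \<open>C\<^sub>h\<close>: if \<open>s a t = s b t\<close> with \<open>s\<close> and \<open>t\<close> defined at the inverse of \<open>h\<close>, then the values of \<open>s\<close> and
  \<open>t\<close> there can be cancelled in the groupoid. So \<open>\<phi>(h) = C\<^sub>h\<close> and \<open>\<tau>([a, C\<^sub>h], h) = \<theta>(a)(h)\<close> define a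
  Pierce morphism that induces \<open>\<theta>\<close>, and reading the equation \<open>\<theta> = \<tau>/\<phi> \<circ> \<mu>\<close> first for domains and
  then for values shows that no other choice is possible
  (\<open>pierce_morphism_\<phi>\<tau>\<close>, \<open>induced_section_\<phi>\<tau>\<close>, \<open>pierce_morphism_unique\<close>).

  The longer part is that cosets and their germs form a groupoid bundle represented by
  \<open>a \<mapsto> (C \<mapsto> [a, C])\<close>. When \<open>a <\<^sub>s b\<close>, the elements \<open>bs\<close> and \<open>sb\<close> lie in \<open>Z\<close> and act as identities
  on \<open>a\<close>, so that \<open>s\<close> is an inverse of \<open>b\<close> as far as \<open>a\<close> can see. All computations use this together
  with the centrality of \<open>Z\<close> in \<open>N\<close> and the conjugation axioms. The decisive ones are
  \<open>dom_cancel_left\<close> and \<open>dom_cancel_right\<close>: an inverse \<open>x\<close> of a product \<open>bc\<close> becomes an inverse of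
  \<open>c\<close> when multiplied by \<open>b\<close>, and an inverse of \<open>b\<close> when multiplied by \<open>c\<close>. They show
  \<open>(BC)\<^sup>* \<subseteq> (C\<^sup>* B\<^sup>*)\<^sup><\<close> for composable cosets, hence that \<open>(BC)\<^sup><\<close> is a coset.

  Symmetry of \<open>Z\<close> enters through \<open>factorization\<close>: a coset that contains \<open>ab\<close> is the product of a
  coset containing \<open>a\<close> and one containing \<open>b\<close>. If \<open>d <\<^sub>s ab\<close>, the obvious inverse \<open>bs\<close> of \<open>a\<close>
  satisfies only \<open>a(bs) \<in> Z\<close>; symmetry makes \<open>bsabs\<close> an inverse on both sides. Factorization makes
  \<open>cosets_at\<close> multiplicative, and it also makes the source map open, since every unit near
  the source of \<open>C\<close> becomes the source of a coset near \<open>C\<close>.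

  Every germ is invertible, because \<open>c' <\<^sub>r c\<close> with \<open>c' \<in> C\<close> gives \<open>[c, C]\<inverse> = [r, C\<^sup>*]\<close>. That
  products of germs are well defined is again a matter of moving central elements:
  \<open>z a w = z a' w\<close> with \<open>w \<in> Z\<close> is passed across a factor \<open>b\<close> by means of
  \<open>w b (q b) = b (q w b)\<close>, where \<open>bq \<in> Z\<close>.
\<close>

section \<open>The calculus of domination\<close>

locale structured =
  fixes N Z :: "'a::semigroup_mult set"
  assumes structured: "structured_semigroup N Z"
begin

abbreviation dom_by_notation ("_ \<prec>[_] _" [51, 0, 51] 50) where
  "a \<prec>[s] b \<equiv> dom_by N Z a s b"

abbreviation up_notation ("_\<^sup>\<up>" [1000] 1000) where
  "A\<^sup>\<up> \<equiv> up N Z A"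

abbreviation star_notation ("_\<^sup>\<star>" [1000] 1000) where
  "A\<^sup>\<star> \<equiv> star N Z A"

lemma N_mult: "a \<in> N \<Longrightarrow> b \<in> N \<Longrightarrow> a * b \<in> N"
  using structured by (auto simp: structured_semigroup_def subsemigroup_def)

lemma Z_mult: "a \<in> Z \<Longrightarrow> b \<in> Z \<Longrightarrow> a * b \<in> Z"
  using structured by (auto simp: structured_semigroup_def subsemigroup_def)

lemma Z_N: "z \<in> Z \<Longrightarrow> z \<in> N"
  using structured by (auto simp: structured_semigroup_def center_def)

lemma ZN_commute: "z \<in> Z \<Longrightarrow> n \<in> N \<Longrightarrow> z * n = n * z"
  using structured by (auto simp: structured_semigroup_def center_def)

lemma ZN_commute_assoc:
  assumes "s * b \<in> Z" "c * t \<in> N"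
  shows "s * (b * (c * (t * x))) = c * (t * (s * (b * x)))"
    and "s * (b * (c * t)) = c * (t * (s * b))"
proof -
  show "s * (b * (c * (t * x))) = c * (t * (s * (b * x)))"
    using arg_cong[OF ZN_commute[OF assms], of "\<lambda>y. y * x"] by (simp only: mult.assoc)
  show "s * (b * (c * t)) = c * (t * (s * b))"
    using ZN_commute[OF assms] by (simp only: mult.assoc)
qed

lemma Z_conj: "a * b \<in> Z \<Longrightarrow> b * a \<in> Z \<Longrightarrow> z \<in> Z \<Longrightarrow> a * z * b \<in> Z"
proof -
  assume "a * b \<in> Z" "b * a \<in> Z" and z: "z \<in> Z"
  then have "{a} * Z * {b} \<subseteq> Z"
    using structured unfolding structured_semigroup_def by blast
  with z show "a * z * b \<in> Z" by (auto intro: set_times_intro)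
qed

lemma N_conj:
  "n \<in> N \<Longrightarrow> a * b * n = n \<Longrightarrow> n * a * b = n \<Longrightarrow> a * b \<in> Z \<Longrightarrow> b * a \<in> Z \<Longrightarrow> b * n * a \<in> N"
  using structured unfolding structured_semigroup_def by metis

lemma dom_byI:
  "a * s * b = a \<Longrightarrow> b * s * a = a \<Longrightarrow> a * s \<in> N \<Longrightarrow> s * a \<in> N \<Longrightarrow> b * s \<in> Z \<Longrightarrow> s * b \<in> Z \<Longrightarrow> a \<prec>[s] b"
  by (simp add: dom_by_def)

lemma dom_byD:
  assumes "a \<prec>[s] b"
  shows "a * s \<in> N" "s * a \<in> N" "b * s \<in> Z" "s * b \<in> Z"
  using assms by (auto simp: dom_by_def)

text \<open>The second and fourth equations are the first and third with a trailing factor; once products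
  are associated to the right, these are the rules that the simplifier needs.\<close>

lemma dom_by_eqs:
  assumes "a \<prec>[s] b"
  shows "a * (s * b) = a" "a * (s * (b * x)) = a * x" "b * (s * a) = a" "b * (s * (a * x)) = a * x"
proof -
  have e: "a * s * b = a" "b * s * a = a" using assms by (simp_all add: dom_by_def)
  show "a * (s * b) = a" "b * (s * a) = a" using e by (simp_all only: mult.assoc)
  show "a * (s * (b * x)) = a * x" "b * (s * (a * x)) = a * x"
    using arg_cong[OF e(1), of "\<lambda>y. y * x"] arg_cong[OF e(2), of "\<lambda>y. y * x"]
    by (simp_all only: mult.assoc)
qed

text \<open>The witness of the second relation serves for the composite: \<open>at = (as)(bt)\<close> and
  \<open>ta = (tb)(sa)\<close> are products of elements of \<open>N\<close>.\<close>

lemma dom_trans: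
  assumes ab: "a \<prec>[s] b" and bc: "b \<prec>[t] c"
  shows "a \<prec>[t] c"
proof (rule dom_byI)
  have a: "a = a * s * b" "a = b * s * a" using ab by (auto simp: dom_by_def)
  note E = dom_by_eqs[OF ab] dom_by_eqs[OF bc]
  have "a * t * c = a * (s * (b * (t * c)))" by (simp only: E(2) mult.assoc)
  also have "\<dots> = a" by (subst E(5)) (rule E)
  finally show "a * t * c = a" .
  have "c * t * a = c * (t * (b * (s * a)))" by (simp only: E(3) mult.assoc)
  also have "\<dots> = a" by (subst E(8)) (rule E)
  finally show "c * t * a = a" .
  have "a * t = (a * s) * (b * t)" by (subst a(1)) (simp add: mult.assoc)
  then show "a * t \<in> N" using ab bc by (simp add: N_mult dom_byD)
  have "t * a = (t * b) * (s * a)" by (subst a(2)) (simp add: mult.assoc)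
  then show "t * a \<in> N" using ab bc by (simp add: N_mult dom_byD)
  show "c * t \<in> Z" "t * c \<in> Z" using dom_byD[OF bc] by auto
qed

text \<open>Multiplying by \<open>N\<close> shrinks an element without changing what dominates it. That \<open>tnc \<in> N\<close> comes
  from conjugating \<open>n(ct)\<close>.\<close>

lemma dom_N_left:
  assumes d: "c \<prec>[t] u" and n: "n \<in> N"
  shows "n * c \<prec>[t] u"
proof (rule dom_byI)
  note D = dom_byD[OF d] and E = dom_by_eqs[OF d]
  have comm: "u * (t * (n * x)) = n * (u * (t * x))" for x
    using arg_cong[OF ZN_commute[OF D(3) n], of "\<lambda>y. y * x"] by (simp only: mult.assoc)
  show "n * c * t * u = n * c" by (simp add: mult.assoc E)
  show "u * t * (n * c) = n * c" by (simp add: mult.assoc E comm)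
  show "n * c * t \<in> N" using N_mult[OF n D(1)] by (simp add: mult.assoc)
  have "t * (n * (c * t)) * u \<in> N"
    using ZN_commute[OF D(3) N_mult[OF n D(1)]]
    by (intro N_conj D N_mult n) (simp_all add: mult.assoc E comm)
  then show "t * (n * c) \<in> N" by (simp add: mult.assoc E)
  show "u * t \<in> Z" "t * u \<in> Z" by (fact D)+
qed

lemma dom_N_right:
  assumes d: "c \<prec>[t] u" and n: "n \<in> N"
  shows "c * n \<prec>[t] u"
proof (rule dom_byI)
  note D = dom_byD[OF d] and E = dom_by_eqs[OF d]
  have comm: "t * (u * n) = n * (t * u)" "t * (u * (n * x)) = n * (t * (u * x))" for x
    using ZN_commute[OF D(4) n]
      arg_cong[OF ZN_commute[OF D(4) n], of "\<lambda>y. y * x"]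
    unfolding mult.assoc by - assumption+
  show "c * n * t * u = c * n" by (simp add: mult.assoc E comm[symmetric])
  show "u * t * (c * n) = c * n" by (simp add: mult.assoc E)
  show "t * (c * n) \<in> N" using N_mult[OF D(2) n] by (simp add: mult.assoc)
  have "u * (t * c * n) * t \<in> N"
    by (intro N_conj D N_mult n) (simp_all add: mult.assoc E comm[symmetric])
  then show "c * n * t \<in> N" by (simp add: mult.assoc E)
  show "u * t \<in> Z" "t * u \<in> Z" by (fact D)+
qed

text \<open>This exchanges an element with its inverse, and is what makes \<open>A\<^sup>*\<close> behave like \<open>A\<close>.\<close>

lemma dom_flip:
  assumes d: "a \<prec>[s] b" shows "s * a * s \<prec>[b] s"
  using dom_byD[OF d] dom_by_eqs[OF d] by (intro dom_byI) (simp_all add: mult.assoc)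

text \<open>That \<open>acts\<close> and \<open>tsac\<close> lie in \<open>N\<close> is where the conjugation axiom is needed: they are the conjugates
  \<open>b(sact)s\<close> and \<open>t(sact)d\<close> of \<open>(sa)(ct) \<in> N\<close>.\<close>

lemma dom_times:
  assumes ab: "a \<prec>[s] b" and cd: "c \<prec>[t] d"
  shows "a * c \<prec>[t * s] b * d"
proof (rule dom_byI)
  note D = dom_byD[OF ab] dom_byD[OF cd] and E = dom_by_eqs[OF ab] dom_by_eqs[OF cd]
  note c1 = ZN_commute_assoc[OF D(4,5)] and c2 = ZN_commute_assoc[OF D(7,2)]
  show "a * c * (t * s) * (b * d) = a * c"
    by (simp add: mult.assoc E c1[symmetric])
  show "b * d * (t * s) * (a * c) = a * c"
    by (simp add: mult.assoc E c2)
  have n: "s * a * (c * t) \<in> N" using D by (simp add: N_mult)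
  have "b * (s * a * (c * t)) * s \<in> N"
    by (intro N_conj D n) (simp_all add: mult.assoc E c1[symmetric])
  then show "a * c * (t * s) \<in> N" by (simp add: mult.assoc E)
  have "t * (s * a * (c * t)) * d \<in> N"
    by (intro N_conj D n) (simp_all add: mult.assoc E c2)
  then show "t * s * (a * c) \<in> N" by (simp add: mult.assoc E)
  show "b * d * (t * s) \<in> Z" using Z_conj[OF D(3,4,7)] by (simp add: mult.assoc)
  show "t * s * (b * d) \<in> Z" using Z_conj[OF D(8,7,4)] by (simp add: mult.assoc)
qed

text \<open>The factor \<open>us \<in> N\<close> that separates \<open>t\<close> from \<open>s\<close> need not act trivially on \<open>a\<close>. The witness \<open>sus\<close>
  carries it, and \<open>btb\<close> compensates for it. Combined with \<open>dom_inverse_above\<close>, which uses \<open>sus\<close> to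
  find an element below \<open>u\<close>, this yields \<open>A\<^sup>*\<^sup>< \<subseteq> A\<^sup>*\<close>.\<close>

lemma dom_inverse_shrink:
  assumes ab: "a \<prec>[s] b" and st: "s \<prec>[u] t"
  shows "a \<prec>[s * u * s] b * t * b"
proof (rule dom_byI)
  note D = dom_byD[OF ab] dom_byD[OF st] and E = dom_by_eqs[OF ab] dom_by_eqs[OF st]
  note c1 = ZN_commute_assoc[OF D(4,5)] and c2 = ZN_commute_assoc[OF D(3,6)]
  show "a * (s * u * s) * (b * t * b) = a"
    by (simp add: mult.assoc E c1[symmetric])
  show "b * t * b * (s * u * s) * a = a"
    by (simp add: mult.assoc E c2)
  show "a * (s * u * s) \<in> N" using N_mult[OF D(1,6)] by (simp add: mult.assoc)
  show "s * u * s * a \<in> N" using N_mult[OF D(5,2)] by (simp add: mult.assoc)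
  show "b * t * b * (s * u * s) \<in> Z"
    using Z_mult[OF D(3,3)] by (simp add: mult.assoc E c2)
  show "s * u * s * (b * t * b) \<in> Z"
    using Z_mult[OF D(4,4)] by (simp add: mult.assoc E c1[symmetric])
qed

lemma dom_inverse_above:
  assumes ab: "a \<prec>[s] b" and st: "s \<prec>[u] t"
  shows "a * (s * u * s) * a \<prec>[t] u"
proof -
  note D = dom_byD[OF ab] dom_byD[OF st] and E = dom_by_eqs[OF ab] dom_by_eqs[OF st]
  have comm: "u * (t * (a * (s * x))) = a * (s * x)" "u * (t * (a * s)) = a * s" for x
    by (simp_all add: ZN_commute_assoc[OF D(8,1)] E)
  have "t * (a * s) * u \<in> N"
    by (intro N_conj D) (simp_all add: mult.assoc E comm)
  then have "a * s * u \<prec>[t] u"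
    using D by (intro dom_byI) (simp_all add: mult.assoc E comm)
  from dom_N_right[OF this D(2)] show ?thesis by (simp add: mult.assoc)
qed

lemma dom_star_shrink:
  assumes ra: "a' \<prec>[r] a" and ab: "a \<prec>[s] b"
  shows "a' \<prec>[s * a * s] b * r * b"
proof (rule dom_byI)
  note D = dom_byD[OF ab] dom_byD[OF ra]  dom_byD[OF dom_trans[OF ra ab]]
  note E = dom_by_eqs[OF ab] dom_by_eqs[OF ra] dom_by_eqs[OF dom_trans[OF ra ab]]
  note c1 = ZN_commute_assoc[OF D(7,9)] and c2 = ZN_commute_assoc[OF D(3,1)]
    and c3 = ZN_commute_assoc[OF D(8,10)]
  show "a' * (s * a * s) * (b * r * b) = a'"
    by (simp add: mult.assoc E c1[symmetric])
  show "b * r * b * (s * a * s) * a' = a'"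
    by (simp add: mult.assoc E c2 c3)
  show "a' * (s * a * s) \<in> N" using N_mult[OF D(9,1)] by (simp add: mult.assoc)
  show "s * a * s * a' \<in> N" using N_mult[OF D(2,10)] by (simp add: mult.assoc)
  show "b * r * b * (s * a * s) \<in> Z"
    using Z_conj[OF D(3,4) Z_mult[OF D(8,4)]] by (simp add: mult.assoc E c2)
  show "s * a * s * (b * r * b) \<in> Z"
    using Z_conj[OF D(4,3,7)] by (simp add: mult.assoc E)
qed

text \<open>The new witness \<open>cx\<close> is \<open>x\<close>, an inverse of \<open>bc\<close>, with the inverse of \<open>c\<close> cancelled. The auxiliary
  element \<open>c'\<close> below \<open>c\<close> is what makes \<open>bc'q\<close> small enough for \<open>cq\<close> and \<open>qc\<close> to act as identities.\<close>

lemma dom_cancel_right: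
  assumes bc: "b * c \<prec>[x] d" and cc: "c' \<prec>[q] c"
  shows "b * c' * q \<prec>[c * x] d * q"
proof (rule dom_byI)
  note D = dom_byD[OF bc] dom_byD[OF cc] and E' = dom_by_eqs[OF bc, unfolded mult.assoc]
    and E = dom_by_eqs[OF cc]
  have "b * c * (q * c') \<prec>[x] d" using dom_N_right[OF bc D(6)] .
  then have bc': "b * c' \<prec>[x] d" by (simp add: mult.assoc E)
  note D' = dom_byD[OF bc'] and F = dom_by_eqs[OF bc', unfolded mult.assoc]
  have comm: "q * (c * (x * (b * c'))) = x * (b * c')"
    "q * (c * (x * (b * (c' * y)))) = x * (b * (c' * y))" for y
    using ZN_commute[OF D(8) D'(2)] by (metis mult.assoc E(1) E(2))+
  have n: "x * (b * c') \<in> N" by (rule D')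
  show "b * c' * q * (c * x) * (d * q) = b * c' * q"
    by (simp add: mult.assoc E F)
  show "d * q * (c * x) * (b * c' * q) = b * c' * q"
    by (simp add: mult.assoc F comm)
  show "b * c' * q * (c * x) \<in> N" using D'(1) by (simp add: mult.assoc E)
  have "c * (x * (b * c')) * q \<in> N"
    by (intro N_conj n D) (simp_all add: mult.assoc E comm)
  then show "c * x * (b * c' * q) \<in> N" by (simp add: mult.assoc)
  show "d * q * (c * x) \<in> Z"
    using Z_conj[OF D(3,4,8)] by (simp add: mult.assoc)
  show "c * x * (d * q) \<in> Z"
    using Z_conj[OF D(7,8,4)] by (simp add: mult.assoc)
qed

text \<open>The mirror image of \<open>dom_cancel_right\<close>.\<close>

lemma dom_cancel_left:
  assumes bc: "b * c \<prec>[x] d" and bb: "b' \<prec>[r] b"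
  shows "r * b' * c \<prec>[x * b] r * d"
proof (rule dom_byI)
  note D = dom_byD[OF bc] dom_byD[OF bb] and E = dom_by_eqs[OF bb]
  have "b' * r * (b * c) \<prec>[x] d" using dom_N_left[OF bc D(5)] .
  then have bc': "b' * c \<prec>[x] d" by (simp add: mult.assoc E)
  note D' = dom_byD[OF bc'] and F = dom_by_eqs[OF bc', unfolded mult.assoc]
  have comm: "b' * (c * (x * (b * r))) = b' * (c * x)"
    "b' * (c * (x * (b * (r * y)))) = b' * (c * (x * y))" for y
    using ZN_commute[OF D(7) D'(1)] by (metis mult.assoc E(3) E(4))+
  have n: "b' * c * x \<in> N" by (rule D')
  show "r * b' * c * (x * b) * (r * d) = r * b' * c"
    by (simp add: mult.assoc F comm)
  show "r * d * (x * b) * (r * b' * c) = r * b' * c"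
    by (simp add: mult.assoc E F)
  have "r * (b' * c * x) * b \<in> N"
    by (intro N_conj n D) (simp_all add: mult.assoc E comm)
  then show "r * b' * c * (x * b) \<in> N" by (simp add: mult.assoc)
  show "x * b * (r * b' * c) \<in> N" using D'(2) by (simp add: mult.assoc E)
  show "r * d * (x * b) \<in> Z"
    using Z_conj[OF D(8,7,3)] by (simp add: mult.assoc)
  show "x * b * (r * d) \<in> Z"
    using Z_conj[OF D(4,3,7)] by (simp add: mult.assoc)
qed

end


section \<open>Cosets\<close>

context structured begin

lemma upI: "a \<in> A \<Longrightarrow> a \<prec>[s] b \<Longrightarrow> b \<in> A\<^sup>\<up>"
  by (auto simp: up_def dominated_def)

lemma upE:
  assumes "b \<in> A\<^sup>\<up>"
  obtains a s where "a \<in> A" "a \<prec>[s] b" "s \<in> A\<^sup>\<star>"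
  using assms by (auto simp: up_def star_def dominated_def)

lemma up_timesE:
  assumes "z \<in> (A * B)\<^sup>\<up>"
  obtains x y s where "x \<in> A" "y \<in> B" "x * y \<prec>[s] z"
  using assms by (auto elim!: upE set_times_elim)

lemma starI: "a \<in> A \<Longrightarrow> a \<prec>[s] b \<Longrightarrow> s \<in> A\<^sup>\<star>"
  by (auto simp: star_def)

lemma starE:
  assumes "s \<in> A\<^sup>\<star>"
  obtains a b where "a \<in> A" "a \<prec>[s] b"
  using assms by (auto simp: star_def)

lemma up_mono: "A \<subseteq> B \<Longrightarrow> A\<^sup>\<up> \<subseteq> B\<^sup>\<up>"
  by (auto simp: up_def)

lemma star_mono: "A \<subseteq> B \<Longrightarrow> A\<^sup>\<star> \<subseteq> B\<^sup>\<star>"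
  by (auto simp: star_def)

lemma up_up_subset: "A\<^sup>\<up>\<^sup>\<up> \<subseteq> A\<^sup>\<up>"
  by (meson dom_trans subsetI upE upI)

lemma up_subset: "A \<subseteq> B\<^sup>\<up> \<Longrightarrow> A\<^sup>\<up> \<subseteq> B\<^sup>\<up>"
  using up_mono up_up_subset by blast

lemma up_times: "x \<in> A\<^sup>\<up> \<Longrightarrow> y \<in> B\<^sup>\<up> \<Longrightarrow> x * y \<in> (A * B)\<^sup>\<up>"
  by (meson dom_times set_times_intro upE upI)

lemma star_times: "s \<in> A\<^sup>\<star> \<Longrightarrow> t \<in> B\<^sup>\<star> \<Longrightarrow> t * s \<in> (A * B)\<^sup>\<star>"
  by (meson dom_times set_times_intro starE starI)

text \<open>Half of the atlas condition. It is inherited by products, up-closures and stars, and it allows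
  up-closures to be dropped inside products (\<open>up_up_times\<close>).\<close>

definition rounded :: "'a set \<Rightarrow> bool" where
  "rounded A \<longleftrightarrow> A \<subseteq> A\<^sup>\<up>"

lemma roundedE:
  assumes "rounded A" "a \<in> A"
  obtains a' s where "a' \<in> A" "a' \<prec>[s] a" "s \<in> A\<^sup>\<star>"
  using assms by (meson rounded_def subsetD upE)

lemma rounded_times: "rounded A \<Longrightarrow> rounded B \<Longrightarrow> rounded (A * B)"
  unfolding rounded_def by (auto elim!: set_times_elim intro!: up_times)

lemma rounded_up: "rounded A \<Longrightarrow> rounded (A\<^sup>\<up>)"
  unfolding rounded_def by (rule up_mono)

lemma up_up_times:
  assumes "rounded A" "rounded B"
  shows "(A\<^sup>\<up> * B\<^sup>\<up>)\<^sup>\<up> = (A * B)\<^sup>\<up>" "(A\<^sup>\<up> * B)\<^sup>\<up> = (A * B)\<^sup>\<up>" "(A * B\<^sup>\<up>)\<^sup>\<up> = (A * B)\<^sup>\<up>"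
proof -
  have A: "A \<subseteq> A\<^sup>\<up>" and B: "B \<subseteq> B\<^sup>\<up>" using assms by (auto simp: rounded_def)
  have le: "(A\<^sup>\<up> * B\<^sup>\<up>)\<^sup>\<up> \<subseteq> (A * B)\<^sup>\<up>"
    by (rule up_subset) (auto elim!: set_times_elim intro!: up_times)
  have "A * B \<subseteq> A\<^sup>\<up> * B" "A * B \<subseteq> A * B\<^sup>\<up>" "A\<^sup>\<up> * B \<subseteq> A\<^sup>\<up> * B\<^sup>\<up>" "A * B\<^sup>\<up> \<subseteq> A\<^sup>\<up> * B\<^sup>\<up>"
    using A B by (simp_all add: set_times_mono2)
  from this[THEN up_mono] le
  show "(A\<^sup>\<up> * B\<^sup>\<up>)\<^sup>\<up> = (A * B)\<^sup>\<up>" "(A\<^sup>\<up> * B)\<^sup>\<up> = (A * B)\<^sup>\<up>" "(A * B\<^sup>\<up>)\<^sup>\<up> = (A * B)\<^sup>\<up>"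
    by blast+
qed

text \<open>An element \<open>s\<close> of \<open>A\<^sup>*\<close> dominates \<open>sas\<close>, and \<open>sas\<close> is itself an inverse above some \<open>a' < a\<close>.\<close>

lemma rounded_star:
  assumes "rounded A" shows "rounded (A\<^sup>\<star>)"
  unfolding rounded_def
proof
  fix s assume "s \<in> A\<^sup>\<star>"
  then obtain a b where a: "a \<in> A" "a \<prec>[s] b" by (rule starE)
  obtain a' r where a': "a' \<in> A" "a' \<prec>[r] a" using assms a(1) by (rule roundedE)
  have "s * a * s \<in> A\<^sup>\<star>" using dom_star_shrink[OF a'(2) a(2)] a'(1) by (rule starI[rotated])
  then show "s \<in> A\<^sup>\<star>\<^sup>\<up>" using dom_flip[OF a(2)] by (rule upI)
qed

lemma star_up: "rounded A \<Longrightarrow> (A\<^sup>\<up>)\<^sup>\<star> = A\<^sup>\<star>"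
  by (meson dom_trans rounded_def starE starI star_mono subsetI subset_antisym upE)

lemma star_inverse_shrink: "s \<in> A\<^sup>\<star> \<Longrightarrow> s \<prec>[u] t \<Longrightarrow> s * u * s \<in> A\<^sup>\<star>"
  by (meson dom_inverse_shrink starE starI)

text \<open>For \<open>a <\<^sub>s b\<close> and \<open>s <\<^sub>u t\<close>, the witness for \<open>t \<in> A\<^sup>*\<close> is \<open>a(sus)a\<close>.\<close>

lemma star_up_closed:
  assumes A: "\<And>a s b. a \<in> A \<Longrightarrow> s \<in> A\<^sup>\<star> \<Longrightarrow> b \<in> A \<Longrightarrow> a * s * b \<in> A"
  shows "A\<^sup>\<star>\<^sup>\<up> \<subseteq> A\<^sup>\<star>"
proof
  fix t assume "t \<in> A\<^sup>\<star>\<^sup>\<up>"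
  then obtain s u where s: "s \<in> A\<^sup>\<star>" "s \<prec>[u] t" by (rule upE)
  then obtain a b where a: "a \<in> A" "a \<prec>[s] b" by (meson starE)
  have "a * (s * u * s) * a \<in> A" using A a(1) star_inverse_shrink[OF s] by blast
  then show "t \<in> A\<^sup>\<star>" using dom_inverse_above[OF a(2) s(2)] by (rule starI)
qed

lemma coset_iff:
  "coset N Z C \<longleftrightarrow> (\<forall>a\<in>C. \<forall>s\<in>C\<^sup>\<star>. \<forall>b\<in>C. a * s * b \<in> C) \<and> rounded C \<and> C\<^sup>\<up> \<subseteq> C"
  unfolding coset_def rounded_def
  by (auto elim!: set_times_elim intro: set_times_intro)

lemma cosetD:
  assumes "coset N Z C"
  shows "a \<in> C \<Longrightarrow> s \<in> C\<^sup>\<star> \<Longrightarrow> b \<in> C \<Longrightarrow> a * s * b \<in> C" "rounded C" "C\<^sup>\<up> = C"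
  using assms by (auto simp: coset_iff rounded_def)

lemma coset_upI: "coset N Z C \<Longrightarrow> a \<in> C \<Longrightarrow> a \<prec>[s] b \<Longrightarrow> b \<in> C"
  using cosetD(3) upI by blast

lemma cosetE:
  assumes "coset N Z C" "c \<in> C"
  obtains c' s where "c' \<in> C" "c' \<prec>[s] c" "s \<in> C\<^sup>\<star>"
  using assms by (meson cosetD(2) roundedE)

text \<open>Cosets arise as up-closures of sets that satisfy the ternary condition only up to
  domination, such as products of cosets.\<close>

lemma coset_of_up:
  assumes r: "rounded A" and A: "\<And>a s b. a \<in> A \<Longrightarrow> s \<in> A\<^sup>\<star> \<Longrightarrow> b \<in> A \<Longrightarrow> a * s * b \<in> A\<^sup>\<up>"
  shows "coset N Z (A\<^sup>\<up>)"
  unfolding coset_iff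
proof (intro conjI ballI)
  fix a s b assume "a \<in> A\<^sup>\<up>" "s \<in> A\<^sup>\<up>\<^sup>\<star>" "b \<in> A\<^sup>\<up>"
  moreover have "s \<in> A\<^sup>\<star>\<^sup>\<up>"
    using \<open>s \<in> A\<^sup>\<up>\<^sup>\<star>\<close> rounded_star[OF r] by (auto simp: star_up[OF r] rounded_def)
  ultimately have "a * s * b \<in> (A * A\<^sup>\<star> * A)\<^sup>\<up>" by (blast intro: up_times)
  also have "\<dots> \<subseteq> A\<^sup>\<up>" using A by (intro up_subset) (auto elim!: set_times_elim)
  finally show "a * s * b \<in> A\<^sup>\<up>" .
qed (use r rounded_up up_up_subset in auto)

lemma coset_star:
  assumes C: "coset N Z C" shows "coset N Z (C\<^sup>\<star>)"
  unfolding coset_iff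
proof (intro conjI ballI)
  show "rounded (C\<^sup>\<star>)" using C by (intro rounded_star cosetD)
  show "C\<^sup>\<star>\<^sup>\<up> \<subseteq> C\<^sup>\<star>" by (intro star_up_closed cosetD(1) C)
  fix s x t assume s: "s \<in> C\<^sup>\<star>" and t: "t \<in> C\<^sup>\<star>" and x: "x \<in> C\<^sup>\<star>\<^sup>\<star>"
  obtain a b where a: "a \<in> C" "a \<prec>[s] b" using s by (rule starE)
  obtain c d where c: "c \<in> C" "c \<prec>[t] d" using t by (rule starE)
  obtain u v where u: "u \<in> C\<^sup>\<star>" "u \<prec>[x] v" using x by (rule starE)
  have "c * u * a \<in> C" using C c(1) u(1) a(1) by (rule cosetD(1))
  moreover have "c * u * a \<prec>[s * x * t] d * v * b"
    using dom_times[OF dom_times[OF c(2) u(2)] a(2)] by (simp add: mult.assoc)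
  ultimately show "s * x * t \<in> C\<^sup>\<star>" by (rule starI)
qed

text \<open>For \<open>s <\<^sub>x t\<close> with \<open>s \<in> C\<^sup>*\<close>, the element \<open>a(sxs)a\<close> of \<open>C\<close> lies below \<open>x\<close>.\<close>

lemma coset_star_star:
  assumes C: "coset N Z C" shows "C\<^sup>\<star>\<^sup>\<star> = C"
proof (intro equalityI subsetI)
  fix x assume "x \<in> C\<^sup>\<star>\<^sup>\<star>"
  then obtain s t where s: "s \<in> C\<^sup>\<star>" "s \<prec>[x] t" by (rule starE)
  then obtain a b where a: "a \<in> C" "a \<prec>[s] b" by (meson starE)
  have "a * (s * x * s) * a \<in> C"
    using cosetD(1)[OF C] a(1) star_inverse_shrink[OF s] by blast
  with C show "x \<in> C" using dom_inverse_above[OF a(2) s(2)] by (rule coset_upI)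
next
  fix c assume "c \<in> C"
  then obtain c' r where c': "c' \<in> C" "c' \<prec>[r] c" by (meson C cosetE)
  then obtain c'' q where c'': "c'' \<in> C" "c'' \<prec>[q] c'" by (meson C cosetE)
  have "r * c' * r \<in> C\<^sup>\<star>" using c''(1) dom_star_shrink[OF c''(2) c'(2)] by (rule starI)
  then show "c \<in> C\<^sup>\<star>\<^sup>\<star>" using dom_flip[OF c'(2)] by (rule starI)
qed

lemma star_nonempty: "coset N Z C \<Longrightarrow> C \<noteq> {} \<Longrightarrow> C\<^sup>\<star> \<noteq> {}"
  by (metis cosetE ex_in_conv)

text \<open>Composability of \<open>B\<close> and \<open>C\<close>, phrased without up-closures. For non-empty cosets it is equivalent
  to the equality of the source of \<open>B\<close> and the range of \<open>C\<close> (\<open>src_eq_rng_if_matching\<close> and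
  \<open>matchingI\<close>), and it is the form in which composability is used.\<close>

definition matching :: "'a set \<Rightarrow> 'a set \<Rightarrow> bool" where
  "matching B C \<longleftrightarrow> coset N Z B \<and> coset N Z C \<and>
     (\<forall>s\<in>B\<^sup>\<star>. \<forall>b\<in>B. \<forall>c\<in>C. s * b * c \<in> C) \<and> (\<forall>b\<in>B. \<forall>c\<in>C. \<forall>t\<in>C\<^sup>\<star>. b * c * t \<in> B)"

lemma matchingD:
  assumes "matching B C"
  shows "coset N Z B" "coset N Z C"
    "s \<in> B\<^sup>\<star> \<Longrightarrow> b \<in> B \<Longrightarrow> c \<in> C \<Longrightarrow> s * b * c \<in> C"
    "b \<in> B \<Longrightarrow> c \<in> C \<Longrightarrow> t \<in> C\<^sup>\<star> \<Longrightarrow> b * c * t \<in> B"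
  using assms by (auto simp: matching_def)

lemma matching_star:
  assumes "coset N Z C" shows "matching (C\<^sup>\<star>) C" "matching C (C\<^sup>\<star>)"
  using assms coset_star[OF assms] cosetD(1)[OF assms] cosetD(1)[OF coset_star[OF assms]]
  by (auto simp: matching_def coset_star_star)

lemma matching_inverse_factors:
  assumes BC: "matching B C" and b: "b \<in> B" and c: "c \<in> C" and x: "b * c \<prec>[x] d"
  shows "x * b \<in> C\<^sup>\<star>" "c * x \<in> B\<^sup>\<star>"
proof -
  obtain b' r where b': "b' \<in> B" "b' \<prec>[r] b" "r \<in> B\<^sup>\<star>" using matchingD(1)[OF BC] b by (rule cosetE)
  show "x * b \<in> C\<^sup>\<star>"
    using matchingD(3)[OF BC b'(3,1) c] dom_cancel_left[OF x b'(2)] by (rule starI)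
  obtain c' q where c': "c' \<in> C" "c' \<prec>[q] c" "q \<in> C\<^sup>\<star>" using matchingD(2)[OF BC] c by (rule cosetE)
  show "c * x \<in> B\<^sup>\<star>"
    using matchingD(4)[OF BC b c'(1,3)] dom_cancel_right[OF x c'(2)] by (rule starI)
qed

text \<open>An inverse \<open>x\<close> of \<open>bc\<close> dominates \<open>x(bc)x = (xb)(cx)\<close>, and both factors are inverses of elements
  of \<open>C\<close> and \<open>B\<close>.\<close>

lemma matching_star_subset:
  assumes "matching B C" shows "(B * C)\<^sup>\<star> \<subseteq> (C\<^sup>\<star> * B\<^sup>\<star>)\<^sup>\<up>"
proof
  fix x assume "x \<in> (B * C)\<^sup>\<star>"
  then obtain b c d where bc: "b \<in> B" "c \<in> C" and x: "b * c \<prec>[x] d"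
    by (auto elim!: starE set_times_elim)
  have "(x * b) * (c * x) \<in> C\<^sup>\<star> * B\<^sup>\<star>"
    using matching_inverse_factors[OF assms bc x] by (rule set_times_intro)
  then show "x \<in> (C\<^sup>\<star> * B\<^sup>\<star>)\<^sup>\<up>"
    using dom_flip[OF x] by (intro upI) (simp_all add: mult.assoc)
qed

lemma matching_rounded: "matching B C \<Longrightarrow> rounded (B * C)"
  by (intro rounded_times cosetD(2) matchingD)

lemma coset_mult:
  assumes BC: "matching B C" shows "coset N Z ((B * C)\<^sup>\<up>)"
proof (rule coset_of_up)
  show r: "rounded (B * C)" using BC by (rule matching_rounded)
  have B: "coset N Z B" and C: "coset N Z C" using BC by (auto dest: matchingD)
  fix x s y assume x: "x \<in> B * C" and s: "s \<in> (B * C)\<^sup>\<star>" and y: "y \<in> B * C"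
  have "s \<in> (C\<^sup>\<star> * B\<^sup>\<star>)\<^sup>\<up>" using s matching_star_subset[OF BC] by blast
  with x y r have "x * s * y \<in> ((B * C) * (C\<^sup>\<star> * B\<^sup>\<star>) * (B * C))\<^sup>\<up>"
    by (intro up_times) (auto simp: rounded_def)
  also have "\<dots> \<subseteq> (B * C)\<^sup>\<up>"
  proof (rule up_mono, clarify elim!: set_times_elim)
    fix b c t u b2 c2 assume "b \<in> B" "c \<in> C" "t \<in> C\<^sup>\<star>" "u \<in> B\<^sup>\<star>" "b2 \<in> B" "c2 \<in> C"
    then have "(b * c * t) * (u * b2 * c2) \<in> B * C"
      using matchingD(3,4)[OF BC] by (intro set_times_intro)
    then show "b * c * (t * u) * (b2 * c2) \<in> B * C" by (simp add: mult.assoc)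
  qed
  finally show "x * s * y \<in> (B * C)\<^sup>\<up>" .
qed

lemma star_mult:
  assumes BC: "matching B C" shows "((B * C)\<^sup>\<up>)\<^sup>\<star> = (C\<^sup>\<star> * B\<^sup>\<star>)\<^sup>\<up>"
proof -
  have "((B * C)\<^sup>\<up>)\<^sup>\<star> = (B * C)\<^sup>\<star>" using matching_rounded[OF BC] by (rule star_up)
  moreover have "(C\<^sup>\<star> * B\<^sup>\<star>)\<^sup>\<up> \<subseteq> ((B * C)\<^sup>\<up>)\<^sup>\<star>\<^sup>\<up>"
    unfolding \<open>((B * C)\<^sup>\<up>)\<^sup>\<star> = (B * C)\<^sup>\<star>\<close>
    by (rule up_mono) (auto elim!: set_times_elim intro: star_times)
  ultimately show ?thesis
    using matching_star_subset[OF BC] cosetD(3)[OF coset_star[OF coset_mult[OF BC]]] by auto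
qed

abbreviation src :: "'a set \<Rightarrow> 'a set" where "src C \<equiv> (C\<^sup>\<star> * C)\<^sup>\<up>"
abbreviation rng :: "'a set \<Rightarrow> 'a set" where "rng C \<equiv> (C * C\<^sup>\<star>)\<^sup>\<up>"

lemma subset_src: "coset N Z C \<Longrightarrow> s \<in> C\<^sup>\<star> \<Longrightarrow> c \<in> C \<Longrightarrow> s * c \<in> src C"
  using matching_rounded[OF matching_star(1)] set_times_intro unfolding rounded_def by blast

lemma subset_rng: "coset N Z C \<Longrightarrow> s \<in> C\<^sup>\<star> \<Longrightarrow> c \<in> C \<Longrightarrow> c * s \<in> rng C"
  using matching_rounded[OF matching_star(2)] set_times_intro unfolding rounded_def by blast

lemma src_mult_subset: "coset N Z C \<Longrightarrow> c \<in> C \<Longrightarrow> e \<in> src C \<Longrightarrow> c * e \<in> C"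
proof -
  assume C: "coset N Z C" and "c \<in> C" "e \<in> src C"
  then have "c * e \<in> (C * (C\<^sup>\<star> * C))\<^sup>\<up>" using cosetD(2)[OF C] by (auto simp: rounded_def intro!: up_times)
  also have "\<dots> \<subseteq> C\<^sup>\<up>"
    using cosetD(1)[OF C] by (intro up_mono) (auto elim!: set_times_elim simp: mult.assoc)
  finally show "c * e \<in> C" using cosetD(3)[OF C] by simp
qed

lemma rng_mult_subset: "coset N Z C \<Longrightarrow> c \<in> C \<Longrightarrow> e \<in> rng C \<Longrightarrow> e * c \<in> C"
proof -
  assume C: "coset N Z C" and "c \<in> C" "e \<in> rng C"
  then have "e * c \<in> (C * C\<^sup>\<star> * C)\<^sup>\<up>" using cosetD(2)[OF C] by (auto simp: rounded_def intro!: up_times)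
  also have "\<dots> \<subseteq> C\<^sup>\<up>"
    using cosetD(1)[OF C] by (intro up_mono) (auto elim!: set_times_elim)
  finally show "e * c \<in> C" using cosetD(3)[OF C] by simp
qed

text \<open>Up to associativity, both unit laws of the groupoid of cosets.\<close>

lemma up_ternary: 
  assumes C: "coset N Z C" shows "(C * C\<^sup>\<star> * C)\<^sup>\<up> = C"
proof
  show "(C * C\<^sup>\<star> * C)\<^sup>\<up> \<subseteq> C"
    using cosetD(1)[OF C] by (subst (4) cosetD(3)[OF C, symmetric], intro up_mono) (auto elim!: set_times_elim)
  show "C \<subseteq> (C * C\<^sup>\<star> * C)\<^sup>\<up>"
  proof
    fix c assume "c \<in> C"
    then obtain c' r where c': "c' \<in> C" "c' \<prec>[r] c" "r \<in> C\<^sup>\<star>" by (meson C cosetE)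
    have "c' * r * c \<in> C * C\<^sup>\<star> * C" using c' \<open>c \<in> C\<close> by (intro set_times_intro)
    then show "c \<in> (C * C\<^sup>\<star> * C)\<^sup>\<up>"
      using c'(2) by (intro upI) (simp_all add: mult.assoc dom_by_eqs[OF c'(2)])
  qed
qed

text \<open>For \<open>m <\<^sub>r k\<close> with \<open>m\<close>, \<open>k \<in> N\<close>, also \<open>m <\<^sub>k r\<close>, because \<open>rk\<close> and \<open>kr\<close> commute with \<open>m\<close>. So every
  element of \<open>N\<close> in \<open>E\<close> lies in \<open>E\<^sup>*\<close> as well, and multiplication by such elements compares \<open>E\<close> with
  its source.\<close>

lemma unit_coset:
  assumes E: "coset N Z E" and n: "n \<in> E" "n \<in> N"
  shows "src E = E"
proof -
  have main: "k \<in> E\<^sup>\<star> \<and> (\<exists>m r. m \<prec>[r] k \<and> m \<in> N \<and> m \<in> E \<and> r \<in> E\<^sup>\<star>)" if k: "k \<in> E" "k \<in> N" for k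
  proof -
    obtain m r where m: "m \<in> E" "m \<prec>[r] k" "r \<in> E\<^sup>\<star>" using E k(1) by (rule cosetE)
    note D = dom_byD[OF m(2)] and eqs = dom_by_eqs[OF m(2)]
    have "m = (m * r) * k" by (simp add: mult.assoc eqs)
    then have mN: "m \<in> N" using N_mult D k(2) by metis
    have comm: "m * k * r = k * r * m" "r * k * m = m * (r * k)"
      using ZN_commute[OF D(3) mN] ZN_commute[OF D(4) mN] by (simp_all add: mult.assoc)
    have "m \<prec>[k] r"
      using D N_mult[OF mN k(2)] N_mult[OF k(2) mN]
      by (intro dom_byI) (simp_all only: comm, simp_all add: mult.assoc eqs)
    then show ?thesis using starI[OF m(1)] m mN by blast
  qed
  obtain m r where m: "m \<prec>[r] n" "m \<in> N" "m \<in> E" "r \<in> E\<^sup>\<star>" using main[OF n] by blast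
  have mstar: "m \<in> E\<^sup>\<star>" using main m by blast
  show "src E = E"
  proof
    show "src E \<subseteq> E"
    proof
      fix x assume "x \<in> src E"
      from this obtain s e q where s: "s \<in> E\<^sup>\<star>" "e \<in> E" "s * e \<prec>[q] x" by (rule up_timesE)
      have "n * (s * e) \<in> E" using cosetD(1)[OF E n(1) s(1,2)] by (simp add: mult.assoc)
      then show "x \<in> E" using dom_N_left[OF s(3) n(2)] by (rule coset_upI[OF E])
    qed
    show "E \<subseteq> src E"
    proof
      fix e assume "e \<in> E"
      then obtain e' q where e': "e' \<in> E" "e' \<prec>[q] e" by (meson E cosetE)
      have "r * (m * m * e') \<in> E\<^sup>\<star> * E" using cosetD(1)[OF E m(3) mstar e'(1)] m(4) by (intro set_times_intro)
      moreover have "(r * m) * m * e' \<prec>[q] e"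
        using dom_N_left[OF e'(2) N_mult[OF dom_byD(2)[OF m(1)] m(2)]] .
      ultimately show "e \<in> src E" by (intro upI[of "r * (m * m * e')"]) (simp_all add: mult.assoc)
    qed
  qed
qed

lemma src_meets_N:
  assumes "coset N Z C" "C \<noteq> {}" obtains n where "n \<in> src C" "n \<in> N"
  using assms by (metis cosetE dom_byD(2) ex_in_conv subset_src)

lemma src_coset: "coset N Z C \<Longrightarrow> coset N Z (src C)"
  and rng_coset: "coset N Z C \<Longrightarrow> coset N Z (rng C)"
  by (auto intro: coset_mult matching_star)

text \<open>Both inclusions multiply by an element of \<open>N\<close>: \<open>c'q\<close> moves an element of the source of \<open>B\<close>
  into \<open>C C\<^sup>*\<close>, and \<open>rb'\<close> moves one of the range of \<open>C\<close> into \<open>B\<^sup>* B\<close>.\<close>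

lemma src_eq_rng_if_matching:
  assumes BC: "matching B C" and ne: "B \<noteq> {}" "C \<noteq> {}"
  shows "src B = rng C"
proof
  have B: "coset N Z B" and C: "coset N Z C" using BC by (auto dest: matchingD)
  obtain b' b r where b: "b' \<in> B" "b \<in> B" "b' \<prec>[r] b" "r \<in> B\<^sup>\<star>" using B ne(1) by (metis cosetE ex_in_conv)
  obtain c' c q where c: "c' \<in> C" "c \<in> C" "c' \<prec>[q] c" "q \<in> C\<^sup>\<star>" using C ne(2) by (metis cosetE ex_in_conv)
  show "src B \<subseteq> rng C"
  proof
    fix x assume "x \<in> src B"
    then obtain s d p where s: "s \<in> B\<^sup>\<star>" "d \<in> B" "s * d \<prec>[p] x" by (rule up_timesE)
    have "s * d * c' * q \<in> C * C\<^sup>\<star>" using matchingD(3)[OF BC s(1,2) c(1)] c(4) by (intro set_times_intro)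
    moreover have "(s * d) * (c' * q) \<prec>[p] x" by (rule dom_N_right[OF s(3) dom_byD(1)[OF c(3)]])
    ultimately show "x \<in> rng C" by (intro upI) (simp_all add: mult.assoc)
  qed
  show "rng C \<subseteq> src B"
  proof
    fix x assume "x \<in> rng C"
    from this obtain d s p where s: "d \<in> C" "s \<in> C\<^sup>\<star>" "d * s \<prec>[p] x" by (rule up_timesE)
    have "r * (b' * d * s) \<in> B\<^sup>\<star> * B" using matchingD(4)[OF BC b(1) s(1,2)] b(4) by (intro set_times_intro)
    moreover have "(r * b') * (d * s) \<prec>[p] x" by (rule dom_N_left[OF s(3) dom_byD(2)[OF b(3)]])
    ultimately show "x \<in> src B" by (intro upI) (simp_all add: mult.assoc)
  qed
qed

lemma matchingI:
  assumes B: "coset N Z B" and C: "coset N Z C" and eq: "src B = rng C"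
  shows "matching B C"
  unfolding matching_def
proof (intro conjI ballI B C)
  show "s * b * c \<in> C" if "s \<in> B\<^sup>\<star>" "b \<in> B" "c \<in> C" for s b c
    using rng_mult_subset[OF C] subset_src[OF B] that eq by blast
  show "b * c * t \<in> B" if "b \<in> B" "c \<in> C" "t \<in> C\<^sup>\<star>" for b c t
    using src_mult_subset[OF B] subset_rng[OF C] that eq by (metis mult.assoc)
qed

lemma src_mult:
  assumes BC: "matching B C" and ne: "B \<noteq> {}"
  shows "src ((B * C)\<^sup>\<up>) = src C"
proof -
  have B: "coset N Z B" and C: "coset N Z C" using BC by (auto dest: matchingD)
  have r: "rounded B" "rounded C" "rounded (B\<^sup>\<star>)" "rounded (C\<^sup>\<star>)"
    using cosetD(2) B C coset_star by auto
  have "src ((B * C)\<^sup>\<up>) = ((C\<^sup>\<star> * B\<^sup>\<star>) * (B * C))\<^sup>\<up>"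
    unfolding star_mult[OF BC] using r by (intro up_up_times rounded_times)
  also have "\<dots> = src C"
  proof
    show "((C\<^sup>\<star> * B\<^sup>\<star>) * (B * C))\<^sup>\<up> \<subseteq> src C"
    proof (rule up_mono, clarify elim!: set_times_elim)
      fix t s b c assume "t \<in> C\<^sup>\<star>" "s \<in> B\<^sup>\<star>" "b \<in> B" "c \<in> C"
      then have "t * (s * b * c) \<in> C\<^sup>\<star> * C" using matchingD(3)[OF BC] by (intro set_times_intro)
      then show "t * s * (b * c) \<in> C\<^sup>\<star> * C" by (simp add: mult.assoc)
    qed
    obtain b' b q where b: "b' \<in> B" "b \<in> B" "b' \<prec>[q] b" "q \<in> B\<^sup>\<star>" using B ne by (metis cosetE ex_in_conv)
    show "src C \<subseteq> ((C\<^sup>\<star> * B\<^sup>\<star>) * (B * C))\<^sup>\<up>"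
    proof (rule up_subset, clarify elim!: set_times_elim)
      fix s c assume "s \<in> C\<^sup>\<star>" "c \<in> C"
      then obtain s' c' u v where s: "s' \<in> C\<^sup>\<star>" "s' \<prec>[u] s" and c: "c' \<in> C" "c' \<prec>[v] c"
        by (meson r roundedE)
      have "s' * (q * b' * c') \<prec>[v * u] s * c"
        by (intro dom_times s dom_N_left c dom_byD(2)[OF b(3)])
      moreover have "(s' * q) * (b' * c') \<in> (C\<^sup>\<star> * B\<^sup>\<star>) * (B * C)"
        using s c b by (intro set_times_intro)
      ultimately show "s * c \<in> ((C\<^sup>\<star> * B\<^sup>\<star>) * (B * C))\<^sup>\<up>"
        by (intro upI[of "(s' * q) * (b' * c')"]) (simp_all add: mult.assoc)
    qed
  qed
  finally show ?thesis .
qed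

lemma rng_star: "coset N Z C \<Longrightarrow> rng (C\<^sup>\<star>) = src C" "coset N Z C \<Longrightarrow> src (C\<^sup>\<star>) = rng C"
  by (simp_all add: coset_star_star)

lemma matching_star_star:
  assumes BC: "matching B C" shows "matching (C\<^sup>\<star>) (B\<^sup>\<star>)"
proof (cases "B = {} \<or> C = {}")
  case True
  then have "B\<^sup>\<star> = {} \<or> C\<^sup>\<star> = {}" by (auto simp: star_def)
  then show ?thesis using matchingD(1,2)[OF BC] coset_star by (auto simp: matching_def)
next
  case False
  then show ?thesis
    using matchingD(1,2)[OF BC] coset_star rng_star src_eq_rng_if_matching[OF BC]
    by (intro matchingI) auto
qed

lemma rng_mult:
  assumes BC: "matching B C" and ne: "C \<noteq> {}"
  shows "rng ((B * C)\<^sup>\<up>) = rng B"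
proof -
  have B: "coset N Z B" and C: "coset N Z C" using BC by (auto dest: matchingD)
  have m: "matching (C\<^sup>\<star>) (B\<^sup>\<star>)" using BC by (rule matching_star_star)
  have "((B * C)\<^sup>\<up>) = ((C\<^sup>\<star> * B\<^sup>\<star>)\<^sup>\<up>)\<^sup>\<star>"
    using star_mult[OF m] by (simp add: coset_star_star B C)
  then have "rng ((B * C)\<^sup>\<up>) = src ((C\<^sup>\<star> * B\<^sup>\<star>)\<^sup>\<up>)"
    using rng_star(1)[OF coset_mult[OF m]] by simp
  also have "\<dots> = rng B" using src_mult[OF m star_nonempty[OF C ne]] rng_star(2)[OF B] by simp
  finally show ?thesis .
qed

text \<open>A coset is determined by its source and any one of its elements; hence \<open>cosets_at N Z a\<close> is a slice. The
  explicit description of \<open>C\<close> in terms of its source is also what makes \<open>C\<close> depend continuously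
  on it.\<close>

lemma up_translate:
  assumes C: "coset N Z C" and a: "a \<in> C"
  shows "C = {x. \<exists>e s. e \<in> src C \<and> a * e \<prec>[s] x}"
proof safe
  fix b assume "b \<in> C"
  then obtain b' q where b: "b' \<in> C" "b' \<prec>[q] b" by (meson C cosetE)
  obtain a' r where a': "a' \<in> C" "a' \<prec>[r] a" "r \<in> C\<^sup>\<star>" using C a by (rule cosetE)
  have "a * (r * b') \<prec>[q] b"
    using dom_N_left[OF b(2) Z_N[OF dom_byD(3)[OF a'(2)]]] by (simp add: mult.assoc)
  then show "\<exists>e s. e \<in> src C \<and> a * e \<prec>[s] b" using subset_src[OF C a'(3) b(1)] by blast
next
  fix x e s assume "e \<in> src C" "a * e \<prec>[s] x"
  then show "x \<in> C" using src_mult_subset[OF C a] coset_upI[OF C] by blast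
qed

lemma slice_eq_rng:
  assumes B: "coset N Z B" and C: "coset N Z C" and a: "a \<in> B" "a \<in> C" and eq: "rng B = rng C"
  shows "B \<subseteq> C"
proof
  fix b assume "b \<in> B"
  then obtain b' q where b: "b' \<in> B" "b' \<prec>[q] b" by (meson B cosetE)
  obtain a' r where a': "a' \<in> B" "a' \<prec>[r] a" "r \<in> B\<^sup>\<star>" using B a(1) by (rule cosetE)
  have "b' * r \<in> rng C" using subset_rng[OF B a'(3) b(1)] eq by simp
  then have "(b' * r) * a \<in> C" by (rule rng_mult_subset[OF C a(2)])
  moreover have "(b' * r) * a \<prec>[q] b"
    using dom_N_right[OF b(2) Z_N[OF dom_byD(4)[OF a'(2)]]] by (simp add: mult.assoc)
  ultimately show "b \<in> C" by (rule coset_upI[OF C])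
qed


end

section \<open>Factorization of cosets\<close>

locale symmetric_structured = structured +
  assumes symmetric: "symmetric_subset Z"
begin

lemma Z_symmetric: "a * b \<in> Z \<Longrightarrow> b * a * b * a \<in> Z"
  using symmetric by (auto simp: symmetric_subset_def)

text \<open>Both \<open>a(bs)\<close> and \<open>(sa)b\<close> lie in \<open>Z\<close>, but \<open>(bs)a\<close> and \<open>b(sa)\<close> need not. By symmetry their squares
  do, so that \<open>bsabs\<close> and \<open>sabsa\<close> are two-sided inverses of \<open>a\<close> and \<open>b\<close>.\<close>

lemma dom_factors:
  assumes d: "d \<prec>[s] a * b"
  shows "d * s * a \<prec>[b * s * a * b * s] a" "b * s * d \<prec>[s * a * b * s * a] b"
proof -
  note D = dom_byD[OF d] and E = dom_by_eqs[OF d, unfolded mult.assoc]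
  have p: "b * s * a * (b * s * a) \<in> Z" "a * (b * s) * (a * (b * s)) \<in> Z"
    using Z_symmetric[of a "b * s"] Z_mult[OF D(3,3)] D(3) by (simp_all add: mult.assoc)
  have q: "b * (s * a) * (b * (s * a)) \<in> Z" "s * a * b * (s * a * b) \<in> Z"
    using Z_symmetric[of "s * a" b] Z_mult[OF D(4,4)] D(4) by (simp_all add: mult.assoc)
  have "(b * s * a * b * s) * (d * s) * a \<in> N"
    by (intro N_conj D) (use p in \<open>simp_all add: mult.assoc E\<close>)
  then have bsdsa: "b * s * d * s * a \<in> N" by (simp add: mult.assoc E)
  show "d * s * a \<prec>[b * s * a * b * s] a"
    by (rule dom_byI) (use p D bsdsa in \<open>simp_all add: mult.assoc E\<close>)
  show "b * s * d \<prec>[s * a * b * s * a] b"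
    by (rule dom_byI) (use q D bsdsa in \<open>simp_all add: mult.assoc E\<close>)
qed

text \<open>Since \<open>s\<close> is an inverse of \<open>ab\<close>, \<open>sa\<close> plays the role of the inverse of \<open>b\<close>, and \<open>bs\<close> that of \<open>a\<close>.
  The factors are therefore \<open>B = (D sa)\<^sup><\<close> and \<open>C = (bs D)\<^sup><\<close>.\<close>

lemma factorization:
  assumes D: "coset N Z D" and ab: "a * b \<in> D"
  obtains B C where "matching B C" "a \<in> B" "b \<in> C" "D = (B * C)\<^sup>\<up>"
proof -
  obtain d s where d: "d \<in> D" "d \<prec>[s] a * b" and s: "s \<in> D\<^sup>\<star>" using D ab by (rule cosetE)
  obtain s' u where s': "s' \<in> D\<^sup>\<star>" "s' \<prec>[u] s" and u: "u \<in> D\<^sup>\<star>\<^sup>\<star>" using coset_star[OF D] s by (rule cosetE)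
  have uD: "u \<in> D" using u coset_star_star[OF D] by simp
  have tern: "x * t * y \<in> D" if "x \<in> D" "t \<in> D\<^sup>\<star>" "y \<in> D" for x t y using cosetD(1)[OF D] that .
  have sabs: "s * (a * b) * s \<in> D\<^sup>\<star>"
    using cosetD(1)[OF coset_star[OF D]] s ab coset_star_star[OF D] by simp
  have mulD: "x * s * a * b * s * y \<in> D" if "x \<in> D" "y \<in> D" for x y
    using tern[OF that(1) sabs that(2)] by (simp add: mult.assoc)
  define X where "X = (\<lambda>x. x * s * a) ` D"
  define Y where "Y = (\<lambda>y. b * s * y) ` D"
  note below = dom_factors[OF d(2)]
  \<comment> \<open>If \<open>x\<close> is an inverse of an element of \<open>D sa\<close>, then \<open>sax\<close> is one of an element of \<open>D\<close>.\<close>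
  have starX: "s * a * x \<in> D\<^sup>\<star>" if x: "y \<in> D" "y * s * a \<prec>[x] e" for x y e
  proof -
    have "s' * (d * s * a) \<prec>[b * s * a * b * s * u] s * a"
      using dom_times[OF s'(2) below(1)] .
    from dom_cancel_right[OF _ this, of y x e] x(2)
    have "y * (s' * (d * s * a)) * (b * s * a * b * s * u) \<prec>[s * a * x] e * (b * s * a * b * s * u)"
      by (simp add: mult.assoc)
    moreover have "y * s' * d * s * u \<in> D" using tern[OF tern[OF x(1) s'(1) d(1)] s uD] .
    moreover have "y * (s' * (d * s * a)) * (b * s * a * b * s * u) = y * s' * d * s * u"
      by (simp add: mult.assoc dom_by_eqs[OF d(2), unfolded mult.assoc])
    ultimately show ?thesis by (metis starI)
  qed
  have starY: "x * b * s \<in> D\<^sup>\<star>" if x: "y \<in> D" "b * s * y \<prec>[x] e" for x y e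
  proof -
    have "(b * s * d) * s' \<prec>[u * (s * a * b * s * a)] b * s"
      using dom_times[OF below(2) s'(2)] .
    from dom_cancel_left[OF x(2) this]
    have "u * (s * a * b * s * a) * (b * s * d * s') * y \<prec>[x * (b * s)] u * (s * a * b * s * a) * e" .
    moreover have "u * s * d * s' * y \<in> D" using tern[OF tern[OF uD s d(1)] s'(1) x(1)] .
    moreover have "u * (s * a * b * s * a) * (b * s * d * s') * y = u * s * d * s' * y"
      by (simp add: mult.assoc dom_by_eqs[OF d(2), unfolded mult.assoc])
    ultimately show ?thesis by (metis starI mult.assoc)
  qed
  have rX: "rounded X" unfolding rounded_def
  proof
    fix z assume "z \<in> X"
    then obtain x where x: "x \<in> D" "z = x * s * a" by (auto simp: X_def)
    then obtain x' q where x': "x' \<in> D" "x' \<prec>[q] x" by (meson D cosetE)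
    have "x' * s' * d * s * a \<in> X" using tern[OF x'(1) s'(1) d(1)] by (auto simp: X_def)
    moreover have "x' * s' * (d * s * a) \<prec>[b * s * a * b * s * (u * q)] z"
      unfolding x(2) by (intro dom_times x' s' below)
    ultimately show "z \<in> X\<^sup>\<up>" by (intro upI) (simp_all add: mult.assoc)
  qed
  have rY: "rounded Y" unfolding rounded_def
  proof
    fix z assume "z \<in> Y"
    then obtain x where x: "x \<in> D" "z = b * s * x" by (auto simp: Y_def)
    then obtain x' q where x': "x' \<in> D" "x' \<prec>[q] x" by (meson D cosetE)
    have "b * s * (d * s' * x') \<in> Y" using tern[OF d(1) s'(1) x'(1)] by (auto simp: Y_def)
    moreover have "(b * s * d) * (s' * x') \<prec>[(q * u) * (s * a * b * s * a)] b * (s * x)"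
      by (intro dom_times x' s' below)
    ultimately show "z \<in> Y\<^sup>\<up>" unfolding x(2) by (intro upI) (simp_all add: mult.assoc)
  qed
  have cX: "coset N Z (X\<^sup>\<up>)"
  proof (rule coset_of_up[OF rX])
    fix v x w assume v: "v \<in> X" and x: "x \<in> X\<^sup>\<star>" and w: "w \<in> X"
    obtain v' w' where v': "v' \<in> D" "v = v' * s * a" "w' \<in> D" "w = w' * s * a"
      using v w by (auto simp: X_def)
    obtain y e where "y \<in> D" "y * s * a \<prec>[x] e" using x by (auto simp: X_def elim!: starE)
    then have "v' * (s * a * x) * w' \<in> D" using tern v' starX by blast
    then have "v * x * w \<in> X" unfolding X_def v' by (auto simp: mult.assoc intro!: image_eqI)
    then show "v * x * w \<in> X\<^sup>\<up>" using rX by (auto simp: rounded_def)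
  qed
  have cY: "coset N Z (Y\<^sup>\<up>)"
  proof (rule coset_of_up[OF rY])
    fix v x w assume v: "v \<in> Y" and x: "x \<in> Y\<^sup>\<star>" and w: "w \<in> Y"
    obtain v' w' where v': "v' \<in> D" "v = b * s * v'" "w' \<in> D" "w = b * s * w'"
      using v w by (auto simp: Y_def)
    obtain y e where "y \<in> D" "b * s * y \<prec>[x] e" using x by (auto simp: Y_def elim!: starE)
    then have "v' * (x * b * s) * w' \<in> D" using tern v' starY by blast
    then have "v * x * w \<in> Y" unfolding Y_def v' by (auto simp: mult.assoc intro!: image_eqI)
    then show "v * x * w \<in> Y\<^sup>\<up>" using rY by (auto simp: rounded_def)
  qed
  have DD: "rounded D" "D\<^sup>\<up> = D" using cosetD[OF D] by auto
  have XY: "X * Y \<subseteq> D"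
    using mulD by (auto simp: X_def Y_def mult.assoc elim!: set_times_elim)
  have XYup: "(X * Y)\<^sup>\<up> = D"
  proof
    show "(X * Y)\<^sup>\<up> \<subseteq> D" using up_mono[OF XY] DD by simp
    show "D \<subseteq> (X * Y)\<^sup>\<up>"
    proof
      fix x assume "x \<in> D"
      then obtain x' q where x': "x' \<in> D" "x' \<prec>[q] x" by (meson D cosetE)
      have "(d * s * a) * (b * s * x') \<in> X * Y" using d x' by (auto simp: X_def Y_def intro!: set_times_intro)
      moreover have "d * s * x' \<prec>[q] x" by (rule dom_N_left[OF x'(2) dom_byD(1)[OF d(2)]])
      ultimately show "x \<in> (X * Y)\<^sup>\<up>"
        by (intro upI) (simp_all add: mult.assoc dom_by_eqs[OF d(2), unfolded mult.assoc])
    qed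
  qed
  \<comment> \<open>As \<open>(D sa)(bs D) \<subseteq> D\<close>, this and its dual below give the composability of the factors.\<close>
  have starXD: "x * y \<in> Y\<^sup>\<up>" if x: "x \<in> X\<^sup>\<star>" and y: "y \<in> D" for x y
  proof -
    obtain x' q where x': "x' \<in> X\<^sup>\<star>" "x' \<prec>[q] x" using rounded_star[OF rX] x by (rule roundedE)
    obtain y' r where y': "y' \<in> D" "y' \<prec>[r] y" using D y by (rule cosetE)
    have "s * a * x' \<in> D\<^sup>\<star>" using x'(1) starX by (auto simp: X_def elim!: starE)
    then have "d * (s * a * x') * y' \<in> D" using d y' by (intro tern)
    then have "b * s * (d * (s * a * x') * y') \<in> Y" by (auto simp: Y_def)
    moreover have "b * s * d * s * a \<in> N"
      using dom_byD(2)[OF below(1)] by (simp add: mult.assoc dom_by_eqs[OF d(2), unfolded mult.assoc])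
    then have "(b * s * d * s * a) * x' * y' \<prec>[r * q] x * y"
      by (intro dom_times dom_N_left x' y')
    ultimately show ?thesis by (intro upI) (simp_all add: mult.assoc)
  qed
  have starYD: "y * x \<in> X\<^sup>\<up>" if x: "x \<in> Y\<^sup>\<star>" and y: "y \<in> D" for x y
  proof -
    obtain x' q where x': "x' \<in> Y\<^sup>\<star>" "x' \<prec>[q] x" using rounded_star[OF rY] x by (rule roundedE)
    obtain y' r where y': "y' \<in> D" "y' \<prec>[r] y" using D y by (rule cosetE)
    have "x' * b * s \<in> D\<^sup>\<star>" using x'(1) starY by (auto simp: Y_def elim!: starE)
    then have "y' * (x' * b * s) * d \<in> D" using d y' by (intro tern)
    then have "y' * (x' * b * s) * d * s * a \<in> X" by (auto simp: X_def)
    moreover have "b * s * d * s * a \<in> N"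
      using dom_byD(2)[OF below(1)] by (simp add: mult.assoc dom_by_eqs[OF d(2), unfolded mult.assoc])
    then have "y' * (x' * (b * s * d * s * a)) \<prec>[q * r] y * x"
      by (intro dom_times dom_N_right x' y')
    ultimately show ?thesis by (intro upI) (simp_all add: mult.assoc)
  qed
  have XYrng: "X\<^sup>\<up> * Y\<^sup>\<up> \<subseteq> D"
    using up_up_times(1)[OF rX rY] XYup rounded_times[OF rounded_up[OF rX] rounded_up[OF rY]]
    by (auto simp: rounded_def)
  have "matching (X\<^sup>\<up>) (Y\<^sup>\<up>)"
    unfolding matching_def
  proof (intro conjI ballI cX cY)
    fix v x y assume "v \<in> X\<^sup>\<up>\<^sup>\<star>" "x \<in> X\<^sup>\<up>" "y \<in> Y\<^sup>\<up>"
    then have "v * (x * y) \<in> Y\<^sup>\<up>" using XYrng by (intro starXD) (auto simp: star_up[OF rX])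
    then show "v * x * y \<in> Y\<^sup>\<up>" by (simp add: mult.assoc)
  next
    fix v x y assume "x \<in> X\<^sup>\<up>" "y \<in> Y\<^sup>\<up>" "v \<in> Y\<^sup>\<up>\<^sup>\<star>"
    then show "x * y * v \<in> X\<^sup>\<up>" using XYrng by (intro starYD) (auto simp: star_up[OF rY])
  qed
  moreover have "a \<in> X\<^sup>\<up>" using below(1) d(1) by (intro upI) (auto simp: X_def)
  moreover have "b \<in> Y\<^sup>\<up>" using below(2) d(1) by (intro upI) (auto simp: Y_def)
  moreover have "D = (X\<^sup>\<up> * Y\<^sup>\<up>)\<^sup>\<up>" using up_up_times(1)[OF rX rY] XYup by simp
  ultimately show thesis using that by blast
qed

end


section \<open>Groupoids and functors\<close>

text \<open>Openness is always verified pointwise below, in this form.\<close>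

lemma openin_nbhds:
  "(\<And>x. x \<in> S \<Longrightarrow> \<exists>T. openin X T \<and> x \<in> T \<and> T \<subseteq> S) \<Longrightarrow> openin X S"
  by (subst openin_subopen) blast

lemma composableD:
  "(g, h) \<in> composable G \<Longrightarrow> g \<in> arr G" "(g, h) \<in> composable G \<Longrightarrow> h \<in> arr G"
  "(g, h) \<in> composable G \<Longrightarrow> gsrc G g = grng G h"
  by (auto simp: composable_def)

lemma composableI: "g \<in> arr G \<Longrightarrow> h \<in> arr G \<Longrightarrow> gsrc G g = grng G h \<Longrightarrow> (g, h) \<in> composable G"
  by (auto simp: composable_def)

lemma
  assumes G: "groupoid G"
  shows ginv_arr: "g \<in> arr G \<Longrightarrow> ginv G g \<in> arr G"
    and ginv_ginv: "g \<in> arr G \<Longrightarrow> ginv G (ginv G g) = g"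
    and gmult_grng_left: "g \<in> arr G \<Longrightarrow> gmult G (grng G g) g = g"
    and gmult_gsrc_right: "g \<in> arr G \<Longrightarrow> gmult G g (gsrc G g) = g"
    and gmult_arr: "(g, h) \<in> composable G \<Longrightarrow> gmult G g h \<in> arr G"
    and gsrc_gmult: "(g, h) \<in> composable G \<Longrightarrow> gsrc G (gmult G g h) = gsrc G h"
    and grng_gmult: "(g, h) \<in> composable G \<Longrightarrow> grng G (gmult G g h) = grng G g"
    and gmult_assoc: "(g, h) \<in> composable G \<Longrightarrow> (h, k) \<in> composable G \<Longrightarrow>
      gmult G (gmult G g h) k = gmult G g (gmult G h k)"
  using G unfolding groupoid_def by (blast | (auto; fail))+

lemma
  assumes G: "groupoid G" and g: "g \<in> arr G"
  shows gsrc_ginv: "gsrc G (ginv G g) = grng G g"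
    and grng_ginv: "grng G (ginv G g) = gsrc G g"
    and ginv_composable: "(ginv G g, g) \<in> composable G" "(g, ginv G g) \<in> composable G"
    and gsrc_arr: "gsrc G g \<in> arr G" and grng_arr: "grng G g \<in> arr G"
    and gsrc_gsrc: "gsrc G (gsrc G g) = gsrc G g" and grng_gsrc: "grng G (gsrc G g) = gsrc G g"
    and gsrc_grng: "gsrc G (grng G g) = grng G g"
proof -
  show 1: "gsrc G (ginv G g) = grng G g" and 2: "grng G (ginv G g) = gsrc G g"
    using ginv_ginv[OF G g] by (simp_all add: gsrc_def grng_def)
  show 3: "(ginv G g, g) \<in> composable G" and 4: "(g, ginv G g) \<in> composable G"
    using g ginv_arr[OF G g] 1 2 by (auto intro: composableI)
  show "gsrc G g \<in> arr G" "grng G g \<in> arr G"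
    using gmult_arr[OF G 3] gmult_arr[OF G 4] by (simp_all add: gsrc_def grng_def)
  show "gsrc G (gsrc G g) = gsrc G g" "grng G (gsrc G g) = gsrc G g"
    using gsrc_gmult[OF G 3] grng_gmult[OF G 3] 2 by (simp_all add: gsrc_def[of G g])
  show "gsrc G (grng G g) = grng G g"
    using gsrc_gmult[OF G 4] 1 by (simp add: grng_def[of G g])
qed

lemma unitsD:
  assumes G: "groupoid G" and u: "u \<in> units G"
  shows "u \<in> arr G" "gsrc G u = u" "grng G u = u"
proof -
  obtain g where g: "g \<in> arr G" "u = gsrc G g" using u by (auto simp: units_def)
  show "u \<in> arr G" "gsrc G u = u" "grng G u = u"
    using g gsrc_arr[OF G g(1)] gsrc_gsrc[OF G g(1)] grng_gsrc[OF G g(1)] by simp_all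
qed

lemma gsrc_units: "g \<in> arr G \<Longrightarrow> gsrc G g \<in> units G"
  by (simp add: units_def)

lemma grng_units: "groupoid G \<Longrightarrow> g \<in> arr G \<Longrightarrow> grng G g \<in> units G"
  by (metis ginv_arr gsrc_ginv gsrc_units)

lemma gmult_cancel_left:
  assumes G: "groupoid G" and gh: "(g, h) \<in> composable G"
  shows "gmult G (ginv G g) (gmult G g h) = h"
proof -
  have "gmult G (ginv G g) (gmult G g h) = gmult G (gmult G (ginv G g) g) h"
    using gmult_assoc[OF G ginv_composable(1)[OF G] gh] composableD[OF gh] by simp
  also have "\<dots> = h" using gmult_grng_left[OF G] composableD[OF gh] by (simp add: gsrc_def[symmetric])
  finally show ?thesis .
qed

lemma gmult_cancel_right:
  assumes G: "groupoid G" and gh: "(g, h) \<in> composable G"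
  shows "gmult G (gmult G g h) (ginv G h) = g"
proof -
  have "gmult G (gmult G g h) (ginv G h) = gmult G g (gmult G h (ginv G h))"
    using gmult_assoc[OF G gh ginv_composable(2)[OF G]] composableD[OF gh] by simp
  also have "\<dots> = g" using gmult_gsrc_right[OF G] composableD[OF gh] by (metis grng_def)
  finally show ?thesis .
qed

lemma gmult_unit_left:
  assumes G: "groupoid G" and "(u, g) \<in> composable G" "u \<in> units G" shows "gmult G u g = g"
  using assms gmult_grng_left[OF G, of g] unitsD[OF G, of u] composableD[of u g G] by metis

lemma gmult_unit_right:
  assumes G: "groupoid G" and "(g, u) \<in> composable G" "u \<in> units G" shows "gmult G g u = g"
  using assms gmult_gsrc_right[OF G, of g] unitsD[OF G, of u] composableD[of g u G] by metis

lemma ginv_unique: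
  assumes G: "groupoid G" and hg: "(h, g) \<in> composable G" and u: "gmult G h g \<in> units G"
  shows "h = ginv G g"
proof -
  have g: "g \<in> arr G" using hg by (rule composableD)
  have "h = gmult G (gmult G h g) (ginv G g)" using gmult_cancel_right[OF G hg] by simp
  also have "(gmult G h g, ginv G g) \<in> composable G"
    using gmult_arr[OF G hg] ginv_arr[OF G g] gsrc_gmult[OF G hg] grng_ginv[OF G g]
    by (auto intro: composableI)
  from gmult_unit_left[OF G this u] have "gmult G (gmult G h g) (ginv G g) = ginv G g" .
  finally show ?thesis .
qed

lemma idempotent_unit:
  assumes G: "groupoid G" and ee: "(e, e) \<in> composable G" and id: "gmult G e e = e"
  shows "e \<in> units G"
  using gmult_cancel_left[OF G ee] composableD(1)[OF ee] id gsrc_units by (metis gsrc_def)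

lemma gfunctorD:
  assumes "gfunctor F G p"
  shows "f \<in> arr F \<Longrightarrow> p f \<in> arr G" "(e, f) \<in> composable F \<Longrightarrow> (p e, p f) \<in> composable G"
    "(e, f) \<in> composable F \<Longrightarrow> p (gmult F e f) = gmult G (p e) (p f)"
  using assms by (auto simp: gfunctor_def)

lemma
  assumes F: "groupoid F" and G: "groupoid G" and p: "gfunctor F G p"
  shows gfunctor_gsrc: "f \<in> arr F \<Longrightarrow> p (gsrc F f) = gsrc G (p f)"
    and gfunctor_grng: "f \<in> arr F \<Longrightarrow> p (grng F f) = grng G (p f)"
proof -
  have u: "p u \<in> units G" if u: "u \<in> units F" for u
  proof -
    have uu: "(u, u) \<in> composable F" using unitsD[OF F u] by (auto intro: composableI)
    show ?thesis
      using idempotent_unit[OF G gfunctorD(2)[OF p uu]] gfunctorD(3)[OF p uu]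
        gmult_unit_left[OF F uu u] by simp
  qed
  have inv: "p (ginv F f) = ginv G (p f)" if f: "f \<in> arr F" for f
    using ginv_unique[OF G gfunctorD(2)[OF p ginv_composable(1)[OF F f]]]
      u[OF gsrc_units[OF f]] gfunctorD(3)[OF p ginv_composable(1)[OF F f]] by (simp add: gsrc_def)
  show "p (gsrc F f) = gsrc G (p f)" "p (grng F f) = grng G (p f)" if f: "f \<in> arr F"
    using gfunctorD(3)[OF p ginv_composable(1)[OF F f]] gfunctorD(3)[OF p ginv_composable(2)[OF F f]] inv[OF f]
    by (simp_all add: gsrc_def grng_def)
qed


section \<open>The groupoid of cosets\<close>

context structured begin

abbreviation CG :: "'a set gpd" where "CG \<equiv> coset_groupoid N Z"

lemma CG_simps [simp]:
  "gmult CG B C = (B * C)\<^sup>\<up>" "ginv CG C = C\<^sup>\<star>" "gsrc CG C = src C" "grng CG C = rng C"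
  by (simp_all add: coset_groupoid_def gsrc_def grng_def)

lemma cosets_iff: "C \<in> cosets N Z \<longleftrightarrow> coset N Z C \<and> C \<noteq> {}"
  by (simp add: cosets_def)

lemma cosets_at_iff [simp]: "C \<in> cosets_at N Z a \<longleftrightarrow> C \<in> cosets N Z \<and> a \<in> C"
  by (simp add: cosets_at_def)

lemma arr_CG [simp]: "arr CG = cosets N Z"
  by (auto simp: coset_groupoid_def cosets_iff)

lemma openin_CG: "openin (gtop CG) (cosets_at N Z a)"
  by (simp add: coset_groupoid_def topology_generated_by_Basis)

lemma openin_CG_star: "openin (gtop CG) {C \<in> cosets N Z. s \<in> C\<^sup>\<star>}"
proof (rule openin_nbhds, safe)
  fix C assume "C \<in> cosets N Z" "s \<in> C\<^sup>\<star>"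
  then obtain a b where "a \<in> C" "a \<prec>[s] b" by (meson starE)
  with \<open>C \<in> cosets N Z\<close> show "\<exists>T. openin (gtop CG) T \<and> C \<in> T \<and> T \<subseteq> {C \<in> cosets N Z. s \<in> C\<^sup>\<star>}"
    by (intro exI[of _ "cosets_at N Z a"]) (auto simp: openin_CG intro: starI)
qed

lemma continuous_map_into_CG:
  assumes "\<And>x. x \<in> topspace T \<Longrightarrow> f x \<in> cosets N Z"
    and "\<And>a. openin T {x \<in> topspace T. a \<in> f x}"
  shows "continuous_map T (gtop CG) f"
proof -
  have "f -` cosets_at N Z a \<inter> topspace T = {x \<in> topspace T. a \<in> f x}" for a
    using assms(1) by auto
  then show ?thesis
    unfolding coset_groupoid_def using assms
    by (auto intro!: continuous_on_generated_topo simp: cosets_iff ex_in_conv)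
qed

lemma composable_CG: "(B, C) \<in> composable CG \<longleftrightarrow> matching B C \<and> B \<noteq> {} \<and> C \<noteq> {}"
  using src_eq_rng_if_matching[of B C] matchingI[of B C] matchingD[of B C]
  by (auto simp: composable_def cosets_iff)

lemma matching_mult_nonempty: "matching B C \<Longrightarrow> B \<noteq> {} \<Longrightarrow> C \<noteq> {} \<Longrightarrow> (B * C)\<^sup>\<up> \<noteq> {}"
  using matching_rounded[of B C] set_times_intro unfolding rounded_def by fast

lemma groupoid_CG: "groupoid CG"
  unfolding groupoid_def
proof (intro conjI ballI allI impI)
  fix C assume "C \<in> arr CG"
  then have C: "coset N Z C" "C \<noteq> {}" by (auto simp: cosets_iff)
  show "ginv CG C \<in> arr CG" "ginv CG (ginv CG C) = C"
    using coset_star[OF C(1)] coset_star_star[OF C(1)] star_nonempty[OF C] by (auto simp: cosets_iff)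
  have r: "rounded C" "rounded (C\<^sup>\<star>)" using C(1) coset_star[OF C(1)] cosetD(2) by auto
  show "gmult CG (grng CG C) C = C" "gmult CG C (gsrc CG C) = C"
    using up_up_times(2)[OF rounded_times[OF r] r(1)] up_up_times(3)[OF r(1) rounded_times[OF r(2,1)]]
      up_ternary[OF C(1)] by (simp_all add: mult.assoc)
next
  fix p assume p: "p \<in> composable CG"
  obtain B C where [simp]: "p = (B, C)" by (cases p)
  have BC: "matching B C" "B \<noteq> {}" "C \<noteq> {}" using p by (auto simp: composable_CG)
  show "case p of (g, h) \<Rightarrow> gmult CG g h \<in> arr CG \<and> gsrc CG (gmult CG g h) = gsrc CG h \<and>
      grng CG (gmult CG g h) = grng CG g"
    using coset_mult[OF BC(1)] matching_mult_nonempty[OF BC] src_mult[OF BC(1,2)] rng_mult[OF BC(1,3)]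
    by (simp add: cosets_iff)
next
  fix A B C assume "(A, B) \<in> composable CG \<and> (B, C) \<in> composable CG"
  then have "rounded A" "rounded B" "rounded C"
    using matchingD(1,2) cosetD(2) unfolding composable_CG by blast+
  then show "gmult CG (gmult CG A B) C = gmult CG A (gmult CG B C)"
    by (simp add: up_up_times rounded_times mult.assoc)
qed

lemma topological_groupoid_CG: "topological_groupoid CG"
  unfolding topological_groupoid_def
proof (intro conjI groupoid_CG)
  show "continuous_map (gtop CG) (gtop CG) (ginv CG)"
    using openin_CG_star ginv_arr[OF groupoid_CG] by (intro continuous_map_into_CG) simp_all
  let ?T = "subtopology (prod_topology (gtop CG) (gtop CG)) (composable CG)"
  show "continuous_map ?T (gtop CG) (\<lambda>(g, h). gmult CG g h)"
  proof (rule continuous_map_into_CG)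
    fix p assume "p \<in> topspace ?T"
    then show "(case p of (g, h) \<Rightarrow> gmult CG g h) \<in> cosets N Z"
      using gmult_arr[OF groupoid_CG] by auto
  next
    fix a
    show "openin ?T {p \<in> topspace ?T. a \<in> (case p of (g, h) \<Rightarrow> gmult CG g h)}" (is "openin _ ?U")
    proof (rule openin_nbhds)
      fix p assume p: "p \<in> ?U"
      obtain B C where pBC: "p = (B, C)" by (cases p)
      then obtain b c s where b: "b \<in> B" "c \<in> C" "b * c \<prec>[s] a" using p by (auto elim: up_timesE)
      let ?V = "(cosets_at N Z b \<times> cosets_at N Z c) \<inter> composable CG"
      have "openin ?T ?V"
        by (intro openin_subtopology_Int) (simp add: openin_prod_Times_iff openin_CG)
      moreover have "p \<in> ?V" using p pBC b by auto
      moreover have "?V \<subseteq> ?U" using upI[OF set_times_intro b(3)] by auto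
      ultimately show "\<exists>V. openin ?T V \<and> p \<in> V \<and> V \<subseteq> ?U" by blast
    qed
  qed
qed

text \<open>A source contains some \<open>rc' \<in> N\<close>, and \<open>unit_coset\<close> is the converse. So the units form an open set.\<close>

lemma units_CG: "units CG = {E \<in> cosets N Z. E \<inter> N \<noteq> {}}"
proof (intro equalityI subsetI)
  fix E assume E: "E \<in> units CG"
  then have "E \<in> cosets N Z" using unitsD[OF groupoid_CG E] by simp
  moreover obtain C where "C \<in> cosets N Z" "E = src C" using E by (auto simp: units_def)
  then obtain n where "n \<in> E" "n \<in> N" by (auto simp: cosets_iff elim: src_meets_N)
  ultimately show "E \<in> {E \<in> cosets N Z. E \<inter> N \<noteq> {}}" by blast
next
  fix E assume "E \<in> {E \<in> cosets N Z. E \<inter> N \<noteq> {}}"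
  then obtain n where E: "E \<in> cosets N Z" and n: "n \<in> E" "n \<in> N" by blast
  then have "E = gsrc CG E" using unit_coset[of E n] by (simp add: cosets_iff)
  then show "E \<in> units CG" unfolding units_def using E by (intro image_eqI[of _ _ E]) simp_all
qed

lemma cosets_at_open_slice: "cosets_at N Z a \<in> open_slices CG"
proof -
  have "B = C" if "B \<in> cosets_at N Z a" "C \<in> cosets_at N Z a" "src B = src C" for B C
    using that up_translate[of B a] up_translate[of C a] by (auto simp: cosets_iff)
  moreover have "B = C" if "B \<in> cosets_at N Z a" "C \<in> cosets_at N Z a" "rng B = rng C" for B C
    using that slice_eq_rng[of B C a] slice_eq_rng[of C B a] by (auto simp: cosets_iff)
  ultimately show ?thesis
    unfolding open_slices_def by (auto simp: openin_CG inj_on_def simp del: cosets_at_iff)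
qed

end

context symmetric_structured begin

text \<open>One inclusion is \<open>factorization\<close>; the other holds because products of cosets are rounded.\<close>

lemma cosets_at_mult: "cosets_at N Z (a * b) = slice_mult CG (cosets_at N Z a) (cosets_at N Z b)"
proof safe
  fix D assume D: "D \<in> cosets_at N Z (a * b)"
  then obtain B C where "matching B C" "a \<in> B" "b \<in> C" "D = (B * C)\<^sup>\<up>"
    by (metis cosets_at_iff cosets_iff factorization)
  then have "(B, C) \<in> composable CG" "a \<in> B" "b \<in> C" "D = gmult CG B C" by (auto simp: composable_CG)
  then show "D \<in> slice_mult CG (cosets_at N Z a) (cosets_at N Z b)"
    unfolding slice_mult_def using composableD(1,2)[of B C CG] by auto
next
  fix D assume "D \<in> slice_mult CG (cosets_at N Z a) (cosets_at N Z b)"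
  then obtain B C where D: "D = gmult CG B C" "a \<in> B" "b \<in> C" "(B, C) \<in> composable CG"
    by (auto simp: slice_mult_def)
  then have "D \<in> cosets N Z" using gmult_arr[OF groupoid_CG] by (metis arr_CG)
  moreover have "a * b \<in> D"
    using matching_rounded[of B C] D set_times_intro[of a B b C] by (auto simp: rounded_def composable_CG)
  ultimately show "D \<in> cosets_at N Z (a * b)" by simp
qed

text \<open>Near the source of \<open>C\<close>, with \<open>a \<in> C\<close> and \<open>a' <\<^sub>r a\<close>, the cosets containing
  \<open>ra\<close> form a neighbourhood that consists of units. By \<open>cosets_at_mult\<close>, each of them is a product
  whose right factor contains \<open>a\<close> and has the given unit as its source; by \<open>up_translate\<close> this factor
  depends continuously on the unit.\<close>

lemma etale_groupoid_CG: "etale_groupoid CG"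
  unfolding etale_groupoid_def open_map_def
proof (intro conjI topological_groupoid_CG allI impI)
  fix U assume U: "openin (gtop CG) U"
  show "openin (gtop CG) (gsrc CG ` U)"
  proof (rule openin_nbhds)
    fix E assume "E \<in> gsrc CG ` U"
    then obtain C where C: "C \<in> U" "E = src C" by auto
    then have cC: "coset N Z C" "C \<noteq> {}" using openin_subset[OF U] by (auto simp: cosets_iff)
    then obtain a where a: "a \<in> C" by blast
    obtain a' r where a': "a' \<in> C" "a' \<prec>[r] a" "r \<in> C\<^sup>\<star>" using cC(1) a by (rule cosetE)
    have raN: "r * a \<in> N" using Z_N dom_byD(4)[OF a'(2)] by blast
    \<comment> \<open>The coset with source \<open>E\<close> that contains \<open>a\<close>, by \<open>up_translate\<close>.\<close>
    define f where "f = (\<lambda>E. {x. \<exists>e s. e \<in> E \<and> a * e \<prec>[s] x})"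
    have lift: "\<exists>C'. C' \<in> cosets N Z \<and> a \<in> C' \<and> src C' = E' \<and> C' = f E'" if E': "E' \<in> cosets_at N Z (r * a)" for E'
    proof -
      obtain B C' where BC: "E' = gmult CG B C'" "(B, C') \<in> composable CG" "a \<in> C'"
        using E' unfolding cosets_at_mult by (auto simp: slice_mult_def)
      have cC': "coset N Z C'" using BC(2) by (auto simp: composable_CG dest: matchingD)
      have "src E' = E'" using unit_coset[of E' "r * a"] E' raN by (simp add: cosets_iff)
      then have "src C' = E'" using gsrc_gmult[OF groupoid_CG BC(2)] BC(1) by simp
      moreover have "C' = f (src C')" unfolding f_def by (rule up_translate[OF cC' BC(3)])
      ultimately show ?thesis using BC(3) cC' by (auto simp: cosets_iff)
    qed
    let ?T = "subtopology (gtop CG) (cosets_at N Z (r * a))"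
    have cont: "continuous_map ?T (gtop CG) f"
    proof (rule continuous_map_into_CG)
      show "f E' \<in> cosets N Z" if "E' \<in> topspace ?T" for E' using lift[of E'] that by auto
      fix x
      show "openin ?T {E' \<in> topspace ?T. x \<in> f E'}"
      proof (rule openin_nbhds)
        fix E' assume E': "E' \<in> {E' \<in> topspace ?T. x \<in> f E'}"
        then obtain e s where e: "e \<in> E'" "a * e \<prec>[s] x" by (auto simp: f_def)
        then show "\<exists>V. openin ?T V \<and> E' \<in> V \<and> V \<subseteq> {E' \<in> topspace ?T. x \<in> f E'}"
          using E' openin_subtopology_Int[OF openin_CG[of e], of "cosets_at N Z (r * a)"]
          by (intro exI[of _ "cosets_at N Z e \<inter> cosets_at N Z (r * a)"]) (auto simp: f_def, blast)
      qed
    qed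
    let ?W = "{E' \<in> topspace ?T. f E' \<in> U}"
    have "openin ?T ?W" using openin_continuous_map_preimage[OF cont U] .
    then have "openin (gtop CG) ?W" using openin_CG by (rule openin_trans_full)
    moreover have "E \<in> ?W"
    proof -
      have "C = f E" unfolding f_def C(2) by (rule up_translate[OF cC(1) a])
      moreover have "E \<in> cosets_at N Z (r * a)"
        using subset_src[OF cC(1) a'(3) a] src_coset[OF cC(1)] C(2) by (auto simp: cosets_iff)
      ultimately show ?thesis using C(1) by simp
    qed
    moreover have "?W \<subseteq> gsrc CG ` U"
    proof
      fix E' assume E': "E' \<in> ?W"
      then obtain C' where "src C' = E'" "C' = f E'" using lift[of E'] by auto
      then show "E' \<in> gsrc CG ` U" using E' by (auto intro!: image_eqI[of _ _ C'])
    qed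
    ultimately show "\<exists>W. openin (gtop CG) W \<and> E \<in> W \<and> W \<subseteq> gsrc CG ` U" by blast
  qed
qed

lemma etale_representation_CG: "etale_representation N Z CG (cosets_at N Z)"
  unfolding etale_representation_def
proof (intro conjI allI ballI etale_groupoid_CG cosets_at_open_slice cosets_at_mult)
  show "(\<Union>a. cosets_at N Z a) = arr CG" by (auto simp: cosets_iff)
  fix n assume "n \<in> N"
  then have "cosets_at N Z n = cosets_at N Z n \<inter> units CG" by (auto simp: units_CG)
  then show "openin (subtopology (gtop CG) (units CG)) (cosets_at N Z n)"
    using openin_subtopology_Int[OF openin_CG] by metis
next
  fix a C assume "C \<in> cosets_at N Z a"
  then show "\<exists>b. dominated N Z b a \<and> C \<in> cosets_at N Z b"
    by (auto simp: cosets_iff dominated_def elim!: cosetE)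
qed

end


section \<open>Germs\<close>

context structured begin

lemma star_mult_rng: "coset N Z C \<Longrightarrow> s \<in> C\<^sup>\<star> \<Longrightarrow> e \<in> rng C \<Longrightarrow> s * e \<in> C\<^sup>\<star>"
  using src_mult_subset[OF coset_star, of C s e] rng_star(2)[of C] by simp

lemma src_mult_star: "coset N Z C \<Longrightarrow> s \<in> C\<^sup>\<star> \<Longrightarrow> e \<in> src C \<Longrightarrow> e * s \<in> C\<^sup>\<star>"
  using rng_mult_subset[OF coset_star, of C s e] rng_star(1)[of C] by simp

lemma germ_rel_coset:
  assumes "coset N Z C"
  shows "(a, b) \<in> germ_rel N Z C \<longleftrightarrow> a \<in> C \<and> b \<in> C \<and> (\<exists>s\<in>C\<^sup>\<star>. \<exists>t\<in>C\<^sup>\<star>. s * a * t = s * b * t)"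
  using cosetD(3)[OF assms] by (simp add: germ_rel_def)

text \<open>The converse of \<open>germ_relE\<close>: witnesses in the range and source become
  witnesses in \<open>C\<^sup>*\<close> when multiplied by an element of \<open>C\<^sup>*\<close>.\<close>

lemma germ_relI:
  assumes C: "coset N Z C" and ab: "a \<in> C" "b \<in> C"
    and z: "z \<in> rng C" and w: "w \<in> src C" and eq: "z * a * w = z * b * w"
  shows "(a, b) \<in> germ_rel N Z C"
proof -
  obtain s where s: "s \<in> C\<^sup>\<star>" using C ab(1) by (rule cosetE)
  have "(s * z) * a * (w * s) = (s * z) * b * (w * s)"
    using arg_cong[OF eq, of "\<lambda>x. s * x * s"] by (simp add: mult.assoc)
  then show ?thesis
    unfolding germ_rel_coset[OF C] using ab star_mult_rng[OF C s z] src_mult_star[OF C s w] by blast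
qed

text \<open>The elements that witness a germ equality can be taken in \<open>Z\<close>, by multiplying \<open>s\<close> and \<open>t\<close> with
  inverses. In this form the equalities can be combined, as elements of \<open>Z\<close> commute.\<close>

lemma germ_relE:
  assumes C: "coset N Z C" and ab: "(a, b) \<in> germ_rel N Z C"
  obtains z w where "z \<in> Z" "w \<in> Z" "z \<in> rng C" "w \<in> src C" "z * a * w = z * b * w"
proof -
  obtain s t where s: "s \<in> C\<^sup>\<star>" and t: "t \<in> C\<^sup>\<star>" and eq: "s * a * t = s * b * t"
    using ab by (auto simp: germ_rel_coset[OF C])
  obtain x s' where x: "s' \<prec>[x] s" "x \<in> C" using cosetE[OF coset_star[OF C] s] coset_star_star[OF C] by metis
  obtain y t' where y: "t' \<prec>[y] t" "y \<in> C" using cosetE[OF coset_star[OF C] t] coset_star_star[OF C] by metis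
  have "(x * s) * a * (t * y) = (x * s) * b * (t * y)"
    using arg_cong[OF eq, of "\<lambda>u. x * u * y"] by (simp add: mult.assoc)
  then show thesis
    using that[of "x * s" "t * y"] dom_byD(4)[OF x(1)] dom_byD(3)[OF y(1)]
      subset_rng[OF C s x(2)] subset_src[OF C t y(2)] by blast
qed

lemma equiv_germ_rel:
  assumes C: "coset N Z C" shows "equiv C (germ_rel N Z C)"
proof (rule equivI)
  show "germ_rel N Z C \<subseteq> C \<times> C" by (auto simp: germ_rel_coset[OF C])
  show "refl_on C (germ_rel N Z C)"
    by (rule refl_onI) (use C in \<open>auto simp: germ_rel_coset elim: cosetE\<close>)
  show "sym (germ_rel N Z C)"
    by (rule symI) (auto simp: germ_rel_coset[OF C], metis)
  show "trans (germ_rel N Z C)"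
  proof (rule transI)
    fix a b c assume ab: "(a, b) \<in> germ_rel N Z C" and bc: "(b, c) \<in> germ_rel N Z C"
    obtain z w where z: "z \<in> Z" "w \<in> Z" "z \<in> rng C" "w \<in> src C" "z * a * w = z * b * w"
      using C ab by (rule germ_relE)
    obtain y v where y: "y \<in> Z" "v \<in> Z" "y \<in> rng C" "v \<in> src C" "y * b * v = y * c * v"
      using C bc by (rule germ_relE)
    have abc: "a \<in> C" "c \<in> C" using ab bc by (auto simp: germ_rel_coset[OF C])
    have comm: "z * y = y * z" "w * v = v * w" using ZN_commute z y Z_N by auto
    obtain s where s: "s \<in> C\<^sup>\<star>" using C abc(1) by (rule cosetE)
    have "y * z * a * (w * v) = y * (z * a * w) * v" by (simp only: mult.assoc)
    also have "\<dots> = (y * z) * b * (w * v)" unfolding z(5) by (simp only: mult.assoc)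
    also have "\<dots> = z * (y * b * v) * w" unfolding comm[symmetric] unfolding comm(2) by (simp only: mult.assoc)
    also have "\<dots> = (z * y) * c * (v * w)" unfolding y(5) by (simp only: mult.assoc)
    finally have eq: "(z * y) * a * (v * w) = (z * y) * c * (v * w)" by (simp only: comm)
    have "(s * z * y) * a * (v * w * s) = s * ((z * y) * a * (v * w)) * s" by (simp only: mult.assoc)
    also have "\<dots> = (s * z * y) * c * (v * w * s)" unfolding eq by (simp only: mult.assoc)
    finally have "(s * z * y) * a * (v * w * s) = (s * z * y) * c * (v * w * s)" .
    moreover have "s * z * y \<in> C\<^sup>\<star>" using star_mult_rng[OF C star_mult_rng[OF C s z(3)] y(3)] .
    moreover have "v * w * s \<in> C\<^sup>\<star>"
      using src_mult_star[OF C src_mult_star[OF C s z(4)] y(4)] by (simp add: mult.assoc)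
    ultimately show "(a, c) \<in> germ_rel N Z C" using abc by (auto simp: germ_rel_coset[OF C])
  qed
qed

lemma germ_eq_iff:
  assumes "coset N Z C" "a \<in> C" "b \<in> C"
  shows "germ N Z a C = germ N Z b C \<longleftrightarrow> (a, b) \<in> germ_rel N Z C"
  using eq_equiv_class_iff[OF equiv_germ_rel[OF assms(1)] assms(2,3)] by (auto simp: germ_def)

lemma germ_up: "rounded A \<Longrightarrow> germ N Z a A = germ N Z a (A\<^sup>\<up>)"
  using rounded_up[of A] up_up_subset[of A] star_up[of A] star_up[of "A\<^sup>\<up>"]
  unfolding germ_def germ_rel_def rounded_def by (simp add: subset_antisym)

lemma snd_germ: "coset N Z C \<Longrightarrow> snd (germ N Z a C) = C"
  using cosetD(3) by (simp add: germ_def)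

text \<open>With \<open>z a w = z a' w\<close>, multiply on the right by \<open>b(qb)\<close> and use \<open>w b (qb) = b (q w b)\<close>: the
  witness \<open>w\<close> between \<open>a\<close> and \<open>b\<close> becomes the witness \<open>qwb\<close> on the right of \<open>ab\<close>.\<close>

lemma germ_rel_mult_left:
  assumes AB: "matching A B" and aa: "(a, a') \<in> germ_rel N Z A" and b: "b \<in> B"
  shows "(a * b, a' * b) \<in> germ_rel N Z ((A * B)\<^sup>\<up>)"
proof -
  have A: "coset N Z A" and B: "coset N Z B" using AB by (auto dest: matchingD)
  have a: "a \<in> A" "a' \<in> A" using aa by (auto simp: germ_rel_coset[OF A])
  then have ne: "A \<noteq> {}" "B \<noteq> {}" using b by auto
  obtain z w where z: "z \<in> Z" "w \<in> Z" "z \<in> rng A" "w \<in> src A" "z * a * w = z * a' * w"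
    using A aa by (rule germ_relE)
  obtain b' q where b': "b' \<prec>[q] b" "q \<in> B\<^sup>\<star>" using B b by (rule cosetE)
  have shift: "w * b * (q * b) = b * (q * w * b)"
    using ZN_commute[OF z(2) Z_N[OF dom_byD(3)[OF b'(1)]]] by (metis mult.assoc)
  have "z * (x * b) * (q * w * b) = (z * x * w) * b * (q * b)" for x
    by (simp only: mult.assoc shift[symmetric, unfolded mult.assoc])
  then have "z * (a * b) * (q * w * b) = z * (a' * b) * (q * w * b)" using z(5) by simp
  moreover have "w * b \<in> B" using rng_mult_subset[OF B b] z(4) src_eq_rng_if_matching[OF AB ne] by simp
  then have "q * w * b \<in> src B" using subset_src[OF B b'(2)] by (simp add: mult.assoc)
  moreover have "A * B \<subseteq> (A * B)\<^sup>\<up>" using matching_rounded[OF AB] by (simp add: rounded_def)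
  ultimately show ?thesis
    using a b z(3) by (intro germ_relI[OF coset_mult[OF AB]])
      (auto simp: rng_mult[OF AB ne(2)] src_mult[OF AB ne(1)])
qed

text \<open>The mirror image, by means of \<open>(a y p) a = (a p a) y\<close>.\<close>

lemma germ_rel_mult_right:
  assumes AB: "matching A B" and bb: "(b, b') \<in> germ_rel N Z B" and a: "a \<in> A"
  shows "(a * b, a * b') \<in> germ_rel N Z ((A * B)\<^sup>\<up>)"
proof -
  have A: "coset N Z A" and B: "coset N Z B" using AB by (auto dest: matchingD)
  have b: "b \<in> B" "b' \<in> B" using bb by (auto simp: germ_rel_coset[OF B])
  then have ne: "A \<noteq> {}" "B \<noteq> {}" using a by auto
  obtain y v where y: "y \<in> Z" "v \<in> Z" "y \<in> rng B" "v \<in> src B" "y * b * v = y * b' * v"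
    using B bb by (rule germ_relE)
  obtain a0 p where a0: "a0 \<prec>[p] a" "p \<in> A\<^sup>\<star>" using A a by (rule cosetE)
  have shift: "a * y * p * a = a * p * a * y"
    using ZN_commute[OF y(1) Z_N[OF dom_byD(4)[OF a0(1)]]] by (metis mult.assoc)
  have "(a * y * p) * (a * x) * v = a * p * a * (y * x * v)" for x
    using arg_cong[OF shift, of "\<lambda>u. u * x * v"] by (simp only: mult.assoc)
  then have "(a * y * p) * (a * b) * v = (a * y * p) * (a * b') * v" using y(5) by simp
  moreover have "a * y \<in> A" using src_mult_subset[OF A a] y(3) src_eq_rng_if_matching[OF AB ne] by simp
  then have "a * y * p \<in> rng A" using subset_rng[OF A a0(2)] by blast
  moreover have "A * B \<subseteq> (A * B)\<^sup>\<up>" using matching_rounded[OF AB] by (simp add: rounded_def)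
  ultimately show ?thesis
    using a b y(4) by (intro germ_relI[OF coset_mult[OF AB]])
      (auto simp: rng_mult[OF AB ne(2)] src_mult[OF AB ne(1)])
qed

lemma germ_mult_eq:
  assumes AB: "matching A B" and ab: "a \<in> A" "b \<in> B"
  shows "germ_mult N Z (germ N Z a A) (germ N Z b B) = germ N Z (a * b) ((A * B)\<^sup>\<up>)"
  unfolding germ_mult_def
proof (rule the_equality)
  have A: "coset N Z A" and B: "coset N Z B" using AB by (auto dest: matchingD)
  have up: "germ N Z x (A * B) = germ N Z x ((A * B)\<^sup>\<up>)" for x
    by (rule germ_up[OF matching_rounded[OF AB]])
  then show "\<exists>A'\<in>cosets N Z. \<exists>B'\<in>cosets N Z. \<exists>a'\<in>A'. \<exists>b'\<in>B'. germ N Z a A = germ N Z a' A' \<and>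
      germ N Z b B = germ N Z b' B' \<and> germ N Z (a * b) ((A * B)\<^sup>\<up>) = germ N Z (a' * b') (A' * B')"
    using A B ab cosets_iff by (metis empty_iff)
  fix r assume "\<exists>A'\<in>cosets N Z. \<exists>B'\<in>cosets N Z. \<exists>a'\<in>A'. \<exists>b'\<in>B'. germ N Z a A = germ N Z a' A' \<and>
      germ N Z b B = germ N Z b' B' \<and> r = germ N Z (a' * b') (A' * B')"
  then obtain A' B' a' b' where *: "A' \<in> cosets N Z" "B' \<in> cosets N Z" "a' \<in> A'" "b' \<in> B'"
    "germ N Z a A = germ N Z a' A'" "germ N Z b B = germ N Z b' B'" "r = germ N Z (a' * b') (A' * B')" by blast
  have "A' = A" "B' = B" using * A B snd_germ by (metis cosets_iff)+
  with * have a': "(a, a') \<in> germ_rel N Z A" "(b, b') \<in> germ_rel N Z B" "a' \<in> A" "b' \<in> B"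
    using germ_eq_iff A B ab by auto
  let ?D = "(A * B)\<^sup>\<up>"
  have D: "coset N Z ?D" "A * B \<subseteq> ?D"
    using coset_mult[OF AB] matching_rounded[OF AB] by (auto simp: rounded_def)
  have mem: "a * b \<in> ?D" "a' * b \<in> ?D" "a' * b' \<in> ?D"
    using ab a' D(2) set_times_intro by blast+
  have "germ N Z (a * b) ?D = germ N Z (a' * b) ?D" "germ N Z (a' * b) ?D = germ N Z (a' * b') ?D"
    using germ_rel_mult_left[OF AB a'(1) ab(2)] germ_rel_mult_right[OF AB a'(2,3)]
      germ_eq_iff[OF D(1) mem(1,2)] germ_eq_iff[OF D(1) mem(2,3)] by blast+
  then show "r = germ N Z (a * b) ?D" using *(7) \<open>A' = A\<close> \<open>B' = B\<close> up by simp
qed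

lemma germ_in_germs: "coset N Z C \<Longrightarrow> c \<in> C \<Longrightarrow> germ N Z c C \<in> germs N Z"
  unfolding germs_def cosets_def by blast

lemma germsE:
  assumes "p \<in> germs N Z"
  obtains c C c' r where "p = germ N Z c C" "coset N Z C" "C \<noteq> {}" "c \<in> C" "c' \<in> C" "c' \<prec>[r] c" "r \<in> C\<^sup>\<star>"
proof -
  obtain c C where C: "p = germ N Z c C" "c \<in> C" "coset N Z C"
    using assms unfolding germs_def cosets_def by blast
  obtain c' r where "c' \<in> C" "c' \<prec>[r] c" "r \<in> C\<^sup>\<star>" using C(3,2) by (rule cosetE)
  with C that show thesis by blast
qed

text \<open>The germs of \<open>rc\<close> and \<open>cr\<close> are the units over the source and range of \<open>C\<close>. Two elements of this
  kind over the same coset have equal germs, since a left unit and a right unit agree.\<close>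

lemma germ_unit_left:
  assumes C: "coset N Z C" "c' \<in> C" "c' \<prec>[r] c" "r \<in> C\<^sup>\<star>"
    and D: "coset N Z D" "x \<in> D" and CD: "src C = rng D" and c: "c \<in> C"
  shows "(r * c * x, x) \<in> germ_rel N Z D"
proof -
  obtain u where u: "u \<in> D\<^sup>\<star>" using D by (rule cosetE)
  have "u * (r * c') \<in> D\<^sup>\<star>" using star_mult_rng[OF D(1) u] subset_src[OF C(1,4,2)] CD by simp
  moreover have "u * (r * c') * (r * c * x) * u = u * (r * c') * x * u"
    by (simp add: mult.assoc dom_by_eqs[OF C(3)])
  moreover have "r * c * x \<in> D" using rng_mult_subset[OF D] subset_src[OF C(1,4) c] CD by simp
  ultimately show ?thesis using D(2) u by (auto simp: germ_rel_coset[OF D(1)])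
qed

lemma germ_unit_right:
  assumes C: "coset N Z C" "c' \<in> C" "c' \<prec>[r] c" "r \<in> C\<^sup>\<star>"
    and D: "coset N Z D" "x \<in> D" and CD: "rng C = src D" and c: "c \<in> C"
  shows "(x * (c * r), x) \<in> germ_rel N Z D"
proof -
  obtain u where u: "u \<in> D\<^sup>\<star>" using D by (rule cosetE)
  have "(c' * r) * u \<in> D\<^sup>\<star>" using src_mult_star[OF D(1) u] subset_rng[OF C(1,4,2)] CD by simp
  moreover have "u * (x * (c * r)) * ((c' * r) * u) = u * x * ((c' * r) * u)"
    by (simp add: mult.assoc dom_by_eqs[OF C(3)])
  moreover have "x * (c * r) \<in> D" using src_mult_subset[OF D] subset_rng[OF C(1,4) c] CD by simp
  ultimately show ?thesis using D(2) u by (auto simp: germ_rel_coset[OF D(1)])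
qed

lemma dom_flip_star:
  assumes "coset N Z C" "c' \<in> C" "c' \<prec>[r] c" "r \<in> C\<^sup>\<star>"
  shows "r * c' * r \<in> C\<^sup>\<star>" "r * c' * r \<prec>[c] r"
  using cosetD(1)[OF coset_star[OF assms(1)] assms(4) _ assms(4)] assms dom_flip
  by (auto simp: coset_star_star)

text \<open>Existence is the unit laws. For uniqueness, \<open>cdc\<close> and \<open>c\<close> have the same germ, and \<open>c\<close> has that of
  \<open>crc\<close>; cancelling \<open>c\<close> on both sides identifies the germs of \<open>d\<close> and \<open>r\<close>.\<close>

lemma germ_inv_eq:
  assumes C: "coset N Z C" "c' \<in> C" "c' \<prec>[r] c" "r \<in> C\<^sup>\<star>" and c: "c \<in> C"
  shows "germ_inv N Z (germ N Z c C) = germ N Z r (C\<^sup>\<star>)"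
proof -
  note star = coset_star[OF C(1)] and ss = coset_star_star[OF C(1)]
  note flip = dom_flip_star[OF C]
  have ne: "C \<noteq> {}" "C\<^sup>\<star> \<noteq> {}" using c C(4) by auto
  have arr: "C \<in> arr CG" using C(1) ne by (simp add: cosets_iff)
  note fact = gmult_grng_left[OF groupoid_CG arr] gmult_gsrc_right[OF groupoid_CG arr]
  have mS: "matching (src C) (C\<^sup>\<star>)" "matching (rng C) C"
    using gsrc_grng[OF groupoid_CG arr] gsrc_gsrc[OF groupoid_CG arr] src_coset rng_coset C(1) star
    by (auto intro!: matchingI simp: ss)
  have prod: "germ_mult N Z (germ_mult N Z (germ N Z c C) (germ N Z d (C\<^sup>\<star>))) (germ N Z c C) = germ N Z (c * d * c) C"
    "germ_mult N Z (germ_mult N Z (germ N Z d (C\<^sup>\<star>)) (germ N Z c C)) (germ N Z d (C\<^sup>\<star>)) = germ N Z (d * c * d) (C\<^sup>\<star>)"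
    if d: "d \<in> C\<^sup>\<star>" for d
  proof -
    show "germ_mult N Z (germ_mult N Z (germ N Z c C) (germ N Z d (C\<^sup>\<star>))) (germ N Z c C) = germ N Z (c * d * c) C"
      using fact(1) by (simp add: germ_mult_eq[OF matching_star(2)[OF C(1)] c d]
          germ_mult_eq[OF mS(2) subset_rng[OF C(1) d c] c])
    have "(src C * C\<^sup>\<star>)\<^sup>\<up> = C\<^sup>\<star>"
      using gmult_grng_left[OF groupoid_CG ginv_arr[OF groupoid_CG arr]] by (simp add: ss)
    then show "germ_mult N Z (germ_mult N Z (germ N Z d (C\<^sup>\<star>)) (germ N Z c C)) (germ N Z d (C\<^sup>\<star>)) = germ N Z (d * c * d) (C\<^sup>\<star>)"
      by (simp add: germ_mult_eq[OF matching_star(1)[OF C(1)] d c]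
          germ_mult_eq[OF mS(1) subset_src[OF C(1) d c] d])
  qed
  show ?thesis
    unfolding germ_inv_def
  proof (rule the_equality)
    have "(c * r * c, c) \<in> germ_rel N Z C"
      using germ_unit_left[of "C\<^sup>\<star>" "r * c' * r" c r C c] flip star C c by (simp add: ss)
    then have "germ N Z (c * r * c) C = germ N Z c C"
      using c C by (intro germ_eq_iff[THEN iffD2] cosetD(1))
    moreover have "(r * c * r, r) \<in> germ_rel N Z (C\<^sup>\<star>)"
      using germ_unit_left[OF C star C(4)] c by (simp add: ss)
    then have "germ N Z (r * c * r) (C\<^sup>\<star>) = germ N Z r (C\<^sup>\<star>)"
      using c C ss star by (intro germ_eq_iff[THEN iffD2] cosetD(1)) simp_all
    ultimately show "germ N Z r (C\<^sup>\<star>) \<in> germs N Z \<and>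
        snd (germ N Z r (C\<^sup>\<star>)) = star N Z (snd (germ N Z c C)) \<and>
        germ_mult N Z (germ_mult N Z (germ N Z c C) (germ N Z r (C\<^sup>\<star>))) (germ N Z c C) = germ N Z c C \<and>
        germ_mult N Z (germ_mult N Z (germ N Z r (C\<^sup>\<star>)) (germ N Z c C)) (germ N Z r (C\<^sup>\<star>)) = germ N Z r (C\<^sup>\<star>)"
      using germ_in_germs[OF star C(4)] snd_germ star C(1) prod[OF C(4)] by simp
  next
    fix q assume q: "q \<in> germs N Z \<and> snd q = star N Z (snd (germ N Z c C)) \<and>
        germ_mult N Z (germ_mult N Z (germ N Z c C) q) (germ N Z c C) = germ N Z c C \<and>
        germ_mult N Z (germ_mult N Z q (germ N Z c C)) q = q"
    obtain d where d: "d \<in> C\<^sup>\<star>" "q = germ N Z d (C\<^sup>\<star>)"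
      using q snd_germ C(1) by (metis germsE)
    have "germ N Z (c * d * c) C = germ N Z c C" using q prod(1)[OF d(1)] d(2) by simp
    then have "(c * d * c, c) \<in> germ_rel N Z C"
      using germ_eq_iff[OF C(1)] cosetD(1)[OF C(1) c d(1) c] c by blast
    then obtain z w where z: "z \<in> Z" "w \<in> Z" "z \<in> rng C" "w \<in> src C" "z * (c * d * c) * w = z * c * w"
      using germ_relE[OF C(1)] by metis
    have comm: "c * r * z = z * (c * r)"
      using ZN_commute[OF dom_byD(3)[OF C(3)] Z_N[OF z(1)]] .
    \<comment> \<open>The factor \<open>c'r \<in> N\<close> absorbs \<open>cr\<close>, so that it equates \<open>crc\<close> with \<open>c\<close> exactly.\<close>
    have "(c' * r * z * c) * d * (c * w) = c' * r * (z * (c * d * c) * w)" by (simp only: mult.assoc)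
    also have "\<dots> = c' * r * (c * r * z) * c * w"
      unfolding z(5) by (simp add: mult.assoc dom_by_eqs[OF C(3)])
    also have "\<dots> = (c' * r * z * c) * r * (c * w)" unfolding comm by (simp only: mult.assoc)
    finally have "(c' * r * z * c) * d * (c * w) = (c' * r * z * c) * r * (c * w)" .
    moreover have "c' * r * (z * c) \<in> C"
      using cosetD(1)[OF C(1,2,4)] rng_mult_subset[OF C(1) c z(3)] by blast
    then have "c' * r * z * c \<in> C\<^sup>\<star>\<^sup>\<star>" by (simp add: ss mult.assoc)
    moreover have "c * w \<in> C\<^sup>\<star>\<^sup>\<star>" using src_mult_subset[OF C(1) c z(4)] by (simp add: ss)
    ultimately have "(d, r) \<in> germ_rel N Z (C\<^sup>\<star>)"
      unfolding germ_rel_coset[OF star] using d(1) C(4) by blast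
    then show "q = germ N Z r (C\<^sup>\<star>)" using d C(4) germ_eq_iff[OF star] by simp
  qed
qed

abbreviation FG :: "('a set \<times> 'a set) gpd" where "FG \<equiv> total_gpd (coset_bundle N Z)"

abbreviation tilde :: "'a \<Rightarrow> ('a set \<times> 'a set) set" where
  "tilde s \<equiv> {germ N Z s C | C. C \<in> cosets_at N Z s}"

lemma bundle_simps [simp]:
  "base_gpd (coset_bundle N Z) = CG" "proj (coset_bundle N Z) = snd"
  "gmult FG = germ_mult N Z" "ginv FG = germ_inv N Z"
  by (simp_all add: coset_bundle_def)

lemma snd_germs: "p \<in> germs N Z \<Longrightarrow> snd p \<in> cosets N Z"
  by (auto elim!: germsE simp: snd_germ cosets_iff)

lemma tilde_subset_germs: "tilde s \<subseteq> germs N Z"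
  by (auto simp: cosets_iff intro: germ_in_germs)

lemma arr_FG [simp]: "arr FG = germs N Z"
proof -
  have "arr FG = (\<Union>s. tilde s) \<union> (\<Union>s. {p \<in> germs N Z. snd p \<in> cosets_at N Z s})"
    by (simp add: coset_bundle_def)
  also have "\<dots> = germs N Z"
  proof
    show "(\<Union>s. tilde s) \<union> (\<Union>s. {p \<in> germs N Z. snd p \<in> cosets_at N Z s}) \<subseteq> germs N Z"
      using tilde_subset_germs by blast
    show "germs N Z \<subseteq> (\<Union>s. tilde s) \<union> (\<Union>s. {p \<in> germs N Z. snd p \<in> cosets_at N Z s})"
      by (auto simp: germs_def)
  qed
  finally show ?thesis .
qed

lemma germ_inv_germs: "p \<in> germs N Z \<Longrightarrow> germ_inv N Z p \<in> germs N Z \<and> snd (germ_inv N Z p) = (snd p)\<^sup>\<star>"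
  by (erule germsE) (simp add: germ_inv_eq germ_in_germs coset_star snd_germ)

lemma germ_inv_inv: "p \<in> germs N Z \<Longrightarrow> germ_inv N Z (germ_inv N Z p) = p"
  by (erule germsE) (simp add: germ_inv_eq dom_flip_star coset_star coset_star_star
      germ_inv_eq[OF coset_star dom_flip_star])

lemma gsrc_germ:
  assumes C: "coset N Z C" "c' \<in> C" "c' \<prec>[r] c" "r \<in> C\<^sup>\<star>" and c: "c \<in> C"
  shows "gsrc FG (germ N Z c C) = germ N Z (r * c) (src C)"
    and "grng FG (germ N Z c C) = germ N Z (c * r) (rng C)"
  using germ_mult_eq[OF matching_star(1)[OF C(1)] C(4) c] germ_mult_eq[OF matching_star(2)[OF C(1)] c C(4)]
  by (simp_all add: gsrc_def grng_def germ_inv_eq[OF C c])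

lemma snd_gsrc_germs: "p \<in> germs N Z \<Longrightarrow> snd (gsrc FG p) = src (snd p)"
  by (erule germsE) (simp add: gsrc_germ snd_germ src_coset)

lemma snd_grng_germs: "p \<in> germs N Z \<Longrightarrow> snd (grng FG p) = rng (snd p)"
  by (erule germsE) (simp add: gsrc_germ snd_germ rng_coset)

text \<open>Over each unit coset there is only one unit germ, so composability of germs is composability of
  the cosets below them.\<close>

lemma gsrc_eq_grng_germs:
  assumes p: "p \<in> germs N Z" and q: "q \<in> germs N Z" and eq: "src (snd p) = rng (snd q)"
  shows "gsrc FG p = grng FG q"
proof -
  obtain c C c' r where C: "p = germ N Z c C" "coset N Z C" "C \<noteq> {}" "c \<in> C" "c' \<in> C" "c' \<prec>[r] c" "r \<in> C\<^sup>\<star>"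
    using p by (rule germsE)
  obtain b B b' t where B: "q = germ N Z b B" "coset N Z B" "B \<noteq> {}" "b \<in> B" "b' \<in> B" "b' \<prec>[t] b" "t \<in> B\<^sup>\<star>"
    using q by (rule germsE)
  have E: "src C = rng B" using eq C B by (simp add: snd_germ)
  have arr: "C \<in> arr CG" using C by (simp add: cosets_iff)
  have EE: "rng (src C) = src C" "src (src C) = src C"
    using grng_gsrc[OF groupoid_CG arr] gsrc_gsrc[OF groupoid_CG arr] by simp_all
  have rc: "r * c \<in> src C" "b * t \<in> src C"
    using subset_src[OF C(2,7,4)] subset_rng[OF B(2,7,4)] E by simp_all
  have cE: "coset N Z (src C)" using src_coset C(2) .
  have "(r * c * (b * t), b * t) \<in> germ_rel N Z (src C)"
    using germ_unit_left[OF C(2,5,6,7) cE rc(2) _ C(4)] EE(1) by simp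
  moreover have "(r * c * (b * t), r * c) \<in> germ_rel N Z (src C)"
    using germ_unit_right[OF B(2,5,6,7) cE rc(1) _ B(4)] EE(2) E by simp
  ultimately have "(r * c, b * t) \<in> germ_rel N Z (src C)"
    using equiv_germ_rel[OF cE] by (meson equivE symE transE)
  then have "germ N Z (r * c) (src C) = germ N Z (b * t) (src C)"
    using germ_eq_iff[OF cE rc] by blast
  then show ?thesis using gsrc_germ(1)[OF C(2,5,6,7,4)] gsrc_germ(2)[OF B(2,5,6,7,4)] C(1) B(1) E by simp
qed

lemma composable_FG:
  "(p, q) \<in> composable FG \<longleftrightarrow> p \<in> germs N Z \<and> q \<in> germs N Z \<and> (snd p, snd q) \<in> composable CG"
proof -
  have "src (snd p) = rng (snd q)" if "p \<in> germs N Z" "q \<in> germs N Z" "gsrc FG p = grng FG q"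
    using snd_gsrc_germs[OF that(1)] snd_grng_germs[OF that(2)] that(3) by simp
  then show ?thesis using gsrc_eq_grng_germs[of p q] snd_germs[of p] snd_germs[of q]
    by (auto simp: composable_def)
qed

lemma germ_mult_germs:
  assumes "(p, q) \<in> composable FG"
  shows "germ_mult N Z p q \<in> germs N Z" "snd (germ_mult N Z p q) = (snd p * snd q)\<^sup>\<up>"
proof -
  have p: "p \<in> germs N Z" "q \<in> germs N Z" and m: "matching (snd p) (snd q)"
    using assms by (auto simp: composable_FG composable_CG)
  obtain a A where A: "p = germ N Z a A" "coset N Z A" "a \<in> A" using p(1) by (rule germsE)
  obtain b B where B: "q = germ N Z b B" "coset N Z B" "b \<in> B" using p(2) by (rule germsE)
  have m: "matching A B" using m A B by (simp add: snd_germ)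
  then have "a * b \<in> (A * B)\<^sup>\<up>"
    using A B matching_rounded set_times_intro unfolding rounded_def by blast
  then show "germ_mult N Z p q \<in> germs N Z" "snd (germ_mult N Z p q) = (snd p * snd q)\<^sup>\<up>"
    using A B coset_mult[OF m] by (auto simp: snd_germ germ_mult_eq[OF m] intro: germ_in_germs)
qed

lemma groupoid_FG: "groupoid FG"
  unfolding groupoid_def
proof (intro conjI ballI allI impI)
  fix p assume "p \<in> arr FG"
  then have p: "p \<in> germs N Z" by simp
  show "ginv FG p \<in> arr FG" "ginv FG (ginv FG p) = p"
    using germ_inv_germs[OF p] germ_inv_inv[OF p] by simp_all
  obtain c C c' r where C: "p = germ N Z c C" "coset N Z C" "C \<noteq> {}" "c \<in> C" "c' \<in> C" "c' \<prec>[r] c" "r \<in> C\<^sup>\<star>"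
    using p by (rule germsE)
  have arr: "C \<in> arr CG" using C by (simp add: cosets_iff)
  note star = coset_star[OF C(2)] and ss = coset_star_star[OF C(2)]
  note flip = dom_flip_star[OF C(2,5,6,7)]
  note fact = gmult_grng_left[OF groupoid_CG arr] gmult_gsrc_right[OF groupoid_CG arr]
  have m: "matching (rng C) C" "matching C (src C)"
    using gsrc_grng[OF groupoid_CG arr] grng_gsrc[OF groupoid_CG arr] src_coset rng_coset C(2)
    by (auto intro!: matchingI)
  have "(c * r * c, c) \<in> germ_rel N Z C"
    using germ_unit_left[of "C\<^sup>\<star>" "r * c' * r" c r C c] flip star C by (simp add: ss)
  then have "germ N Z (c * r * c) C = germ N Z c C"
    using C by (intro germ_eq_iff[THEN iffD2] cosetD(1))
  then show "gmult FG (grng FG p) p = p" "gmult FG p (gsrc FG p) = p"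
    using fact germ_mult_eq[OF m(1) subset_rng[OF C(2,7,4)] C(4)] germ_mult_eq[OF m(2) C(4) subset_src[OF C(2,7,4)]]
    by (simp_all add: gsrc_germ[OF C(2,5,6,7,4)] C(1) mult.assoc)
next
  fix x assume x: "x \<in> composable FG"
  obtain p q where [simp]: "x = (p, q)" by (cases x)
  have pq: "(p, q) \<in> composable FG" using x by simp
  have p: "p \<in> germs N Z" "q \<in> germs N Z" and c: "(snd p, snd q) \<in> composable CG"
    using pq by (auto simp: composable_FG)
  let ?m = "germ_mult N Z p q"
  note m = germ_mult_germs[OF pq]
  have inv: "germ_inv N Z p \<in> germs N Z" "germ_inv N Z q \<in> germs N Z"
    "snd (germ_inv N Z p) = (snd p)\<^sup>\<star>" "snd (germ_inv N Z q) = (snd q)\<^sup>\<star>"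
    using germ_inv_germs p by auto
  have co: "coset N Z (snd p)" "coset N Z (snd q)" using snd_germs p by (auto simp: cosets_iff)
  have "src (snd ?m) = src (snd q)" "rng (snd ?m) = rng (snd p)"
    using gsrc_gmult[OF groupoid_CG c] grng_gmult[OF groupoid_CG c] m(2) by simp_all
  then have "gsrc FG ?m = grng FG (germ_inv N Z q)" "gsrc FG q = grng FG (germ_inv N Z q)"
    "grng FG ?m = gsrc FG (germ_inv N Z p)" "grng FG p = gsrc FG (germ_inv N Z p)"
    using m(1) p inv co by (auto intro!: gsrc_eq_grng_germs gsrc_eq_grng_germs[symmetric] simp: coset_star_star)
  then show "case x of (g, h) \<Rightarrow> gmult FG g h \<in> arr FG \<and> gsrc FG (gmult FG g h) = gsrc FG h \<and>
      grng FG (gmult FG g h) = grng FG g"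
    using m(1) by simp
next
  fix p q s assume a: "(p, q) \<in> composable FG \<and> (q, s) \<in> composable FG"
  obtain a A where A: "p = germ N Z a A" "coset N Z A" "a \<in> A" using a composable_FG by (metis germsE)
  obtain b B where B: "q = germ N Z b B" "coset N Z B" "b \<in> B" using a composable_FG by (metis germsE)
  obtain c C where C: "s = germ N Z c C" "coset N Z C" "c \<in> C" using a composable_FG by (metis germsE)
  have cAB: "(A, B) \<in> composable CG" and cBC: "(B, C) \<in> composable CG"
    using a A B C by (auto simp: composable_FG snd_germ)
  have "(gmult CG A B, C) \<in> composable CG" "(A, gmult CG B C) \<in> composable CG"
    using cAB cBC gmult_arr[OF groupoid_CG] gsrc_gmult[OF groupoid_CG] grng_gmult[OF groupoid_CG]
    unfolding composable_def by auto
  then have m: "matching A B" "matching B C" "matching ((A * B)\<^sup>\<up>) C" "matching A ((B * C)\<^sup>\<up>)"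
    using cAB cBC by (simp_all add: composable_CG)
  have "a * b \<in> (A * B)\<^sup>\<up>" "b * c \<in> (B * C)\<^sup>\<up>"
    using A B C m(1,2)[THEN matching_rounded] set_times_intro unfolding rounded_def by blast+
  then show "gmult FG (gmult FG p q) s = gmult FG p (gmult FG q s)"
    using A(3) B(3) C(3) gmult_assoc[OF groupoid_CG cAB cBC]
    by (simp add: A(1) B(1) C(1) germ_mult_eq m mult.assoc)
qed

end


section \<open>The topology of the coset bundle\<close>

context structured begin

lemma openin_tilde: "openin (gtop FG) (tilde s)"
  unfolding coset_bundle_def by (simp, rule topology_generated_by_Basis) blast

lemma continuous_map_snd: "continuous_map (gtop FG) (gtop CG) snd"
proof (rule continuous_map_into_CG)
  show "snd p \<in> cosets N Z" if "p \<in> topspace (gtop FG)" for p using that snd_germs by simp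
  fix a
  have "{p \<in> topspace (gtop FG). a \<in> snd p} = {p \<in> germs N Z. snd p \<in> cosets_at N Z a}"
    using snd_germs by auto
  then show "openin (gtop FG) {p \<in> topspace (gtop FG). a \<in> snd p}"
    unfolding coset_bundle_def by (simp, intro topology_generated_by_Basis) blast
qed

lemma continuous_map_into_FG:
  assumes f: "\<And>x. x \<in> topspace T \<Longrightarrow> f x \<in> germs N Z"
    and base: "continuous_map T (gtop CG) (\<lambda>x. snd (f x))"
    and tilde: "\<And>s. openin T {x \<in> topspace T. f x \<in> tilde s}"
  shows "continuous_map T (gtop FG) f"
proof -
  have "openin T (f -` U \<inter> topspace T)"
    if U: "U \<in> range tilde \<union> range (\<lambda>s. {p \<in> germs N Z. snd p \<in> cosets_at N Z s})" for U
  proof -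
    have "openin T {x \<in> topspace T. f x \<in> {p \<in> germs N Z. snd p \<in> cosets_at N Z s}}" for s
    proof -
      have "{x \<in> topspace T. f x \<in> {p \<in> germs N Z. snd p \<in> cosets_at N Z s}} =
          {x \<in> topspace T. snd (f x) \<in> cosets_at N Z s}" using f by auto
      then show ?thesis using openin_continuous_map_preimage[OF base openin_CG] by simp
    qed
    moreover have "f -` U \<inter> topspace T = {x \<in> topspace T. f x \<in> U}" by auto
    ultimately show ?thesis using U tilde by auto
  qed
  moreover have "f ` topspace T \<subseteq> arr FG" using f by auto
  ultimately show ?thesis
    by (simp add: coset_bundle_def continuous_on_generated_topo_iff)
qed

lemma germ_in_tilde_iff:
  assumes C: "coset N Z C" "a \<in> C"
  shows "germ N Z a C \<in> tilde s \<longleftrightarrow> (a, s) \<in> germ_rel N Z C"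
proof
  assume "germ N Z a C \<in> tilde s"
  then obtain D where D: "germ N Z a C = germ N Z s D" "D \<in> cosets N Z" "s \<in> D" by auto
  then have "D = C" using snd_germ C(1) by (metis cosets_iff)
  then show "(a, s) \<in> germ_rel N Z C" using germ_eq_iff[OF C] D by blast
next
  assume as: "(a, s) \<in> germ_rel N Z C"
  then have "s \<in> C" using germ_rel_coset[OF C(1)] by blast
  then have "germ N Z a C = germ N Z s C" "C \<in> cosets_at N Z s"
    using as germ_eq_iff[OF C] C by (auto simp: cosets_iff)
  then show "germ N Z a C \<in> tilde s" by blast
qed

text \<open>Equality of the germs of two fixed elements is witnessed by finitely many memberships, hence is an
  open condition on the coset.\<close>

lemma openin_germ_rel: "openin (gtop CG) {C \<in> cosets N Z. (a, s) \<in> germ_rel N Z C}"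
proof (rule openin_nbhds)
  fix C assume "C \<in> {C \<in> cosets N Z. (a, s) \<in> germ_rel N Z C}"
  then have C: "C \<in> cosets N Z" and "coset N Z C" "(a, s) \<in> germ_rel N Z C" by (auto simp: cosets_iff)
  then obtain u v where uv: "a \<in> C" "s \<in> C" "u \<in> C\<^sup>\<star>" "v \<in> C\<^sup>\<star>" "u * a * v = u * s * v"
    by (auto simp: germ_rel_coset)
  let ?W = "cosets_at N Z a \<inter> cosets_at N Z s \<inter> {C \<in> cosets N Z. u \<in> C\<^sup>\<star>} \<inter> {C \<in> cosets N Z. v \<in> C\<^sup>\<star>}"
  have "openin (gtop CG) ?W" by (intro openin_Int openin_CG openin_CG_star)
  moreover have "C \<in> ?W" using C uv by simp
  moreover have "?W \<subseteq> {C \<in> cosets N Z. (a, s) \<in> germ_rel N Z C}"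
    using uv(5) by (auto simp: germ_rel_coset cosets_iff)
  ultimately show "\<exists>W. openin (gtop CG) W \<and> C \<in> W \<and> W \<subseteq> {C \<in> cosets N Z. (a, s) \<in> germ_rel N Z C}" by blast
qed

text \<open>Near \<open>p = [t, D\<^sup>*]\<close> with \<open>p\<inverse> = [s, D]\<close> and \<open>s' <\<^sub>t s\<close>, the inverse is \<open>[s, C\<^sup>*]\<close> for all germs \<open>[t, C]\<close>
  with \<open>s' \<in> C\<^sup>*\<close>.\<close>

lemma continuous_map_germ_inv: "continuous_map (gtop FG) (gtop FG) (germ_inv N Z)"
proof (rule continuous_map_into_FG)
  show "germ_inv N Z p \<in> germs N Z" if "p \<in> topspace (gtop FG)" for p
    using that germ_inv_germs by simp
  have "continuous_map (gtop CG) (gtop CG) (ginv CG)"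
    using topological_groupoid_CG by (simp add: topological_groupoid_def)
  from continuous_map_compose[OF continuous_map_snd this]
  show "continuous_map (gtop FG) (gtop CG) (\<lambda>p. snd (germ_inv N Z p))"
    by (rule continuous_map_eq) (simp add: germ_inv_germs)
  fix s
  show "openin (gtop FG) {p \<in> topspace (gtop FG). germ_inv N Z p \<in> tilde s}" (is "openin _ ?U")
  proof (rule openin_nbhds)
    fix p assume "p \<in> ?U"
    then have p: "p \<in> germs N Z" "germ_inv N Z p \<in> tilde s" by auto
    then obtain D where D: "germ_inv N Z p = germ N Z s D" "D \<in> cosets N Z" "s \<in> D" by auto
    then have cD: "coset N Z D" by (simp add: cosets_iff)
    obtain s' t where t: "s' \<in> D" "s' \<prec>[t] s" "t \<in> D\<^sup>\<star>" using cD D(3) by (rule cosetE)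
    have pt: "p = germ N Z t (D\<^sup>\<star>)"
      using germ_inv_inv[OF p(1)] germ_inv_eq[OF cD t D(3)] D(1) by simp
    have "openin (gtop FG) {p \<in> topspace (gtop FG). snd p \<in> {C \<in> cosets N Z. s' \<in> C\<^sup>\<star>}}"
      using openin_continuous_map_preimage[OF continuous_map_snd openin_CG_star] .
    then have "openin (gtop FG) (tilde t \<inter> {p \<in> topspace (gtop FG). snd p \<in> {C \<in> cosets N Z. s' \<in> C\<^sup>\<star>}})"
      (is "openin _ ?V") by (intro openin_Int openin_tilde)
    moreover have "p \<in> ?V"
    proof -
      have "coset N Z (D\<^sup>\<star>)" "D\<^sup>\<star> \<in> cosets N Z" using coset_star[OF cD] t(3) by (auto simp: cosets_iff)
      then show ?thesis using pt p t coset_star_star[OF cD] by (auto simp: snd_germ)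
    qed
    moreover have "?V \<subseteq> ?U"
    proof
      fix q assume q: "q \<in> ?V"
      then obtain C where C: "q = germ N Z t C" "C \<in> cosets N Z" "t \<in> C" by auto
      then have cC: "coset N Z C" by (simp add: cosets_iff)
      have s': "s' \<in> C\<^sup>\<star>" using q C by (simp add: snd_germ cC)
      note star = coset_star[OF cC] and ss = coset_star_star[OF cC]
      have s: "s \<in> C\<^sup>\<star>" using coset_upI[OF star s' t(2)] .
      have "germ_inv N Z (germ N Z s (C\<^sup>\<star>)) = q"
        using germ_inv_eq[OF star s' t(2) _ s] C ss by simp
      then have "germ_inv N Z q = germ N Z s (C\<^sup>\<star>)"
        using germ_inv_inv[OF germ_in_germs[OF star s]] by simp
      moreover have "C\<^sup>\<star> \<in> cosets_at N Z s" using star s by (auto simp: cosets_iff)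
      ultimately show "q \<in> ?U" using q by auto
    qed
    ultimately show "\<exists>V. openin (gtop FG) V \<and> p \<in> V \<and> V \<subseteq> ?U" by blast
  qed
qed

text \<open>Near \<open>([a, A], [b, B])\<close> the product is the germ of \<open>ab\<close> at the product coset, so that it lies in
  \<open>tilde s\<close> exactly if \<open>ab\<close> and \<open>s\<close> have the same germ there, which is an open condition.\<close>

lemma continuous_map_germ_mult:
  "continuous_map (subtopology (prod_topology (gtop FG) (gtop FG)) (composable FG)) (gtop FG)
     (\<lambda>(p, q). germ_mult N Z p q)" (is "continuous_map ?T _ _")
proof (rule continuous_map_into_FG)
  have top: "topspace ?T = composable FG" by (auto simp: composable_def)
  show "(case x of (p, q) \<Rightarrow> germ_mult N Z p q) \<in> germs N Z" if "x \<in> topspace ?T" for x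
    using that germ_mult_germs(1) unfolding top by (auto split: prod.split)
  have snds: "continuous_map ?T (subtopology (prod_topology (gtop CG) (gtop CG)) (composable CG))
      (\<lambda>(p, q). (snd p, snd q))"
  proof (rule continuous_map_into_subtopology)
    have "continuous_map (prod_topology (gtop FG) (gtop FG)) (prod_topology (gtop CG) (gtop CG))
        (\<lambda>(p, q). (snd p, snd q))"
      using continuous_map_snd by (simp add: continuous_map_prod_top)
    then show "continuous_map ?T (prod_topology (gtop CG) (gtop CG)) (\<lambda>(p, q). (snd p, snd q))"
      by (rule continuous_map_from_subtopology)
    show "(\<lambda>(p, q). (snd p, snd q)) \<in> topspace ?T \<rightarrow> composable CG"
      unfolding top by (auto simp: composable_FG)
  qed
  have "continuous_map (subtopology (prod_topology (gtop CG) (gtop CG)) (composable CG)) (gtop CG)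
      (\<lambda>(g, h). gmult CG g h)"
    using topological_groupoid_CG by (simp add: topological_groupoid_def)
  from continuous_map_compose[OF snds this]
  show base: "continuous_map ?T (gtop CG) (\<lambda>x. snd (case x of (p, q) \<Rightarrow> germ_mult N Z p q))"
    by (rule continuous_map_eq) (auto simp: top germ_mult_germs)
  fix s
  show "openin ?T {x \<in> topspace ?T. (case x of (p, q) \<Rightarrow> germ_mult N Z p q) \<in> tilde s}" (is "openin _ ?U")
  proof (rule openin_nbhds)
    fix x assume x: "x \<in> ?U"
    obtain p q where xpq: "x = (p, q)" by (cases x)
    have pq: "(p, q) \<in> composable FG" "germ_mult N Z p q \<in> tilde s" using x xpq top by auto
    then have g: "p \<in> germs N Z" "q \<in> germs N Z" and m: "matching (snd p) (snd q)"
      by (auto simp: composable_FG composable_CG)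
    obtain a A where A: "p = germ N Z a A" "coset N Z A" "a \<in> A" using g(1) by (rule germsE)
    obtain b B where B: "q = germ N Z b B" "coset N Z B" "b \<in> B" using g(2) by (rule germsE)
    have mem: "a' * b' \<in> (A' * B')\<^sup>\<up>" if "matching A' B'" "a' \<in> A'" "b' \<in> B'" for a' b' A' B'
      using matching_rounded[OF that(1)] that set_times_intro unfolding rounded_def by blast
    have in_tilde: "germ_mult N Z (germ N Z a A') (germ N Z b B') \<in> tilde s \<longleftrightarrow>
        (a * b, s) \<in> germ_rel N Z ((A' * B')\<^sup>\<up>)" if "matching A' B'" "a \<in> A'" "b \<in> B'" for A' B'
      using germ_in_tilde_iff[OF coset_mult[OF that(1)] mem[OF that]] by (simp only: germ_mult_eq[OF that])
    have mAB: "matching A B" using m A B by (simp add: snd_germ)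
    let ?R = "{C \<in> cosets N Z. (a * b, s) \<in> germ_rel N Z C}"
    let ?V = "((tilde a \<times> tilde b) \<inter> composable FG) \<inter>
      {x \<in> topspace ?T. snd (case x of (p, q) \<Rightarrow> germ_mult N Z p q) \<in> ?R}"
    have "openin (prod_topology (gtop FG) (gtop FG)) (tilde a \<times> tilde b)"
      by (simp add: openin_prod_Times_iff openin_tilde del: cosets_at_iff)
    then have "openin ?T ?V"
      by (intro openin_Int openin_subtopology_Int[of _ "tilde a \<times> tilde b"]
          openin_continuous_map_preimage[OF base] openin_germ_rel)
    moreover have "x \<in> ?V"
    proof -
      have "A \<in> cosets_at N Z a" "B \<in> cosets_at N Z b" using A B by (auto simp: cosets_iff)
      then have "p \<in> tilde a" "q \<in> tilde b" using A(1) B(1) by blast+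
      moreover have "snd (germ_mult N Z p q) = (A * B)\<^sup>\<up>" using germ_mult_germs(2)[OF pq(1)] A B by (simp add: snd_germ)
      moreover have "(A * B)\<^sup>\<up> \<in> cosets N Z" using coset_mult[OF mAB] mem[OF mAB A(3) B(3)] by (auto simp: cosets_iff)
      moreover have "(a * b, s) \<in> germ_rel N Z ((A * B)\<^sup>\<up>)" using in_tilde[OF mAB A(3) B(3)] pq(2) A(1) B(1) by simp
      ultimately show ?thesis using pq(1) xpq top by auto
    qed
    moreover have "?V \<subseteq> ?U"
    proof
      fix y assume y: "y \<in> ?V"
      then obtain A' B' where AB: "y = (germ N Z a A', germ N Z b B')" "A' \<in> cosets N Z" "a \<in> A'"
        "B' \<in> cosets N Z" "b \<in> B'" by auto
      then have c: "coset N Z A'" "coset N Z B'" by (auto simp: cosets_iff)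
      have yc: "(germ N Z a A', germ N Z b B') \<in> composable FG" using y AB(1) by auto
      then have m: "matching A' B'" using c by (simp add: composable_FG composable_CG snd_germ)
      have "(a * b, s) \<in> germ_rel N Z ((A' * B')\<^sup>\<up>)"
        using y germ_mult_germs(2)[OF yc] c unfolding AB(1) by (simp add: snd_germ)
      then show "y \<in> ?U" using in_tilde[OF m AB(3,5)] yc AB(1) top by simp
    qed
    ultimately show "\<exists>V. openin ?T V \<and> x \<in> V \<and> V \<subseteq> ?U" by blast
  qed
qed

lemma topological_groupoid_FG: "topological_groupoid FG"
  unfolding topological_groupoid_def
  using groupoid_FG continuous_map_germ_inv continuous_map_germ_mult by simp

lemma continuous_map_germ:
  "continuous_map (subtopology (gtop CG) (cosets_at N Z a)) (gtop FG) (germ N Z a)" (is "continuous_map ?T _ _")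
proof (rule continuous_map_into_FG)
  have top: "topspace ?T = cosets_at N Z a" by auto
  show "germ N Z a C \<in> germs N Z" if "C \<in> topspace ?T" for C
    using that by (auto simp: cosets_iff intro: germ_in_germs)
  have "continuous_map ?T (gtop CG) (\<lambda>C. C)"
    by (intro continuous_map_from_subtopology) (simp add: continuous_map_id[unfolded id_def])
  then show "continuous_map ?T (gtop CG) (\<lambda>C. snd (germ N Z a C))"
    by (rule continuous_map_eq) (auto simp: snd_germ cosets_iff)
  fix s
  have "{C \<in> topspace ?T. germ N Z a C \<in> tilde s} = {C \<in> cosets N Z. (a, s) \<in> germ_rel N Z C} \<inter> cosets_at N Z a"
  proof -
    have "germ N Z a C \<in> tilde s \<longleftrightarrow> (a, s) \<in> germ_rel N Z C" if "C \<in> cosets_at N Z a" for C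
      using that by (intro germ_in_tilde_iff) (auto simp: cosets_iff)
    moreover have "cosets_at N Z a \<subseteq> cosets N Z" by auto
    ultimately show ?thesis unfolding top by blast
  qed
  then show "openin ?T {C \<in> topspace ?T. germ N Z a C \<in> tilde s}"
    using openin_subtopology_Int[OF openin_germ_rel] by metis
qed

text \<open>Through every germ over \<open>C\<close> passes one of the continuous sections \<open>D \<mapsto> [a, D]\<close>, defined on a
  neighbourhood of \<open>C\<close>.\<close>

lemma open_map_snd: "open_map (gtop FG) (gtop CG) snd"
  unfolding open_map_def
proof (intro allI impI)
  fix U assume U: "openin (gtop FG) U"
  show "openin (gtop CG) (snd ` U)"
  proof (rule openin_nbhds)
    fix C assume "C \<in> snd ` U"
    then obtain p where p: "p \<in> U" "C = snd p" by auto
    then have "p \<in> germs N Z" using openin_subset[OF U] by auto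
    then obtain a where a: "p = germ N Z a C" "coset N Z C" "a \<in> C"
      using p(2) snd_germ by (metis germsE)
    let ?V = "{D \<in> topspace (subtopology (gtop CG) (cosets_at N Z a)). germ N Z a D \<in> U}"
    have "openin (gtop CG) ?V"
      using openin_continuous_map_preimage[OF continuous_map_germ U] openin_CG by (rule openin_trans_full)
    moreover have "C \<in> ?V" using a p by (auto simp: cosets_iff)
    moreover have "?V \<subseteq> snd ` U"
    proof
      fix D assume "D \<in> ?V"
      then show "D \<in> snd ` U" by (intro image_eqI[of _ _ "germ N Z a D"]) (auto simp: snd_germ cosets_iff)
    qed
    ultimately show "\<exists>V. openin (gtop CG) V \<and> C \<in> V \<and> V \<subseteq> snd ` U" by blast
  qed
qed

lemma dom_coset_section: "dom (coset_section N Z a) = cosets_at N Z a"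
  by (auto simp: coset_section_def dom_def)

lemma coset_section_eq: "C \<in> cosets_at N Z a \<Longrightarrow> the (coset_section N Z a C) = germ N Z a C"
  by (simp add: coset_section_def)

lemma inj_on_snd_units: "inj_on snd (units FG)"
proof (rule inj_onI)
  fix u v assume u: "u \<in> units FG" and v: "v \<in> units FG" and eq: "snd u = snd v"
  have g: "u \<in> germs N Z" "v \<in> germs N Z" using unitsD(1)[OF groupoid_FG] u v by simp_all
  have "src (snd u) = rng (snd v)"
    using snd_gsrc_germs[OF g(1)] snd_grng_germs[OF g(2)] unitsD(2,3)[OF groupoid_FG] u v eq by simp
  then have "gsrc FG u = grng FG v" by (rule gsrc_eq_grng_germs[OF g])
  then show "u = v" using unitsD(2,3)[OF groupoid_FG] u v by simp
qed

end

context symmetric_structured begin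

lemma groupoid_bundle_coset_bundle: "groupoid_bundle (coset_bundle N Z)"
proof -
  have "gfunctor FG CG snd"
    unfolding gfunctor_def by (auto simp: germ_mult_germs composable_FG dest: snd_germs)
  then show ?thesis
    unfolding groupoid_bundle_def
    using topological_groupoid_FG etale_groupoid_CG continuous_map_snd open_map_snd inj_on_snd_units by simp
qed

lemma coset_section_mult:
  "coset_section N Z (a * b) = section_mult (coset_bundle N Z) (coset_section N Z a) (coset_section N Z b)"
proof
  fix D
  show "coset_section N Z (a * b) D = section_mult (coset_bundle N Z) (coset_section N Z a) (coset_section N Z b) D"
  proof (cases "D \<in> cosets_at N Z (a * b)")
    case False
    then show ?thesis
      by (simp add: section_mult_def dom_coset_section cosets_at_mult[symmetric] coset_section_def[of N Z "a * b"]
          del: cosets_at_iff)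
  next
    case True
    have "(THE f. \<exists>g\<in>cosets_at N Z a. \<exists>h\<in>cosets_at N Z b. (g, h) \<in> composable CG \<and> D = gmult CG g h \<and>
        f = germ_mult N Z (the (coset_section N Z a g)) (the (coset_section N Z b h))) = germ N Z (a * b) D"
      (is "(THE f. ?P f) = _")
    proof (rule the_equality)
      have P: "?P f \<longleftrightarrow> (\<exists>g\<in>cosets_at N Z a. \<exists>h\<in>cosets_at N Z b. (g, h) \<in> composable CG \<and> D = gmult CG g h \<and>
        f = germ N Z (a * b) D)" for f
        by (intro bex_cong refl conj_cong) (auto simp: coset_section_eq composable_CG germ_mult_eq)
      show "?P (germ N Z (a * b) D)" unfolding P
        using True unfolding cosets_at_mult slice_mult_def by blast
      show "?P f \<Longrightarrow> f = germ N Z (a * b) D" for f unfolding P by blast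
    qed
    then show ?thesis using True
      by (simp add: section_mult_def dom_coset_section cosets_at_mult[symmetric] coset_section_def[of N Z "a * b"] del: cosets_at_iff CG_simps)
  qed
qed

lemma coset_section_slice_section: "coset_section N Z a \<in> slice_sections (coset_bundle N Z)"
proof -
  have "continuous_map (subtopology (gtop CG) (cosets_at N Z a)) (gtop FG) (\<lambda>C. the (coset_section N Z a C))"
    using continuous_map_germ by (rule continuous_map_eq) (simp add: coset_section_eq)
  then show ?thesis
    unfolding slice_sections_def
    by (auto simp: dom_coset_section cosets_at_open_slice coset_section_eq snd_germ cosets_iff)
qed

lemma bundle_representation_coset_section:
  "bundle_representation N Z (coset_bundle N Z) (coset_section N Z)"
  unfolding bundle_representation_def
  using groupoid_bundle_coset_bundle coset_section_slice_section coset_section_mult etale_representation_CG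
  by (simp add: dom_coset_section)

end


section \<open>The coset of an arrow\<close>

text \<open>An arrow \<open>h\<close> of the represented groupoid is recorded by the set \<open>pt h\<close> of the elements
  represented at \<open>h\<close>. The map \<open>pt\<close> is a continuous functor into the groupoid of cosets, and its graph
  is the Zakrzewski morphism \<open>\<phi>\<close>.\<close>

locale etale_rep = structured N Z for N Z :: "'a::semigroup_mult set" +
  fixes G :: "'h gpd" and \<theta> :: "'a \<Rightarrow> 'h set"
  assumes rep: "etale_representation N Z G \<theta>"
begin

lemma groupoid_G: "groupoid G"
  using rep by (simp add: etale_representation_def etale_groupoid_def topological_groupoid_def)

lemma
  shows open_\<theta>: "openin (gtop G) (\<theta> a)"
    and slice_src: "g \<in> \<theta> a \<Longrightarrow> h \<in> \<theta> a \<Longrightarrow> gsrc G g = gsrc G h \<Longrightarrow> g = h"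
    and slice_rng: "g \<in> \<theta> a \<Longrightarrow> h \<in> \<theta> a \<Longrightarrow> grng G g = grng G h \<Longrightarrow> g = h"
    and \<theta>_mult: "\<theta> (a * b) = slice_mult G (\<theta> a) (\<theta> b)"
    and \<theta>_cover: "(\<Union>a. \<theta> a) = arr G"
    and \<theta>_below: "g \<in> \<theta> a \<Longrightarrow> \<exists>b s. b \<prec>[s] a \<and> g \<in> \<theta> b"
  using rep unfolding etale_representation_def open_slices_def inj_on_def dominated_def by blast+

lemma \<theta>_arr: "g \<in> \<theta> a \<Longrightarrow> g \<in> arr G"
  using \<theta>_cover by blast

lemma \<theta>_N: "n \<in> N \<Longrightarrow> g \<in> \<theta> n \<Longrightarrow> g \<in> units G"
  using rep openin_subset unfolding etale_representation_def by fastforce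

lemma \<theta>_multI: "g \<in> \<theta> a \<Longrightarrow> h \<in> \<theta> b \<Longrightarrow> (g, h) \<in> composable G \<Longrightarrow> gmult G g h \<in> \<theta> (a * b)"
  unfolding \<theta>_mult slice_mult_def by blast

lemma \<theta>_multE:
  assumes "k \<in> \<theta> (a * b)"
  obtains g h where "g \<in> \<theta> a" "h \<in> \<theta> b" "(g, h) \<in> composable G" "k = gmult G g h"
  using assms unfolding \<theta>_mult slice_mult_def by blast

text \<open>Write \<open>a = b(sa)\<close>. As \<open>sa \<in> N\<close> is represented by units, an arrow of \<open>\<theta> a\<close> already lies in \<open>\<theta> b\<close>;
  decomposing the unit over \<open>s\<close> and \<open>a\<close> exhibits the inverse arrow in \<open>\<theta> s\<close>.\<close>

lemma \<theta>_dom_by: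
  assumes ab: "a \<prec>[s] b" and h: "h \<in> \<theta> a"
  shows "h \<in> \<theta> b" "ginv G h \<in> \<theta> s"
proof -
  have "a = b * (s * a)" using dom_by_eqs[OF ab] by simp
  then obtain g k where g: "g \<in> \<theta> b" "k \<in> \<theta> (s * a)" "(g, k) \<in> composable G" "h = gmult G g k"
    using h \<theta>_multE by metis
  have k: "k \<in> units G" using \<theta>_N[OF dom_byD(2)[OF ab] g(2)] .
  show "h \<in> \<theta> b" using gmult_unit_right[OF groupoid_G g(3) k] g(1,4) by simp
  obtain i j where i: "i \<in> \<theta> s" "j \<in> \<theta> a" "(i, j) \<in> composable G" "k = gmult G i j"
    using g(2) by (rule \<theta>_multE)
  have "gsrc G j = gsrc G h"
    using gsrc_gmult[OF groupoid_G] g(3,4) i(3,4) by simp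
  then have "j = h" using slice_src[OF i(2) h] by blast
  then show "ginv G h \<in> \<theta> s" using ginv_unique[OF groupoid_G i(3)] k i(1,4) by simp
qed

definition pt :: "'h \<Rightarrow> 'a set" where "pt h = {a. h \<in> \<theta> a}"

lemma pt_iff [simp]: "a \<in> pt h \<longleftrightarrow> h \<in> \<theta> a" by (simp add: pt_def)

lemma \<theta>_ternary:
  assumes h: "h \<in> arr G" and a: "h \<in> \<theta> a" "ginv G h \<in> \<theta> s" "h \<in> \<theta> b"
  shows "h \<in> \<theta> (a * s * b)"
proof -
  have "grng G h \<in> \<theta> (a * s)"
    using \<theta>_multI[OF a(1,2) ginv_composable(2)[OF groupoid_G h]] by (simp add: grng_def)
  moreover have "(grng G h, h) \<in> composable G"
    using grng_arr[OF groupoid_G h] gsrc_grng[OF groupoid_G h] h by (auto intro: composableI)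
  ultimately show ?thesis using \<theta>_multI[OF _ a(3)] gmult_grng_left[OF groupoid_G h] by metis
qed

text \<open>For \<open>s\<close> represented at the inverse of \<open>h\<close>, choose \<open>s' <\<^sub>u s\<close> represented there as well. Then \<open>us'u\<close> is
  represented at \<open>h\<close> and dominated by \<open>u\<close> through \<open>s\<close>.\<close>

lemma star_pt: 
  assumes h: "h \<in> arr G" shows "(pt h)\<^sup>\<star> = pt (ginv G h)"
proof
  show "(pt h)\<^sup>\<star> \<subseteq> pt (ginv G h)" using \<theta>_dom_by(2) by (auto elim!: starE)
  show "pt (ginv G h) \<subseteq> (pt h)\<^sup>\<star>"
  proof
    fix s assume "s \<in> pt (ginv G h)"
    then obtain s' u where u: "s' \<prec>[u] s" "ginv G h \<in> \<theta> s'" using \<theta>_below by (metis pt_iff)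
    then have "h \<in> \<theta> u" using \<theta>_dom_by(2)[OF u] ginv_ginv[OF groupoid_G h] by simp
    then have "u * s' * u \<in> pt h" using \<theta>_ternary[OF h _ u(2)] by simp
    then show "s \<in> (pt h)\<^sup>\<star>" using dom_flip[OF u(1)] by (rule starI)
  qed
qed

lemma coset_pt:
  assumes h: "h \<in> arr G" shows "coset N Z (pt h)"
  unfolding coset_iff
proof (intro conjI ballI)
  show "a * s * b \<in> pt h" if "a \<in> pt h" "s \<in> (pt h)\<^sup>\<star>" "b \<in> pt h" for a s b
    using that \<theta>_ternary[OF h] by (simp add: star_pt[OF h])
  show "rounded (pt h)" unfolding rounded_def
  proof
    fix a assume "a \<in> pt h"
    then obtain b s where "b \<prec>[s] a" "b \<in> pt h" using \<theta>_below by (metis pt_iff)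
    then show "a \<in> (pt h)\<^sup>\<up>" by (intro upI)
  qed
  show "(pt h)\<^sup>\<up> \<subseteq> pt h" using \<theta>_dom_by(1) by (auto elim!: upE)
qed

lemma pt_cosets: "h \<in> arr G \<Longrightarrow> pt h \<in> cosets N Z"
  using coset_pt[of h] \<theta>_cover unfolding cosets_iff pt_def by blast

text \<open>For the inclusion from right to left, \<open>x' < x\<close> is multiplied by \<open>a'r \<in> N\<close>, where \<open>a'\<close> is represented
  at \<open>g\<close> and \<open>r\<close> at its inverse; this splits off a factor represented at \<open>g\<close>.\<close>

lemma pt_mult:
  assumes gh: "(g, h) \<in> composable G" shows "(pt g * pt h)\<^sup>\<up> = pt (gmult G g h)"
proof
  let ?k = "gmult G g h"
  have arr: "g \<in> arr G" "h \<in> arr G" "?k \<in> arr G" using gh gmult_arr[OF groupoid_G gh] by (auto dest: composableD)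
  show "(pt g * pt h)\<^sup>\<up> \<subseteq> pt ?k"
    using \<theta>_multI[OF _ _ gh] \<theta>_dom_by(1) by (auto elim!: up_timesE)
  show "pt ?k \<subseteq> (pt g * pt h)\<^sup>\<up>"
  proof
    fix x assume "x \<in> pt ?k"
    then obtain x' p where x': "x' \<in> pt ?k" "x' \<prec>[p] x" by (meson coset_pt[OF arr(3)] cosetE)
    obtain a where "a \<in> pt g" using pt_cosets[OF arr(1)] by (auto simp: cosets_iff)
    then obtain a' r where a': "a' \<in> pt g" "a' \<prec>[r] a" "r \<in> (pt g)\<^sup>\<star>" by (meson coset_pt[OF arr(1)] cosetE)
    have "(ginv G g, ?k) \<in> composable G"
      using arr ginv_arr[OF groupoid_G arr(1)] gsrc_ginv[OF groupoid_G arr(1)] grng_gmult[OF groupoid_G gh]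
      by (auto intro: composableI)
    then have "r * x' \<in> pt h"
      using \<theta>_multI a'(3) x'(1) gmult_cancel_left[OF groupoid_G gh] by (metis pt_iff star_pt[OF arr(1)])
    then have "a' * (r * x') \<in> pt g * pt h" using a'(1) by (intro set_times_intro)
    moreover have "a' * r * x' \<prec>[p] x" by (rule dom_N_left[OF x'(2) dom_byD(1)[OF a'(2)]])
    ultimately show "x \<in> (pt g * pt h)\<^sup>\<up>" by (intro upI) (simp_all add: mult.assoc)
  qed
qed

lemma src_pt: "h \<in> arr G \<Longrightarrow> src (pt h) = pt (gsrc G h)"
  using pt_mult[OF ginv_composable(1)[OF groupoid_G]] by (simp add: star_pt gsrc_def)

lemma rng_pt: "h \<in> arr G \<Longrightarrow> rng (pt h) = pt (grng G h)"
  using pt_mult[OF ginv_composable(2)[OF groupoid_G]] by (simp add: star_pt grng_def)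

lemma composable_pt: "(g, h) \<in> composable G \<Longrightarrow> (pt g, pt h) \<in> composable CG"
  by (auto simp: composable_def pt_cosets src_pt rng_pt)

lemma continuous_map_pt: "continuous_map (gtop G) (gtop CG) pt"
proof (rule continuous_map_into_CG)
  show "pt h \<in> cosets N Z" if "h \<in> topspace (gtop G)" for h using pt_cosets[OF that] .
  fix a
  have "{h \<in> arr G. a \<in> pt h} = \<theta> a" using \<theta>_arr by auto
  then show "openin (gtop G) {h \<in> arr G. a \<in> pt h}" using open_\<theta> by simp
qed

definition \<phi> :: "('a set \<times> 'h) set" where "\<phi> = {(pt h, h) | h. h \<in> arr G}"

lemma \<phi>_iff: "(C, h) \<in> \<phi> \<longleftrightarrow> h \<in> arr G \<and> C = pt h"
  by (auto simp: \<phi>_def)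

text \<open>Star-bijectivity: for \<open>a \<in> C\<close>, the unit \<open>h\<close> is represented by some \<open>ar\<close> and so is the range of an
  arrow \<open>i\<close> in \<open>\<theta> a\<close>. Then \<open>C\<close> and \<open>pt i\<close> share \<open>a\<close> and their range, and \<open>i\<close> is the only arrow of
  the slice \<open>\<theta> a\<close> with range \<open>h\<close>.\<close>

lemma zakrzewski_morphism_\<phi>: "zakrzewski_morphism CG G \<phi>"
  unfolding zakrzewski_morphism_def
proof (intro conjI allI impI)
  show "\<phi> \<subseteq> arr CG \<times> arr G" by (auto simp: \<phi>_iff pt_cosets)
  show "functorial CG G \<phi>"
    unfolding functorial_def
    using composable_pt pt_mult gmult_arr[OF groupoid_G] ginv_arr[OF groupoid_G]
    by (auto simp: \<phi>_iff star_pt src_pt rng_pt composable_def)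
  show "star_bijective CG G \<phi>"
    unfolding star_bijective_def
  proof (intro ballI impI)
    fix C h assume "C \<in> arr CG" and h: "h \<in> units G" and "(grng CG C, h) \<in> \<phi>"
    then have C: "coset N Z C" "C \<noteq> {}" and rng: "rng C = pt h" by (auto simp: cosets_iff \<phi>_iff)
    obtain a where "a \<in> C" using C(2) by blast
    then obtain c r where c: "c \<in> C" "c \<prec>[r] a" "r \<in> C\<^sup>\<star>" by (meson C(1) cosetE)
    have "h \<in> \<theta> (a * r)" using subset_rng[OF C(1) c(3) \<open>a \<in> C\<close>] rng by simp
    then obtain i k where i: "i \<in> \<theta> a" "(i, k) \<in> composable G" "h = gmult G i k" by (meson \<theta>_multE)
    have ir: "i \<in> arr G" "grng G i = h"
      using i \<theta>_arr grng_gmult[OF groupoid_G i(2)] unitsD(3)[OF groupoid_G h] by auto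
    have "rng (pt i) = rng C" using rng rng_pt[OF ir(1)] ir(2) by simp
    then have "C = pt i"
      using slice_eq_rng[of C "pt i" a] slice_eq_rng[of "pt i" C a] C(1) coset_pt[OF ir(1)] \<open>a \<in> C\<close> i(1) by auto
    moreover have "j = i" if "j \<in> arr G" "grng G j = h" "C = pt j" for j
      using slice_rng[of j a i] that ir i(1) \<open>a \<in> C\<close> by auto
    ultimately show "\<exists>!i. i \<in> arr G \<and> grng G i = h \<and> (C, i) \<in> \<phi>"
      using ir unfolding \<phi>_iff by metis
  qed
  fix U assume "openin (gtop CG) U"
  then have "openin (gtop G) {h \<in> topspace (gtop G). pt h \<in> U}"
    by (rule openin_continuous_map_preimage[OF continuous_map_pt])
  moreover have "\<phi> `` U = {h \<in> topspace (gtop G). pt h \<in> U}" by (auto simp: \<phi>_iff)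
  ultimately show "openin (gtop G) (\<phi> `` U)" by simp
qed

end

section \<open>The universal property\<close>

locale bundle_rep = etale_rep N Z "base_gpd \<pi>" "\<lambda>a. dom (\<Theta> a)"
  for N Z :: "'a::semigroup_mult set" and \<pi> :: "('e, 'h) gpd_bundle" and \<Theta> :: "'a \<Rightarrow> ('h \<rightharpoonup> 'e)" +
  assumes bundle_rep: "bundle_representation N Z \<pi> \<Theta>"
begin

abbreviation "E \<equiv> total_gpd \<pi>"
abbreviation "H \<equiv> base_gpd \<pi>"
abbreviation "val a h \<equiv> the (\<Theta> a h)"

lemma groupoid_E: "groupoid E" and proj_functor: "gfunctor E H (proj \<pi>)" and inj_units: "inj_on (proj \<pi>) (units E)"
  using bundle_rep by (auto simp: bundle_representation_def groupoid_bundle_def topological_groupoid_def)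

lemma
  shows val_continuous: "continuous_map (subtopology (gtop H) (dom (\<Theta> a))) (gtop E) (val a)"
    and proj_val: "h \<in> dom (\<Theta> a) \<Longrightarrow> proj \<pi> (val a h) = h"
    and \<Theta>_mult: "\<Theta> (a * b) = section_mult \<pi> (\<Theta> a) (\<Theta> b)"
  using bundle_rep unfolding bundle_representation_def slice_sections_def by blast+

lemma val_arr: "h \<in> dom (\<Theta> a) \<Longrightarrow> val a h \<in> arr E"
  using continuous_map_funspace[OF val_continuous[of a]] \<theta>_arr[of h a] by auto

text \<open>Injectivity on units lets composability be tested in the base.\<close>

lemma composable_E:
  assumes "e \<in> arr E" "f \<in> arr E" "(proj \<pi> e, proj \<pi> f) \<in> composable H"
  shows "(e, f) \<in> composable E"
proof (rule composableI[OF assms(1,2)])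
  have "proj \<pi> (gsrc E e) = proj \<pi> (grng E f)"
    using gfunctor_gsrc[OF groupoid_E groupoid_G proj_functor] gfunctor_grng[OF groupoid_E groupoid_G proj_functor]
      assms composableD(3) by fastforce
  then show "gsrc E e = grng E f"
    using inj_units gsrc_units grng_units[OF groupoid_E] assms by (meson inj_onD)
qed

lemma composable_val:
  "g \<in> dom (\<Theta> a) \<Longrightarrow> h \<in> dom (\<Theta> b) \<Longrightarrow> (g, h) \<in> composable H \<Longrightarrow> (val a g, val b h) \<in> composable E"
  by (intro composable_E val_arr) (simp_all add: proj_val)

lemma val_mult:
  assumes g: "g \<in> dom (\<Theta> a)" and h: "h \<in> dom (\<Theta> b)" and gh: "(g, h) \<in> composable H"
  shows "val (a * b) (gmult H g h) = gmult E (val a g) (val b h)"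
proof -
  have "gmult H g h \<in> slice_mult H (dom (\<Theta> a)) (dom (\<Theta> b))"
    using assms unfolding slice_mult_def by blast
  moreover have "(THE f. \<exists>g'\<in>dom (\<Theta> a). \<exists>h'\<in>dom (\<Theta> b). (g', h') \<in> composable H \<and>
      gmult H g h = gmult H g' h' \<and> f = gmult E (val a g') (val b h')) = gmult E (val a g) (val b h)"
  proof (rule the_equality)
    show "\<exists>g'\<in>dom (\<Theta> a). \<exists>h'\<in>dom (\<Theta> b). (g', h') \<in> composable H \<and>
      gmult H g h = gmult H g' h' \<and> gmult E (val a g) (val b h) = gmult E (val a g') (val b h')"
      using assms by blast
    fix f assume "\<exists>g'\<in>dom (\<Theta> a). \<exists>h'\<in>dom (\<Theta> b). (g', h') \<in> composable H \<and>
      gmult H g h = gmult H g' h' \<and> f = gmult E (val a g') (val b h')"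
    then obtain g' h' where *: "g' \<in> dom (\<Theta> a)" "h' \<in> dom (\<Theta> b)" "(g', h') \<in> composable H"
      "gmult H g h = gmult H g' h'" "f = gmult E (val a g') (val b h')" by blast
    have "grng H g = grng H g'" "gsrc H h = gsrc H h'"
      using grng_gmult[OF groupoid_G gh] grng_gmult[OF groupoid_G *(3)]
        gsrc_gmult[OF groupoid_G gh] gsrc_gmult[OF groupoid_G *(3)] *(4) by simp_all
    then have "g = g'" "h = h'" using slice_rng[OF g *(1)] slice_src[OF h *(2)] by blast+
    then show "f = gmult E (val a g) (val b h)" using *(5) by simp
  qed
  ultimately show ?thesis by (simp add: \<Theta>_mult section_mult_def)
qed

text \<open>The equation \<open>s a t = s b t\<close> is evaluated at \<open>h\<inverse> = h\<inverse> h h\<inverse>\<close>, and the values of \<open>s\<close> and \<open>t\<close> at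
  \<open>h\<inverse>\<close> are cancelled.\<close>

lemma germ_rel_val:
  assumes h: "h \<in> arr H" and ab: "(a, b) \<in> germ_rel N Z (pt h)"
  shows "val a h = val b h"
proof -
  let ?i = "ginv H h"
  obtain s t where s: "h \<in> dom (\<Theta> a)" "h \<in> dom (\<Theta> b)" "?i \<in> dom (\<Theta> s)" "?i \<in> dom (\<Theta> t)"
    and eq: "s * a * t = s * b * t"
    using ab by (auto simp: germ_rel_coset[OF coset_pt[OF h]] star_pt[OF h])
  note c1 = ginv_composable(1)[OF groupoid_G h]
  have c2: "(gsrc H h, ?i) \<in> composable H"
    using gsrc_arr[OF groupoid_G h] gsrc_gsrc[OF groupoid_G h] ginv_arr[OF groupoid_G h] grng_ginv[OF groupoid_G h]
    by (auto intro: composableI)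
  have expand: "val (s * x * t) (gmult H (gsrc H h) ?i) = gmult E (gmult E (val s ?i) (val x h)) (val t ?i)"
    and comp: "(val s ?i, val x h) \<in> composable E" "(gmult E (val s ?i) (val x h), val t ?i) \<in> composable E"
    if x: "h \<in> dom (\<Theta> x)" for x
  proof -
    have u: "gsrc H h \<in> dom (\<Theta> (s * x))" using \<theta>_multI[OF s(3) x c1] by (simp add: gsrc_def)
    have v: "val (s * x) (gsrc H h) = gmult E (val s ?i) (val x h)"
      using val_mult[OF s(3) x c1] by (simp add: gsrc_def)
    show "val (s * x * t) (gmult H (gsrc H h) ?i) = gmult E (gmult E (val s ?i) (val x h)) (val t ?i)"
      using val_mult[OF u s(4) c2] v by simp
    show "(val s ?i, val x h) \<in> composable E" using composable_val[OF s(3) x c1] .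
    show "(gmult E (val s ?i) (val x h), val t ?i) \<in> composable E" using composable_val[OF u s(4) c2] v by simp
  qed
  have "gmult E (val s ?i) (val a h) = gmult E (val s ?i) (val b h)"
    using gmult_cancel_right[OF groupoid_E comp(2)[OF s(1)]] gmult_cancel_right[OF groupoid_E comp(2)[OF s(2)]]
      expand[OF s(1)] expand[OF s(2)] eq by simp
  then show ?thesis
    using gmult_cancel_left[OF groupoid_E comp(1)[OF s(1)]] gmult_cancel_left[OF groupoid_E comp(1)[OF s(2)]] by metis
qed

abbreviation "PB \<equiv> pullback (coset_bundle N Z) H \<phi>"

lemma arr_PB: "arr PB = {(germ N Z a (pt h), h) | a h. h \<in> dom (\<Theta> a)}"
proof -
  have "arr PB = {(p, h). p \<in> germs N Z \<and> h \<in> arr H \<and> snd p = pt h}"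
    by (auto simp: pullback_def \<phi>_iff)
  also have "\<dots> = {(germ N Z a (pt h), h) | a h. h \<in> dom (\<Theta> a)}"
  proof (intro equalityI subsetI)
    fix x assume "x \<in> {(p, h). p \<in> germs N Z \<and> h \<in> arr H \<and> snd p = pt h}"
    then obtain p h where x: "x = (p, h)" "p \<in> germs N Z" "snd p = pt h" by auto
    obtain a C where "p = germ N Z a C" "coset N Z C" "a \<in> C" using x(2) by (rule germsE)
    with x have "x = (germ N Z a (pt h), h)" "h \<in> dom (\<Theta> a)" by (auto simp: snd_germ)
    then show "x \<in> {(germ N Z a (pt h), h) | a h. h \<in> dom (\<Theta> a)}" by blast
  next
    fix x assume "x \<in> {(germ N Z a (pt h), h) | a h. h \<in> dom (\<Theta> a)}"
    then obtain a h where x: "x = (germ N Z a (pt h), h)" "h \<in> dom (\<Theta> a)" by blast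
    then have harr: "h \<in> arr H" by (intro \<theta>_arr)
    show "x \<in> {(p, h). p \<in> germs N Z \<and> h \<in> arr H \<and> snd p = pt h}"
      using x harr germ_in_germs[OF coset_pt[OF harr], of a] snd_germ[OF coset_pt[OF harr]] by simp
  qed
  finally show ?thesis .
qed

text \<open>The choice of the representative \<open>a\<close> is immaterial by \<open>germ_rel_val\<close>.\<close>

definition \<tau> :: "('a set \<times> 'a set) \<times> 'h \<Rightarrow> 'e" where
  "\<tau> = (\<lambda>(p, h)\<in>arr PB. val (SOME a. h \<in> dom (\<Theta> a) \<and> p = germ N Z a (pt h)) h)"

lemma \<tau>_germ:
  assumes h: "h \<in> dom (\<Theta> a)" shows "\<tau> (germ N Z a (pt h), h) = val a h"
proof -
  have harr: "h \<in> arr H" using h by (rule \<theta>_arr)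
  define b where "b = (SOME b. h \<in> dom (\<Theta> b) \<and> germ N Z a (pt h) = germ N Z b (pt h))"
  have b: "h \<in> dom (\<Theta> b) \<and> germ N Z a (pt h) = germ N Z b (pt h)"
    unfolding b_def by (rule someI[of _ a]) (use h in simp)
  then have "(a, b) \<in> germ_rel N Z (pt h)"
    using germ_eq_iff[OF coset_pt[OF harr], of a b] h by (metis pt_iff)
  then have "val a h = val b h" by (rule germ_rel_val[OF harr])
  moreover have "\<tau> (germ N Z a (pt h), h) = val b h"
    unfolding \<tau>_def b_def using h by (subst restrict_apply') (auto simp: arr_PB)
  ultimately show ?thesis by simp
qed

lemma PB_simps:
  "gmult PB (p, g) (q, h) = (germ_mult N Z p q, gmult H g h)"
  "gsrc PB (p, g) = (gsrc FG p, gsrc H g)" "grng PB (p, g) = (grng FG p, grng H g)"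
  by (simp_all add: pullback_def gsrc_def grng_def)

lemma gfunctor_\<tau>: "gfunctor PB E \<tau>"
  unfolding gfunctor_def
proof (intro conjI ballI)
  show "\<tau> ` arr PB \<subseteq> arr E"
  proof (rule image_subsetI)
    fix x assume "x \<in> arr PB"
    then obtain a h where "x = (germ N Z a (pt h), h)" "h \<in> dom (\<Theta> a)" unfolding arr_PB by blast
    then show "\<tau> x \<in> arr E" using val_arr \<tau>_germ by metis
  qed
  fix x assume x: "x \<in> composable PB"
  then obtain y z where yz: "x = (y, z)" "y \<in> arr PB" "z \<in> arr PB" "gsrc PB y = grng PB z"
    by (auto simp: composable_def)
  then obtain a g b h where y: "y = (germ N Z a (pt g), g)" "g \<in> dom (\<Theta> a)"
    and z: "z = (germ N Z b (pt h), h)" "h \<in> dom (\<Theta> b)" unfolding arr_PB by blast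
  have gh: "(g, h) \<in> composable H"
    using yz(4) y z \<theta>_arr by (auto simp: PB_simps intro: composableI)
  have m: "matching (pt g) (pt h)" using composable_pt[OF gh] by (simp add: composable_CG)
  have "gmult PB y z = (germ N Z (a * b) (pt (gmult H g h)), gmult H g h)"
    unfolding y z using y z by (simp add: PB_simps germ_mult_eq[OF m] pt_mult[OF gh])
  moreover have "gmult H g h \<in> dom (\<Theta> (a * b))" using \<theta>_multI[OF y(2) z(2) gh] .
  ultimately have "\<tau> (gmult PB y z) = gmult E (\<tau> y) (\<tau> z)"
    using val_mult[OF y(2) z(2) gh] y z by (simp only: \<tau>_germ)
  moreover have "(\<tau> y, \<tau> z) \<in> composable E"
    using composable_val[OF y(2) z(2) gh] y z by (simp only: \<tau>_germ)
  ultimately show "case x of (e, f) \<Rightarrow> (\<tau> e, \<tau> f) \<in> composable E \<and> \<tau> (gmult PB e f) = gmult E (\<tau> e) (\<tau> f)"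
    using yz(1) by simp
qed

text \<open>Near a point \<open>([a, pt h], h)\<close> of the pullback, \<open>\<tau>\<close> depends only on the second coordinate and is the
  continuous section \<open>\<Theta> a\<close>.\<close>

lemma continuous_map_\<tau>: "continuous_map (gtop PB) (gtop E) \<tau>"
  unfolding continuous_map_def
proof (intro conjI allI impI)
  show "\<tau> \<in> arr PB \<rightarrow> arr E" using gfunctor_\<tau> by (auto simp: gfunctor_def)
  fix U assume U: "openin (gtop E) U"
  show "openin (gtop PB) {x \<in> arr PB. \<tau> x \<in> U}"
  proof (rule openin_nbhds)
    fix x assume x: "x \<in> {x \<in> arr PB. \<tau> x \<in> U}"
    then obtain a h where ah: "x = (germ N Z a (pt h), h)" "h \<in> dom (\<Theta> a)" unfolding arr_PB by blast
    let ?W = "{h \<in> topspace (subtopology (gtop H) (dom (\<Theta> a))). val a h \<in> U}"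
    have W: "openin (gtop H) ?W"
      using openin_continuous_map_preimage[OF val_continuous U] open_\<theta> by (rule openin_trans_full)
    have P: "openin (prod_topology (gtop FG) (gtop H)) (tilde a \<times> ?W)"
      unfolding openin_prod_Times_iff using W openin_tilde by blast
    let ?V = "(tilde a \<times> ?W) \<inter> {(f, h). (snd f, h) \<in> \<phi>}"
    have "openin (gtop PB) ?V"
      using openin_subtopology_Int[OF P] by (simp add: pullback_def)
    moreover have "x \<in> ?V"
    proof -
      have h: "h \<in> arr H" using ah(2) by (rule \<theta>_arr)
      then have "pt h \<in> cosets_at N Z a" using pt_cosets ah(2) by simp
      then have "germ N Z a (pt h) \<in> tilde a" by blast
      moreover have "val a h \<in> U" using x ah(1) \<tau>_germ[OF ah(2)] by simp
      ultimately show ?thesis using h ah snd_germ[OF coset_pt[OF h]] by (simp add: \<phi>_iff del: cosets_at_iff)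
    qed
    moreover have "?V \<subseteq> {x \<in> arr PB. \<tau> x \<in> U}"
    proof
      fix y assume "y \<in> ?V"
      then obtain f k where fk: "y = (f, k)" "f \<in> tilde a" "k \<in> ?W" "(snd f, k) \<in> \<phi>" by (cases y) blast
      then obtain C where f: "f = germ N Z a C" "C \<in> cosets_at N Z a" by blast
      have y: "y = (germ N Z a C, k)" "C \<in> cosets N Z" "k \<in> dom (\<Theta> a)" "val a k \<in> U"
        "(snd (germ N Z a C), k) \<in> \<phi>" using fk f by auto
      then have "C = pt k" by (simp add: snd_germ cosets_iff \<phi>_iff)
      then show "y \<in> {x \<in> arr PB. \<tau> x \<in> U}" using y(1,3,4) \<tau>_germ[OF y(3)] by (auto simp: arr_PB)
    qed
    ultimately show "\<exists>V. openin (gtop PB) V \<and> x \<in> V \<and> V \<subseteq> {x \<in> arr PB. \<tau> x \<in> U}" by blast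
  qed
qed

lemma pierce_morphism_\<phi>\<tau>: "pierce_morphism (coset_bundle N Z) \<pi> \<phi> \<tau>"
  unfolding pierce_morphism_def zakrzewski_pierce_morphism_def
proof (intro conjI)
  show "zakrzewski_morphism (base_gpd (coset_bundle N Z)) H \<phi>" using zakrzewski_morphism_\<phi> by simp
  show "\<tau> \<in> extensional (arr PB)" by (simp add: \<tau>_def)
  show "continuous_map (gtop PB) (gtop E) \<tau>" by (rule continuous_map_\<tau>)
  show "gfunctor PB E \<tau>" by (rule gfunctor_\<tau>)
  show "\<forall>(f, h)\<in>arr PB. proj \<pi> (\<tau> (f, h)) = h"
  proof
    fix x assume "x \<in> arr PB"
    then obtain a h where "x = (germ N Z a (pt h), h)" "h \<in> dom (\<Theta> a)" unfolding arr_PB by blast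
    then show "case x of (f, h) \<Rightarrow> proj \<pi> (\<tau> (f, h)) = h" using proj_val \<tau>_germ by auto
  qed
  show "single_valued (\<phi>\<inverse>)" by (auto simp: single_valued_def \<phi>_iff)
qed

lemma induced_section_eq:
  assumes sv: "single_valued (\<psi>\<inverse>)" and C: "(C, h) \<in> \<psi>" "C \<in> cosets_at N Z a"
  shows "induced_section \<psi> \<sigma> (coset_section N Z a) h = Some (\<sigma> (germ N Z a C, h))"
proof -
  have "(THE g. g \<in> cosets_at N Z a \<and> (g, h) \<in> \<psi>) = C"
    using C sv by (intro the_equality) (auto simp: single_valued_def)
  moreover have "h \<in> \<psi> `` cosets_at N Z a" using C by blast
  ultimately show ?thesis using C(2) by (simp add: induced_section_def dom_coset_section coset_section_eq del: cosets_at_iff)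
qed

lemma induced_section_\<phi>\<tau>: "\<Theta> = induced_section \<phi> \<tau> \<circ> coset_section N Z"
proof (rule ext, rule ext)
  fix a h
  show "\<Theta> a h = (induced_section \<phi> \<tau> \<circ> coset_section N Z) a h"
  proof (cases "h \<in> dom (\<Theta> a)")
    case True
    then have harr: "h \<in> arr H" by (rule \<theta>_arr)
    have "induced_section \<phi> \<tau> (coset_section N Z a) h = Some (\<tau> (germ N Z a (pt h), h))"
      using pierce_morphism_\<phi>\<tau> pt_cosets[OF harr] True harr
      by (intro induced_section_eq) (auto simp: pierce_morphism_def \<phi>_iff)
    then show ?thesis using True \<tau>_germ[OF True] by auto
  next
    case False
    then have "h \<notin> \<phi> `` dom (coset_section N Z a)"
      by (auto simp: \<phi>_iff coset_section_def split: if_splits)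
    then show ?thesis using False by (auto simp: induced_section_def)
  qed
qed

text \<open>Equality of domains forces \<open>C = pt h\<close> whenever \<open>C\<close> is related to \<open>h\<close>, and every \<open>h\<close> is related to
  something because the domains cover; equality of values then determines \<open>\<sigma>\<close> on every germ.\<close>

lemma pierce_morphism_unique:
  assumes pm: "pierce_morphism (coset_bundle N Z) \<pi> \<psi> \<sigma>"
    and ind: "\<Theta> = induced_section \<psi> \<sigma> \<circ> coset_section N Z"
  shows "\<psi> = \<phi>" "\<sigma> = \<tau>"
proof -
  have sub: "\<psi> \<subseteq> cosets N Z \<times> arr H" and sv: "single_valued (\<psi>\<inverse>)"
    using pm by (auto simp: pierce_morphism_def zakrzewski_pierce_morphism_def zakrzewski_morphism_def)
  have ext: "\<sigma> \<in> extensional (arr (pullback (coset_bundle N Z) H \<psi>))"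
    using pm by (simp add: pierce_morphism_def zakrzewski_pierce_morphism_def)
  have dom: "h \<in> dom (\<Theta> a) \<longleftrightarrow> (\<exists>C. (C, h) \<in> \<psi> \<and> C \<in> cosets_at N Z a)" for a h
  proof -
    have "\<Theta> a = induced_section \<psi> \<sigma> (coset_section N Z a)" using fun_cong[OF ind, of a] by simp
    then have "h \<in> dom (\<Theta> a) \<longleftrightarrow> h \<in> \<psi> `` dom (coset_section N Z a)"
      by (simp add: induced_section_def domIff)
    then show ?thesis unfolding dom_coset_section by blast
  qed
  have point: "C = pt h" if C: "(C, h) \<in> \<psi>" for C h
  proof -
    have "a \<in> C \<longleftrightarrow> h \<in> dom (\<Theta> a)" for a
      using C sub sv unfolding dom by (auto simp: single_valued_def)
    then show ?thesis by (auto simp: pt_def)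
  qed
  show eq: "\<psi> = \<phi>"
  proof safe
    fix C h assume "(C, h) \<in> \<psi>"
    then show "(C, h) \<in> \<phi>" using point sub by (auto simp: \<phi>_iff)
  next
    fix C h assume "(C, h) \<in> \<phi>"
    then have h: "h \<in> arr H" "C = pt h" by (auto simp: \<phi>_iff)
    then obtain a where "h \<in> dom (\<Theta> a)" using \<theta>_cover by blast
    then obtain C' where "(C', h) \<in> \<psi>" unfolding dom by blast
    then show "(C, h) \<in> \<psi>" using point h(2) by simp
  qed
  show "\<sigma> = \<tau>"
  proof (rule extensionalityI)
    show "\<sigma> \<in> extensional (arr PB)" using ext eq by simp
    show "\<tau> \<in> extensional (arr PB)" by (simp add: \<tau>_def)
    fix x assume "x \<in> arr PB"
    then obtain a h where x: "x = (germ N Z a (pt h), h)" "h \<in> dom (\<Theta> a)" unfolding arr_PB by blast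
    then have h: "h \<in> arr H" using \<theta>_arr by blast
    have "\<Theta> a h = Some (\<sigma> (germ N Z a (pt h), h))"
      unfolding comp_def using induced_section_eq[OF sv, of "pt h" h a \<sigma>] x h pt_cosets[OF h]
      by (subst ind) (simp add: eq \<phi>_iff)
    then show "\<sigma> x = \<tau> x" using x(1) \<tau>_germ[OF x(2)] by simp
  qed
qed

end

theorem theorem10p2:
  fixes N Z :: "'a::semigroup_mult set"
  assumes "structured_semigroup N Z"
    and "symmetric_subset Z"
  shows "universal_bundle_representation TYPE('e) TYPE('h) N Z
           (coset_bundle N Z) (coset_section N Z)"
proof -
  interpret symmetric_structured N Z
    by unfold_locales (fact assms)+
  have "\<exists>!(\<phi>, \<tau>). pierce_morphism (coset_bundle N Z) \<pi>' \<phi> \<tau> \<and> \<theta> = induced_section \<phi> \<tau> \<circ> coset_section N Z"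
    if rep: "bundle_representation N Z \<pi>' \<theta>" for \<pi>' :: "('e, 'h) gpd_bundle" and \<theta>
  proof -
    interpret R: bundle_rep N Z \<pi>' \<theta>
      using rep by unfold_locales (auto simp: bundle_representation_def)
    show ?thesis
    proof (rule ex1I[of _ "(R.\<phi>, R.\<tau>)"])
      show "case (R.\<phi>, R.\<tau>) of (\<phi>, \<tau>) \<Rightarrow> pierce_morphism (coset_bundle N Z) \<pi>' \<phi> \<tau> \<and>
          \<theta> = induced_section \<phi> \<tau> \<circ> coset_section N Z"
        unfolding prod.case using R.pierce_morphism_\<phi>\<tau> R.induced_section_\<phi>\<tau> by (rule conjI)
      fix x assume x: "case x of (\<phi>, \<tau>) \<Rightarrow> pierce_morphism (coset_bundle N Z) \<pi>' \<phi> \<tau> \<and>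
          \<theta> = induced_section \<phi> \<tau> \<circ> coset_section N Z"
      obtain \<psi> \<sigma> where x_eq: "x = (\<psi>, \<sigma>)" by (cases x)
      have pm: "pierce_morphism (coset_bundle N Z) \<pi>' \<psi> \<sigma>"
        and ind: "\<theta> = induced_section \<psi> \<sigma> \<circ> coset_section N Z"
        using x unfolding x_eq prod.case by blast+
      show "x = (R.\<phi>, R.\<tau>)" unfolding x_eq by (simp only: R.pierce_morphism_unique[OF pm ind])
    qed
  qed
  then show ?thesis
    unfolding universal_bundle_representation_def
    using bundle_representation_coset_section by blast
qed

end
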